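(* Let $\mathcal S$, $\mathcal A\subseteq\mathcal S^2$, $\mathcal R\subseteq\mathcal S^3$ be given. The PTSC determined by $(\mathcal S,\mathcal A,\mathcal R)$ is strongly normalising (every ground term $M$ with $\Gamma\vdash M:A$ for some $\Gamma,A$ admits no infinite $\to$-reduction sequence) if and only if the PTS determined by the same $(\mathcal S,\mathcal A,\mathcal R)$ is strongly normalising (every PTS term $t$ with $\Gamma\vdash_{\mathsf{PTS}}t:T$ for some $\Gamma,T$ admits no infinite $\to_\beta$-reduction sequence).
   Context: Ground PTSC syntax: given sorts $\mathcal S$ and variables, terms $M ::= \Pi x^{A}.B \mid \lambda x^{A}.M \mid s \mid x\,l \mid M\,l \mid \langle N/x\rangle_A M$ and lists $l ::= [\,] \mid M\cdot l \mid l @ l' \mid \langle N/x\rangle_A l$ ($\langle N/x\rangle_A$ explicit substitution binding $x$; $\Pi,\lambda$ bind $x$). Reduction $\to$ is the contextual closure of: $(\lambda x^A.M)(N\cdot l)\to(\langle N/x\rangle_A M)\,l$; $M\,[\,]\to M$; $(x\,l)\,l'\to x\,(l@l')$; $(M\,l)\,l'\to M\,(l@l')$; $(M\cdot l')@l\to M\cdot(l'@l)$; $[\,]@l\to l$; $(l@l')@l''\to l@(l'@l'')$; $l@[\,]\to l$; $\langle P/y\rangle_G(\lambda x^A.M)\to\lambda x^{\langle P/y\rangle_G A}.\langle P/y\rangle_G M$; $\langle P/y\rangle_G(y\,l)\to P\,(\langle P/y\rangle_G l)$; $\langle P/y\rangle_G(x\,l)\to x\,(\langle P/y\rangle_G l)$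 ($x\ne y$); $\langle P/y\rangle_G(M\,l)\to(\langle P/y\rangle_G M)(\langle P/y\rangle_G l)$; $\langle P/y\rangle_G(\Pi x^A.B)\to\Pi x^{\langle P/y\rangle_G A}.\langle P/y\rangle_G B$; $\langle P/y\rangle_G s\to s$; $\langle P/y\rangle_G[\,]\to[\,]$; $\langle P/y\rangle_G(M\cdot l)\to(\langle P/y\rangle_G M)\cdot(\langle P/y\rangle_G l)$; $\langle P/y\rangle_G(l@l')\to(\langle P/y\rangle_G l)@(\langle P/y\rangle_G l')$; $\leftrightarrow^*$ is the induced equivalence. PTSC typing (parameters $\mathcal A$, $\mathcal R$): environments are lists of $(x:A)$; $\langle P/x\rangle_A\Delta$ applies the substitution to every type of $\Delta$; $\Gamma\sqsubseteq\Delta$ means each $(x:A)\in\Gamma$ has some $(x:B)\in\Delta$ with $A\leftrightarrow^*B$. Rules: $\emptyset\ \mathsf{wf}$; $\Gamma\vdash A:s$, $x\notin\mathrm{dom}\,\Gamma\Rightarrow\Gamma,(x:A)\ \mathsf{wf}$; $\Gamma\ \mathsf{wf}$, $(s,s')\in\mathcal A\Rightarrow\Gamma\vdash s:s'$; $\Gamma\vdash A:s_1$, $\Gamma,(x:A)\vdash B:s_2$, $(s_1,s_2,s_3)\in\mathcal R\Rightarrow\Gamma\vdash\Pi x^A.B:s_3$; $\Gamma\vdash\Pi x^A.B:s$, $\Gamma,(x:A)\vdash M:B\Rightarrow\Gamma\vdash\lambda x^A.M:\Pi x^A.B$; $\Gamma;A\vdash l:B$, $(x:A)\in\Gamma\Rightarrow\Gamma\vdash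 x\,l:B$; $\Gamma\vdash A:s\Rightarrow\Gamma;A\vdash[\,]:A$; $\Gamma\vdash M:A$, $\Gamma\vdash B:s$, $A\leftrightarrow^*B\Rightarrow\Gamma\vdash M:B$; $\Gamma\vdash\Pi x^A.B:s$, $\Gamma\vdash M:A$, $\Gamma;\langle M/x\rangle_A B\vdash l:C\Rightarrow\Gamma;\Pi x^A.B\vdash M\cdot l:C$; $\Gamma;C\vdash l:A$, $\Gamma\vdash B:s$, $A\leftrightarrow^*B\Rightarrow\Gamma;C\vdash l:B$; $\Gamma;A\vdash l:C$, $\Gamma\vdash B:s$, $A\leftrightarrow^*B\Rightarrow\Gamma;B\vdash l:C$; $\Gamma;C\vdash l':A$, $\Gamma;A\vdash l:B\Rightarrow\Gamma;C\vdash l'@l:B$; $\Gamma\vdash P:A$, $\Gamma,(x:A),\Delta;B\vdash l:C$, $\Gamma,\langle P/x\rangle_A\Delta\sqsubseteq\Delta'$, $\Delta'\ \mathsf{wf}\Rightarrow\Delta';\langle P/x\rangle_A B\vdash\langle P/x\rangle_A l:\langle P/x\rangle_A C$; $\Gamma\vdash M:A$, $\Gamma;A\vdash l:B\Rightarrow\Gamma\vdash M\,l:B$; $\Gamma\vdash P:A$, $\Gamma,(x:A),\Delta\vdash M:C$, $\Gamma,\langle P/x\rangle_A\Delta\sqsubseteq\Delta'$, $\Delta'\ \mathsf{wf}\Rightarrow\Delta'\vdash\langle P/x\rangle_A M:C'$ with $C'=C$ if $C\in\mathcal S$, else $C'=\langle P/x\rangle_A C$. PTS: terms $t,u,T,U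 ::= x\mid s\mid\Pi x^T.t\mid\lambda x^T.t\mid t\,u$, $\to_\beta$ the contextual closure of $(\lambda x^v.t)u\to t\{x:=u\}$, $\leftrightarrow_\beta^*$ its equivalence. PTS typing rules (same $\mathcal S,\mathcal A,\mathcal R$): $\emptyset\ \mathsf{wf}$; $\Gamma\vdash_{\mathsf{PTS}}T:s$, $x\notin\mathrm{dom}\,\Gamma\Rightarrow\Gamma,(x:T)\ \mathsf{wf}$; $\Gamma\ \mathsf{wf}$, $(x:T)\in\Gamma\Rightarrow\Gamma\vdash_{\mathsf{PTS}}x:T$; $\Gamma\ \mathsf{wf}$, $(s,s')\in\mathcal A\Rightarrow\Gamma\vdash_{\mathsf{PTS}}s:s'$; $\Gamma\vdash_{\mathsf{PTS}}U:s_1$, $\Gamma,(x:U)\vdash_{\mathsf{PTS}}T:s_2$, $(s_1,s_2,s_3)\in\mathcal R\Rightarrow\Gamma\vdash_{\mathsf{PTS}}\Pi x^U.T:s_3$; $\Gamma\vdash_{\mathsf{PTS}}\Pi x^U.T:s$, $\Gamma,(x:U)\vdash_{\mathsf{PTS}}t:T\Rightarrow\Gamma\vdash_{\mathsf{PTS}}\lambda x^U.t:\Pi x^U.T$; $\Gamma\vdash_{\mathsf{PTS}}t:\Pi x^U.T$, $\Gamma\vdash_{\mathsf{PTS}}u:U\Rightarrow\Gamma\vdash_{\mathsf{PTS}}t\,u:T\{x:=u\}$; $\Gamma\vdash_{\mathsf{PTS}}t:U$, $\Gamma\vdash_{\mathsf{PTS}}V:s$, $U\leftrightarrow_\beta^*V\Rightarrow\Gamma\vdash_{\mathsf{PTS}}t:V$.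 *)

theory Defs
  imports Main
begin

text \<open>
  Variables are natural numbers, terms are taken up to alpha-equivalence, and the type variable
  \<open>'s\<close> is the set of sorts. To represent alpha-equivalence classes, a body in the scope of a binder
  uses 0 for the bound variable and \<open>Suc n\<close> for the outer variable \<open>n\<close>. At top level, however,
  a variable is simply a name: environments are lists of (name, type) pairs, and the functions
  \<open>bind_trm\<close>, \<open>bind_lst\<close> and \<open>bind_pts\<close> abstract a name. With the named binders \<open>PI\<close>, \<open>LAM\<close>,
  \<open>SUB\<close>, ... built from them, reduction and typing are stated with named variables; the freshness
  side conditions are those left implicit by the variable convention.
\<close>

definition strongly_normalising :: "('a \<Rightarrow> 'a \<Rightarrow> bool) \<Rightarrow> 'a \<Rightarrow> bool" where
  "strongly_normalising r t \<longleftrightarrow> \<not> (\<exists>f :: nat \<Rightarrow> 'a. f 0 = t \<and> (\<forall>n. r (f n) (f (Suc n))))"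

definition up :: "(nat \<Rightarrow> nat) \<Rightarrow> nat \<Rightarrow> nat" where
  "up \<rho> = case_nat 0 (\<lambda>n. Suc (\<rho> n))"

text \<open>Renaming turning the name \<open>x\<close> into the variable bound by the enclosing binder.\<close>

definition capture :: "nat \<Rightarrow> nat \<Rightarrow> nat" where
  "capture x = (\<lambda>n. if n = x then 0 else Suc n)"


section \<open>PTSC: terms and lists\<close>

text \<open>The last argument of \<open>Pi\<close>, \<open>Lam\<close>, \<open>TSub\<close> and \<open>LSub\<close> is in the scope of the bound variable.
  \<open>TSub N A M\<close> is the explicit substitution of \<open>N\<close> in \<open>M\<close>, with annotation \<open>A\<close>.\<close>

datatype 's trm =
    Pi "'s trm" "'s trm"
  | Lam "'s trm" "'s trm"
  | Sort 's
  | VApp nat "'s lst"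
  | TApp "'s trm" "'s lst"
  | TSub "'s trm" "'s trm" "'s trm"
and 's lst =
    LNil
  | LCons "'s trm" "'s lst"
  | LAppend "'s lst" "'s lst"
  | LSub "'s trm" "'s trm" "'s lst"

primrec ren_trm :: "(nat \<Rightarrow> nat) \<Rightarrow> 's trm \<Rightarrow> 's trm"
  and ren_lst :: "(nat \<Rightarrow> nat) \<Rightarrow> 's lst \<Rightarrow> 's lst" where
  "ren_trm \<rho> (Pi A B) = Pi (ren_trm \<rho> A) (ren_trm (up \<rho>) B)"
| "ren_trm \<rho> (Lam A M) = Lam (ren_trm \<rho> A) (ren_trm (up \<rho>) M)"
| "ren_trm \<rho> (Sort s) = Sort s"
| "ren_trm \<rho> (VApp x l) = VApp (\<rho> x) (ren_lst \<rho> l)"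
| "ren_trm \<rho> (TApp M l) = TApp (ren_trm \<rho> M) (ren_lst \<rho> l)"
| "ren_trm \<rho> (TSub N A M) = TSub (ren_trm \<rho> N) (ren_trm \<rho> A) (ren_trm (up \<rho>) M)"
| "ren_lst \<rho> LNil = LNil"
| "ren_lst \<rho> (LCons M l) = LCons (ren_trm \<rho> M) (ren_lst \<rho> l)"
| "ren_lst \<rho> (LAppend l l') = LAppend (ren_lst \<rho> l) (ren_lst \<rho> l')"
| "ren_lst \<rho> (LSub N A l) = LSub (ren_trm \<rho> N) (ren_trm \<rho> A) (ren_lst (up \<rho>) l)"

primrec fv_trm :: "'s trm \<Rightarrow> nat set" and fv_lst :: "'s lst \<Rightarrow> nat set" where
  "fv_trm (Pi A B) = fv_trm A \<union> Suc -` fv_trm B"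
| "fv_trm (Lam A M) = fv_trm A \<union> Suc -` fv_trm M"
| "fv_trm (Sort s) = {}"
| "fv_trm (VApp x l) = insert x (fv_lst l)"
| "fv_trm (TApp M l) = fv_trm M \<union> fv_lst l"
| "fv_trm (TSub N A M) = fv_trm N \<union> fv_trm A \<union> Suc -` fv_trm M"
| "fv_lst LNil = {}"
| "fv_lst (LCons M l) = fv_trm M \<union> fv_lst l"
| "fv_lst (LAppend l l') = fv_lst l \<union> fv_lst l'"
| "fv_lst (LSub N A l) = fv_trm N \<union> fv_trm A \<union> Suc -` fv_lst l"

definition bind_trm :: "nat \<Rightarrow> 's trm \<Rightarrow> 's trm" where
  "bind_trm x M = ren_trm (capture x) M"

definition bind_lst :: "nat \<Rightarrow> 's lst \<Rightarrow> 's lst" where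
  "bind_lst x l = ren_lst (capture x) l"

text \<open>Named binders; only the last argument is in the scope of \<open>x\<close>. \<open>SUB N x A M\<close> reads
  \<open>\<langle>N/x\<rangle>\<^sub>A M\<close>.\<close>

abbreviation PI :: "nat \<Rightarrow> 's trm \<Rightarrow> 's trm \<Rightarrow> 's trm" where
  "PI x A B \<equiv> Pi A (bind_trm x B)"

abbreviation LAM :: "nat \<Rightarrow> 's trm \<Rightarrow> 's trm \<Rightarrow> 's trm" where
  "LAM x A M \<equiv> Lam A (bind_trm x M)"

abbreviation SUB :: "'s trm \<Rightarrow> nat \<Rightarrow> 's trm \<Rightarrow> 's trm \<Rightarrow> 's trm" where
  "SUB N x A M \<equiv> TSub N A (bind_trm x M)"

abbreviation SUBL :: "'s trm \<Rightarrow> nat \<Rightarrow> 's trm \<Rightarrow> 's lst \<Rightarrow> 's lst" where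
  "SUBL N x A l \<equiv> LSub N A (bind_lst x l)"

text \<open>Adequacy of the encoding: every body is the abstraction of a name, which can be any fresh one
  (\<open>PI_named\<close>); renaming the bound name to a fresh one does not change the term (\<open>PI_alpha\<close>); and
  abstraction of a given name is injective (\<open>bind_inj\<close>).\<close>

lemma up_comp: "up (\<sigma> \<circ> \<rho>) = up \<sigma> \<circ> up \<rho>"
  by (auto simp: up_def fun_eq_iff split: nat.split)

lemma ren_comp:
  "ren_trm \<sigma> (ren_trm \<rho> (M :: 's trm)) = ren_trm (\<sigma> \<circ> \<rho>) M"
  "ren_lst \<sigma> (ren_lst \<rho> (l :: 's lst)) = ren_lst (\<sigma> \<circ> \<rho>) l"
  by (induction M and l arbitrary: \<sigma> \<rho> and \<sigma> \<rho>) (auto simp: up_comp)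

lemma up_cong: "\<forall>n\<in>A \<union> Suc -` B. \<sigma> n = \<rho> n \<Longrightarrow> \<forall>n\<in>B. up \<sigma> n = up \<rho> n"
  by (auto simp: up_def split: nat.split)

lemma up_id: "up id = id"
  by (auto simp: up_def fun_eq_iff split: nat.split)

lemma ren_cong:
  "\<forall>n\<in>fv_trm (M :: 's trm). \<sigma> n = \<rho> n \<Longrightarrow> ren_trm \<sigma> M = ren_trm \<rho> M"
  "\<forall>n\<in>fv_lst (l :: 's lst). \<sigma> n = \<rho> n \<Longrightarrow> ren_lst \<sigma> l = ren_lst \<rho> l"
proof (induction M and l arbitrary: \<sigma> \<rho> and \<sigma> \<rho>)
  case (Pi A B)
  with up_cong[of "fv_trm A" "fv_trm B" \<sigma> \<rho>] show ?case by auto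
next
  case (Lam A B)
  with up_cong[of "fv_trm A" "fv_trm B" \<sigma> \<rho>] show ?case by auto
next
  case (TSub N A B)
  with up_cong[of "fv_trm N \<union> fv_trm A" "fv_trm B" \<sigma> \<rho>] show ?case by auto
next
  case (LSub N A l)
  with up_cong[of "fv_trm N \<union> fv_trm A" "fv_lst l" \<sigma> \<rho>] show ?case by auto
qed auto

lemma ren_id: "ren_trm id (M :: 's trm) = M" "ren_lst id (l :: 's lst) = l"
  by (induction M and l) (auto simp: up_id[unfolded id_def])

lemma bind_named:
  assumes "Suc x \<notin> fv_trm B"
  shows "bind_trm x (ren_trm (case_nat x id) B) = B"
proof -
  have "ren_trm (capture x \<circ> case_nat x id) B = ren_trm id B"
    using assms by (intro ren_cong) (auto simp: capture_def split: nat.split)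
  then show ?thesis by (simp add: bind_trm_def ren_comp ren_id)
qed

lemma PI_named: "x \<notin> fv_trm (Pi A B) \<Longrightarrow> \<exists>B'. Pi A B = PI x A B'"
  using bind_named[of x B] by (metis UnCI fv_trm.simps(1) vimageI2)

lemma PI_alpha:
  assumes "y \<notin> fv_trm B"
  shows "PI y A (ren_trm (id(x := y)) B) = PI x A B"
proof -
  have "ren_trm (capture y \<circ> id(x := y)) B = ren_trm (capture x) B"
    using assms by (intro ren_cong) (auto simp: capture_def)
  then show ?thesis by (simp add: bind_trm_def ren_comp)
qed

lemma bind_inj: "bind_trm x M = bind_trm x N \<Longrightarrow> M = N"
proof -
  have *: "case_nat x id \<circ> capture x = id" by (auto simp: capture_def fun_eq_iff)
  assume "bind_trm x M = bind_trm x N"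
  then have "ren_trm (case_nat x id) (bind_trm x M) = ren_trm (case_nat x id) (bind_trm x N)"
    by simp
  then show ?thesis by (simp add: bind_trm_def ren_comp * ren_id)
qed


section \<open>PTSC: reduction\<close>

inductive red :: "'s trm \<Rightarrow> 's trm \<Rightarrow> bool" and red_lst :: "'s lst \<Rightarrow> 's lst \<Rightarrow> bool" where
  beta: "red (TApp (LAM x A M) (LCons N l)) (TApp (SUB N x A M) l)"
| app_nil: "red (TApp M LNil) M"
| app_var: "red (TApp (VApp x l) l') (VApp x (LAppend l l'))"
| app_app: "red (TApp (TApp M l) l') (TApp M (LAppend l l'))"
| append_cons: "red_lst (LAppend (LCons M l') l) (LCons M (LAppend l' l))"
| append_nil_left: "red_lst (LAppend LNil l) l"
| append_assoc: "red_lst (LAppend (LAppend l l') l'') (LAppend l (LAppend l' l''))"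
| append_nil_right: "red_lst (LAppend l LNil) l"
| sub_lam: "\<lbrakk>x \<noteq> y; x \<notin> fv_trm P; x \<notin> fv_trm G\<rbrakk> \<Longrightarrow>
    red (SUB P y G (LAM x A M)) (LAM x (SUB P y G A) (SUB P y G M))"
| sub_var_eq: "red (SUB P y G (VApp y l)) (TApp P (SUBL P y G l))"
| sub_var_neq: "x \<noteq> y \<Longrightarrow> red (SUB P y G (VApp x l)) (VApp x (SUBL P y G l))"
| sub_app: "red (SUB P y G (TApp M l)) (TApp (SUB P y G M) (SUBL P y G l))"
| sub_pi: "\<lbrakk>x \<noteq> y; x \<notin> fv_trm P; x \<notin> fv_trm G\<rbrakk> \<Longrightarrow>
    red (SUB P y G (PI x A B)) (PI x (SUB P y G A) (SUB P y G B))"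
| sub_sort: "red (SUB P y G (Sort s)) (Sort s)"
| sub_nil: "red_lst (SUBL P y G LNil) LNil"
| sub_cons: "red_lst (SUBL P y G (LCons M l)) (LCons (SUB P y G M) (SUBL P y G l))"
| sub_append: "red_lst (SUBL P y G (LAppend l l')) (LAppend (SUBL P y G l) (SUBL P y G l'))"
| ctx_pi_ty: "red A A' \<Longrightarrow> red (PI x A B) (PI x A' B)"
| ctx_pi_body: "red B B' \<Longrightarrow> red (PI x A B) (PI x A B')"
| ctx_lam_ty: "red A A' \<Longrightarrow> red (LAM x A M) (LAM x A' M)"
| ctx_lam_body: "red M M' \<Longrightarrow> red (LAM x A M) (LAM x A M')"
| ctx_var: "red_lst l l' \<Longrightarrow> red (VApp x l) (VApp x l')"
| ctx_app_head: "red M M' \<Longrightarrow> red (TApp M l) (TApp M' l)"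
| ctx_app_list: "red_lst l l' \<Longrightarrow> red (TApp M l) (TApp M l')"
| ctx_sub_arg: "red N N' \<Longrightarrow> red (SUB N x A M) (SUB N' x A M)"
| ctx_sub_ty: "red A A' \<Longrightarrow> red (SUB N x A M) (SUB N x A' M)"
| ctx_sub_body: "red M M' \<Longrightarrow> red (SUB N x A M) (SUB N x A M')"
| ctx_cons_head: "red M M' \<Longrightarrow> red_lst (LCons M l) (LCons M' l)"
| ctx_cons_tail: "red_lst l l' \<Longrightarrow> red_lst (LCons M l) (LCons M l')"
| ctx_append_left: "red_lst l k \<Longrightarrow> red_lst (LAppend l l') (LAppend k l')"
| ctx_append_right: "red_lst l' k \<Longrightarrow> red_lst (LAppend l l') (LAppend l k)"
| ctx_subl_arg: "red N N' \<Longrightarrow> red_lst (SUBL N x A l) (SUBL N' x A l)"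
| ctx_subl_ty: "red A A' \<Longrightarrow> red_lst (SUBL N x A l) (SUBL N x A' l)"
| ctx_subl_body: "red_lst l l' \<Longrightarrow> red_lst (SUBL N x A l) (SUBL N x A l')"

abbreviation conv :: "'s trm \<Rightarrow> 's trm \<Rightarrow> bool" where
  "conv \<equiv> equivclp red"


section \<open>PTSC: typing\<close>

type_synonym 's env = "(nat \<times> 's trm) list"

definition sub_env :: "'s trm \<Rightarrow> nat \<Rightarrow> 's trm \<Rightarrow> 's env \<Rightarrow> 's env" where
  "sub_env P x A \<Delta> = map (\<lambda>(y, B). (y, SUB P x A B)) \<Delta>"

definition env_le :: "'s env \<Rightarrow> 's env \<Rightarrow> bool" where
  "env_le \<Gamma> \<Delta> \<longleftrightarrow> (\<forall>x A. (x, A) \<in> set \<Gamma> \<longrightarrow> (\<exists>B. (x, B) \<in> set \<Delta> \<and> conv A B))"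

text \<open>Environments grow to the right: \<open>\<Gamma> @ [(x, A)] @ \<Delta>\<close> is \<open>\<Gamma>, (x:A), \<Delta>\<close>. The judgement
  \<open>ptsc_lst Ax Ru \<Gamma> A l B\<close> is \<open>\<Gamma>; A \<turnstile> l : B\<close>.\<close>

inductive ptsc_wf :: "('s \<times> 's) set \<Rightarrow> ('s \<times> 's \<times> 's) set \<Rightarrow> 's env \<Rightarrow> bool"
  and ptsc_trm :: "('s \<times> 's) set \<Rightarrow> ('s \<times> 's \<times> 's) set \<Rightarrow> 's env \<Rightarrow> 's trm \<Rightarrow> 's trm \<Rightarrow> bool"
  and ptsc_lst :: "('s \<times> 's) set \<Rightarrow> ('s \<times> 's \<times> 's) set \<Rightarrow>
    's env \<Rightarrow> 's trm \<Rightarrow> 's lst \<Rightarrow> 's trm \<Rightarrow> bool"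
  for Ax :: "('s \<times> 's) set" and Ru :: "('s \<times> 's \<times> 's) set" where
  wf_empty: "ptsc_wf Ax Ru []"
| wf_extend: "\<lbrakk>ptsc_trm Ax Ru \<Gamma> A (Sort s); x \<notin> fst ` set \<Gamma>\<rbrakk> \<Longrightarrow> ptsc_wf Ax Ru (\<Gamma> @ [(x, A)])"
| ty_sort: "\<lbrakk>ptsc_wf Ax Ru \<Gamma>; (s, s') \<in> Ax\<rbrakk> \<Longrightarrow> ptsc_trm Ax Ru \<Gamma> (Sort s) (Sort s')"
| ty_pi: "\<lbrakk>ptsc_trm Ax Ru \<Gamma> A (Sort s1); ptsc_trm Ax Ru (\<Gamma> @ [(x, A)]) B (Sort s2);
    (s1, s2, s3) \<in> Ru\<rbrakk> \<Longrightarrow> ptsc_trm Ax Ru \<Gamma> (PI x A B) (Sort s3)"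
| ty_lam: "\<lbrakk>ptsc_trm Ax Ru \<Gamma> (PI x A B) (Sort s); ptsc_trm Ax Ru (\<Gamma> @ [(x, A)]) M B\<rbrakk> \<Longrightarrow>
    ptsc_trm Ax Ru \<Gamma> (LAM x A M) (PI x A B)"
| ty_var: "\<lbrakk>ptsc_lst Ax Ru \<Gamma> A l B; (x, A) \<in> set \<Gamma>\<rbrakk> \<Longrightarrow> ptsc_trm Ax Ru \<Gamma> (VApp x l) B"
| ty_nil: "ptsc_trm Ax Ru \<Gamma> A (Sort s) \<Longrightarrow> ptsc_lst Ax Ru \<Gamma> A LNil A"
| ty_conv: "\<lbrakk>ptsc_trm Ax Ru \<Gamma> M A; ptsc_trm Ax Ru \<Gamma> B (Sort s); conv A B\<rbrakk> \<Longrightarrow>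
    ptsc_trm Ax Ru \<Gamma> M B"
| ty_cons: "\<lbrakk>ptsc_trm Ax Ru \<Gamma> (PI x A B) (Sort s); ptsc_trm Ax Ru \<Gamma> M A;
    ptsc_lst Ax Ru \<Gamma> (SUB M x A B) l C\<rbrakk> \<Longrightarrow> ptsc_lst Ax Ru \<Gamma> (PI x A B) (LCons M l) C"
| ty_conv_right: "\<lbrakk>ptsc_lst Ax Ru \<Gamma> C l A; ptsc_trm Ax Ru \<Gamma> B (Sort s); conv A B\<rbrakk> \<Longrightarrow>
    ptsc_lst Ax Ru \<Gamma> C l B"
| ty_conv_left: "\<lbrakk>ptsc_lst Ax Ru \<Gamma> A l C; ptsc_trm Ax Ru \<Gamma> B (Sort s); conv A B\<rbrakk> \<Longrightarrow>
    ptsc_lst Ax Ru \<Gamma> B l C"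
| ty_append: "\<lbrakk>ptsc_lst Ax Ru \<Gamma> C l' A; ptsc_lst Ax Ru \<Gamma> A l B\<rbrakk> \<Longrightarrow>
    ptsc_lst Ax Ru \<Gamma> C (LAppend l' l) B"
| ty_subl: "\<lbrakk>ptsc_trm Ax Ru \<Gamma> P A; ptsc_lst Ax Ru (\<Gamma> @ [(x, A)] @ \<Delta>) B l C;
    env_le (\<Gamma> @ sub_env P x A \<Delta>) \<Delta>'; ptsc_wf Ax Ru \<Delta>'\<rbrakk> \<Longrightarrow>
    ptsc_lst Ax Ru \<Delta>' (SUB P x A B) (SUBL P x A l) (SUB P x A C)"
| ty_app: "\<lbrakk>ptsc_trm Ax Ru \<Gamma> M A; ptsc_lst Ax Ru \<Gamma> A l B\<rbrakk> \<Longrightarrow> ptsc_trm Ax Ru \<Gamma> (TApp M l) B"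
| ty_sub: "\<lbrakk>ptsc_trm Ax Ru \<Gamma> P A; ptsc_trm Ax Ru (\<Gamma> @ [(x, A)] @ \<Delta>) M C;
    env_le (\<Gamma> @ sub_env P x A \<Delta>) \<Delta>'; ptsc_wf Ax Ru \<Delta>';
    C' = (if C \<in> range Sort then C else SUB P x A C)\<rbrakk> \<Longrightarrow>
    ptsc_trm Ax Ru \<Delta>' (SUB P x A M) C'"

definition PTSC_SN :: "('s \<times> 's) set \<Rightarrow> ('s \<times> 's \<times> 's) set \<Rightarrow> bool" where
  "PTSC_SN Ax Ru \<longleftrightarrow> (\<forall>\<Gamma> M A. ptsc_trm Ax Ru \<Gamma> M A \<longrightarrow> strongly_normalising red M)"


section \<open>PTS\<close>

datatype 's pts =
    PVar nat
  | PSort 's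
  | PPi "'s pts" "'s pts"
  | PLam "'s pts" "'s pts"
  | PApp "'s pts" "'s pts"

primrec ren_pts :: "(nat \<Rightarrow> nat) \<Rightarrow> 's pts \<Rightarrow> 's pts" where
  "ren_pts \<rho> (PVar x) = PVar (\<rho> x)"
| "ren_pts \<rho> (PSort s) = PSort s"
| "ren_pts \<rho> (PPi T U) = PPi (ren_pts \<rho> T) (ren_pts (up \<rho>) U)"
| "ren_pts \<rho> (PLam T t) = PLam (ren_pts \<rho> T) (ren_pts (up \<rho>) t)"
| "ren_pts \<rho> (PApp t u) = PApp (ren_pts \<rho> t) (ren_pts \<rho> u)"

definition bind_pts :: "nat \<Rightarrow> 's pts \<Rightarrow> 's pts" where
  "bind_pts x t = ren_pts (capture x) t"

abbreviation PPI :: "nat \<Rightarrow> 's pts \<Rightarrow> 's pts \<Rightarrow> 's pts" where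
  "PPI x T U \<equiv> PPi T (bind_pts x U)"

abbreviation PLAM :: "nat \<Rightarrow> 's pts \<Rightarrow> 's pts \<Rightarrow> 's pts" where
  "PLAM x T t \<equiv> PLam T (bind_pts x t)"

definition up_subst :: "(nat \<Rightarrow> 's pts) \<Rightarrow> nat \<Rightarrow> 's pts" where
  "up_subst \<sigma> = case_nat (PVar 0) (\<lambda>n. ren_pts Suc (\<sigma> n))"

primrec psubst :: "(nat \<Rightarrow> 's pts) \<Rightarrow> 's pts \<Rightarrow> 's pts" where
  "psubst \<sigma> (PVar x) = \<sigma> x"
| "psubst \<sigma> (PSort s) = PSort s"
| "psubst \<sigma> (PPi T U) = PPi (psubst \<sigma> T) (psubst (up_subst \<sigma>) U)"
| "psubst \<sigma> (PLam T t) = PLam (psubst \<sigma> T) (psubst (up_subst \<sigma>) t)"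
| "psubst \<sigma> (PApp t u) = PApp (psubst \<sigma> t) (psubst \<sigma> u)"

text \<open>\<open>subst t x u\<close> is the capture-avoiding substitution \<open>t{x := u}\<close>.\<close>

definition subst :: "'s pts \<Rightarrow> nat \<Rightarrow> 's pts \<Rightarrow> 's pts" where
  "subst t x u = psubst (PVar(x := u)) t"

inductive pbeta :: "'s pts \<Rightarrow> 's pts \<Rightarrow> bool" where
  pbeta_redex: "pbeta (PApp (PLAM x v t) u) (subst t x u)"
| pbeta_pi_ty: "pbeta T T' \<Longrightarrow> pbeta (PPI x T t) (PPI x T' t)"
| pbeta_pi_body: "pbeta t t' \<Longrightarrow> pbeta (PPI x T t) (PPI x T t')"
| pbeta_lam_ty: "pbeta T T' \<Longrightarrow> pbeta (PLAM x T t) (PLAM x T' t)"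
| pbeta_lam_body: "pbeta t t' \<Longrightarrow> pbeta (PLAM x T t) (PLAM x T t')"
| pbeta_app_left: "pbeta t t' \<Longrightarrow> pbeta (PApp t u) (PApp t' u)"
| pbeta_app_right: "pbeta u u' \<Longrightarrow> pbeta (PApp t u) (PApp t u')"

abbreviation pconv :: "'s pts \<Rightarrow> 's pts \<Rightarrow> bool" where
  "pconv \<equiv> equivclp pbeta"

type_synonym 's penv = "(nat \<times> 's pts) list"

inductive pts_wf :: "('s \<times> 's) set \<Rightarrow> ('s \<times> 's \<times> 's) set \<Rightarrow> 's penv \<Rightarrow> bool"
  and pts_trm :: "('s \<times> 's) set \<Rightarrow> ('s \<times> 's \<times> 's) set \<Rightarrow> 's penv \<Rightarrow> 's pts \<Rightarrow> 's pts \<Rightarrow> bool"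
  for Ax :: "('s \<times> 's) set" and Ru :: "('s \<times> 's \<times> 's) set" where
  pwf_empty: "pts_wf Ax Ru []"
| pwf_extend: "\<lbrakk>pts_trm Ax Ru \<Gamma> T (PSort s); x \<notin> fst ` set \<Gamma>\<rbrakk> \<Longrightarrow> pts_wf Ax Ru (\<Gamma> @ [(x, T)])"
| pty_var: "\<lbrakk>pts_wf Ax Ru \<Gamma>; (x, T) \<in> set \<Gamma>\<rbrakk> \<Longrightarrow> pts_trm Ax Ru \<Gamma> (PVar x) T"
| pty_sort: "\<lbrakk>pts_wf Ax Ru \<Gamma>; (s, s') \<in> Ax\<rbrakk> \<Longrightarrow> pts_trm Ax Ru \<Gamma> (PSort s) (PSort s')"
| pty_pi: "\<lbrakk>pts_trm Ax Ru \<Gamma> U (PSort s1); pts_trm Ax Ru (\<Gamma> @ [(x, U)]) T (PSort s2);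
    (s1, s2, s3) \<in> Ru\<rbrakk> \<Longrightarrow> pts_trm Ax Ru \<Gamma> (PPI x U T) (PSort s3)"
| pty_lam: "\<lbrakk>pts_trm Ax Ru \<Gamma> (PPI x U T) (PSort s); pts_trm Ax Ru (\<Gamma> @ [(x, U)]) t T\<rbrakk> \<Longrightarrow>
    pts_trm Ax Ru \<Gamma> (PLAM x U t) (PPI x U T)"
| pty_app: "\<lbrakk>pts_trm Ax Ru \<Gamma> t (PPI x U T); pts_trm Ax Ru \<Gamma> u U\<rbrakk> \<Longrightarrow>
    pts_trm Ax Ru \<Gamma> (PApp t u) (subst T x u)"
| pty_conv: "\<lbrakk>pts_trm Ax Ru \<Gamma> t U; pts_trm Ax Ru \<Gamma> V (PSort s); pconv U V\<rbrakk> \<Longrightarrow>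
    pts_trm Ax Ru \<Gamma> t V"

definition PTS_SN :: "('s \<times> 's) set \<Rightarrow> ('s \<times> 's \<times> 's) set \<Rightarrow> bool" where
  "PTS_SN Ax Ru \<longleftrightarrow> (\<forall>\<Gamma> t T. pts_trm Ax Ru \<Gamma> t T \<longrightarrow> strongly_normalising pbeta t)"

end

theory Submission
  imports Defs
begin

text \<open>Let \<open>W\<close> be the union of \<open>\<beta>\<close>-reduction and the subterm relation. A PTSC term \<open>M\<close> is read as the PTS
  term obtained by executing its explicit substitutions and by turning \<open>x l\<close> and \<open>M l\<close> into iterated
  applications. This preserves typing, and every reduction step becomes a (possibly empty) \<open>\<beta>\<close>-reduction,
  which is nonempty if the step is the \<open>\<beta>\<close>-rule applied at the root. If the PTS is strongly normalising,
  then \<open>W\<close> is well-founded below the translation of each typed term, and an induction on \<open>W\<close>, and then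
  on the immediate components, shows that explicit substitutions and applications of strongly normalising
  components are strongly normalising: only the \<open>\<beta>\<close>-rule at the root creates a new explicit substitution
  out of an application, and it decreases the translation. Hence typed PTSC terms are strongly normalising,
  by induction on the typing derivation.

  Conversely, sending \<open>t u\<close> to \<open>M (N \<cdot> [])\<close> maps typed PTS terms to typed PTSC terms, with each \<open>\<beta>\<close>-step
  simulated by at least one step.\<close>

section \<open>Substitution in PTS terms\<close>

text \<open>Termination of the translation cannot by itself bound reduction in PTSC. The translation
  drops the annotation \<open>G\<close> of an explicit substitution, and it drops the substituted
  term whenever the variable does not occur, so steps inside these parts are invisible. Their
  termination has to come from the typing derivation. There the annotation is not the subject of a
  premise but a type in the environment of one, hence the claim proved over derivations also covers
  the types in the environment. Subterms enter \<open>W\<close> because the root \<beta>-step puts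
  the new substitution at the head of an application: its translation need not be a reduct of the
  old one, only a head inside a reduct. Every other step stays under the same bound, and no rule
  moves one explicit substitution through another. A body has no canonical bound name, so inverting
  a named step would have to guess one. Both reductions are therefore first shown equal to relations
  on the bodies as stored. Typing keeps its names, and the two views meet in \<open>bind_pts\<close>
  and \<open>bind_trm\<close>.\<close>

primrec fv_pts :: "'s pts \<Rightarrow> nat set" where
  "fv_pts (PVar x) = {x}"
| "fv_pts (PSort s) = {}"
| "fv_pts (PPi T U) = fv_pts T \<union> Suc -` fv_pts U"
| "fv_pts (PLam T t) = fv_pts T \<union> Suc -` fv_pts t"
| "fv_pts (PApp t u) = fv_pts t \<union> fv_pts u"

abbreviation inst :: "'s pts \<Rightarrow> nat \<Rightarrow> 's pts" where
  "inst u \<equiv> case_nat u PVar"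

lemma finite_fv_pts [simp]: "finite (fv_pts t)"
  by (induction t) (auto intro: finite_vimageI)

lemma up_simps [simp]: "up \<rho> 0 = 0" "up \<rho> (Suc n) = Suc (\<rho> n)"
  by (simp_all add: up_def)

lemma up_subst_simps [simp]:
  "up_subst \<sigma> 0 = PVar 0" "up_subst \<sigma> (Suc n) = ren_pts Suc (\<sigma> n)"
  by (simp_all add: up_subst_def)

lemma fun_eq_nat_iff: "f = g \<longleftrightarrow> f 0 = g 0 \<and> (\<forall>n. f (Suc n) = g (Suc n))"
proof
  assume r: "f 0 = g 0 \<and> (\<forall>n. f (Suc n) = g (Suc n))"
  show "f = g"
  proof
    show "f n = g n" for n using r by (cases n) auto
  qed
qed simp

lemma psubst_cong: "(\<And>n. n \<in> fv_pts t \<Longrightarrow> \<sigma> n = \<tau> n) \<Longrightarrow> psubst \<sigma> t = psubst \<tau> t"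
proof (induction t arbitrary: \<sigma> \<tau>)
  case (PPi T U)
  have "up_subst \<sigma> n = up_subst \<tau> n" if "n \<in> fv_pts U" for n
    using PPi.prems that by (cases n) auto
  with PPi.IH(2) have "psubst (up_subst \<sigma>) U = psubst (up_subst \<tau>) U" .
  moreover have "psubst \<sigma> T = psubst \<tau> T" by (rule PPi.IH(1)) (simp add: PPi.prems)
  ultimately show ?case by simp
next
  case (PLam T U)
  have "up_subst \<sigma> n = up_subst \<tau> n" if "n \<in> fv_pts U" for n
    using PLam.prems that by (cases n) auto
  with PLam.IH(2) have "psubst (up_subst \<sigma>) U = psubst (up_subst \<tau>) U" .
  moreover have "psubst \<sigma> T = psubst \<tau> T" by (rule PLam.IH(1)) (simp add: PLam.prems)
  ultimately show ?case by simp
next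
  case (PApp t u)
  have "psubst \<sigma> t = psubst \<tau> t" "psubst \<sigma> u = psubst \<tau> u"
    by (rule PApp.IH; simp add: PApp.prems)+
  then show ?case by simp
qed auto

lemma up_subst_PVar: "up_subst (PVar \<circ> \<rho>) = PVar \<circ> up \<rho>"
  by (simp add: fun_eq_nat_iff)

lemma psubst_PVar: "psubst (PVar \<circ> \<rho>) t = ren_pts \<rho> t"
  by (induction t arbitrary: \<rho>) (auto simp: up_subst_PVar)

lemma up_subst_id: "up_subst PVar = PVar"
  by (simp add: fun_eq_nat_iff)

lemma psubst_id: "psubst PVar t = t"
  by (induction t) (auto simp: up_subst_id)

lemma ren_pts_id: "ren_pts id t = t"
  using psubst_PVar[of id t] psubst_id[of t] by simp

lemma psubst_ren: "psubst \<sigma> (ren_pts \<rho> t) = psubst (\<sigma> \<circ> \<rho>) t"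
proof (induction t arbitrary: \<sigma> \<rho>)
  case (PPi T U)
  have "up_subst \<sigma> \<circ> up \<rho> = up_subst (\<sigma> \<circ> \<rho>)" by (simp add: fun_eq_nat_iff)
  with PPi show ?case by (simp add: comp_def)
next
  case (PLam T U)
  have "up_subst \<sigma> \<circ> up \<rho> = up_subst (\<sigma> \<circ> \<rho>)" by (simp add: fun_eq_nat_iff)
  with PLam show ?case by (simp add: comp_def)
qed auto

lemma ren_ren_pts: "ren_pts \<sigma> (ren_pts \<rho> t) = ren_pts (\<sigma> \<circ> \<rho>) t"
  by (metis psubst_PVar psubst_ren comp_assoc)

lemma ren_psubst: "ren_pts \<rho> (psubst \<sigma> t) = psubst (ren_pts \<rho> \<circ> \<sigma>) t"
proof (induction t arbitrary: \<sigma> \<rho>)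
  case (PPi T U)
  have "ren_pts (up \<rho>) \<circ> up_subst \<sigma> = up_subst (ren_pts \<rho> \<circ> \<sigma>)"
    by (simp add: fun_eq_nat_iff ren_ren_pts) (simp add: comp_def)
  with PPi show ?case by (simp add: comp_def)
next
  case (PLam T U)
  have "ren_pts (up \<rho>) \<circ> up_subst \<sigma> = up_subst (ren_pts \<rho> \<circ> \<sigma>)"
    by (simp add: fun_eq_nat_iff ren_ren_pts) (simp add: comp_def)
  with PLam show ?case by (simp add: comp_def)
qed auto

lemma up_subst_comp: "psubst (up_subst \<tau>) \<circ> up_subst \<sigma> = up_subst (psubst \<tau> \<circ> \<sigma>)"
proof -
  have "up_subst \<tau> \<circ> Suc = ren_pts Suc \<circ> \<tau>" by auto
  then show ?thesis by (simp add: fun_eq_nat_iff psubst_ren ren_psubst comp_def)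
qed

lemma psubst_psubst: "psubst \<tau> (psubst \<sigma> t) = psubst (psubst \<tau> \<circ> \<sigma>) t"
  by (induction t arbitrary: \<sigma> \<tau>) (auto simp: up_subst_comp)

lemma ren_pts_cong: "(\<And>n. n \<in> fv_pts t \<Longrightarrow> \<sigma> n = \<tau> n) \<Longrightarrow> ren_pts \<sigma> t = ren_pts \<tau> t"
  using psubst_cong[of t "PVar \<circ> \<sigma>" "PVar \<circ> \<tau>"] by (simp add: psubst_PVar)

lemma vimage_up_image: "Suc -` up \<rho> ` A = \<rho> ` (Suc -` A)"
proof (rule set_eqI)
  fix n
  have "(\<exists>m\<in>A. Suc n = up \<rho> m) \<longleftrightarrow> (\<exists>m. Suc m \<in> A \<and> n = \<rho> m)"
    by (metis Suc_inject nat.distinct(1) not0_implies_Suc up_simps)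
  then show "n \<in> Suc -` up \<rho> ` A \<longleftrightarrow> n \<in> \<rho> ` (Suc -` A)" by (auto simp: image_iff)
qed

lemma fv_ren_pts: "fv_pts (ren_pts \<rho> t) = \<rho> ` fv_pts t"
proof (induction t arbitrary: \<rho>)
  case (PPi T U)
  have "Suc -` up \<rho> ` fv_pts U = \<rho> ` (Suc -` fv_pts U)"
    by (rule vimage_up_image)
  with PPi show ?case by auto
next
  case (PLam T U)
  have "Suc -` up \<rho> ` fv_pts U = \<rho> ` (Suc -` fv_pts U)"
    by (rule vimage_up_image)
  with PLam show ?case by auto
qed auto

lemma fv_bind_pts: "Suc -` fv_pts (bind_pts x t) = fv_pts t - {x}"
  by (auto simp: bind_pts_def fv_ren_pts capture_def image_iff split: if_splits)

lemma inst_capture: "inst u \<circ> capture x = PVar(x := u)"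
  by (auto simp: capture_def)

text \<open>\<open>capture x\<close> sends \<open>x\<close> to 0 and shifts every other variable,
  and \<open>inst u\<close> undoes the shift; named substitution is thus the contraction of a bound
  body.\<close>

lemma psubst_bind: "psubst (inst u) (bind_pts x t) = subst t x u"
  by (simp add: bind_pts_def subst_def psubst_ren inst_capture)

text \<open>Freshness of \<open>y\<close> for the images of the other free variables makes the
  binder catch only the old \<open>x\<close>. Substituted bodies thereby regain a name, which the
  typing rules demand.\<close>

lemma psubst_up_bind:
  assumes "\<And>n. n \<in> fv_pts t \<Longrightarrow> n \<noteq> x \<Longrightarrow> y \<notin> fv_pts (\<sigma> n)"
  shows "psubst (up_subst \<sigma>) (bind_pts x t) = bind_pts y (psubst (\<sigma>(x := PVar y)) t)"
  unfolding bind_pts_def psubst_ren ren_psubst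
proof (rule psubst_cong)
  fix n assume n: "n \<in> fv_pts t"
  show "(up_subst \<sigma> \<circ> capture x) n = (ren_pts (capture y) \<circ> \<sigma>(x := PVar y)) n"
    using assms[OF n] by (auto simp: capture_def intro!: ren_pts_cong)
qed

text \<open>The nameless substitution lemma: both composites agree at 0, and at a successor the
  weakening made by \<open>up_subst\<close> is cancelled by the instantiation.\<close>

lemma psubst_inst: "psubst \<sigma> (psubst (inst u) t) = psubst (inst (psubst \<sigma> u)) (psubst (up_subst \<sigma>) t)"
proof -
  have "psubst \<sigma> \<circ> inst u = psubst (inst (psubst \<sigma> u)) \<circ> up_subst \<sigma>"
    by (simp add: fun_eq_nat_iff psubst_ren) (simp add: comp_def psubst_id)
  then show ?thesis by (simp add: psubst_psubst)
qed

lemma ren_inst: "ren_pts \<rho> (psubst (inst u) t) = psubst (inst (ren_pts \<rho> u)) (ren_pts (up \<rho>) t)"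
  using psubst_inst[of "PVar \<circ> \<rho>" u t] by (simp add: psubst_PVar up_subst_PVar)

text \<open>Working on the body as it is stored makes closure under substitution a direct induction
  and lets a step in a subterm be replayed in its context without choosing a name.\<close>

inductive dbeta :: "'s pts \<Rightarrow> 's pts \<Rightarrow> bool" where
  dbeta_redex: "dbeta (PApp (PLam v t) u) (psubst (inst u) t)"
| dbeta_pi_ty: "dbeta T T' \<Longrightarrow> dbeta (PPi T t) (PPi T' t)"
| dbeta_pi_body: "dbeta t t' \<Longrightarrow> dbeta (PPi T t) (PPi T t')"
| dbeta_lam_ty: "dbeta T T' \<Longrightarrow> dbeta (PLam T t) (PLam T' t)"
| dbeta_lam_body: "dbeta t t' \<Longrightarrow> dbeta (PLam T t) (PLam T t')"
| dbeta_app_left: "dbeta t t' \<Longrightarrow> dbeta (PApp t u) (PApp t' u)"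
| dbeta_app_right: "dbeta u u' \<Longrightarrow> dbeta (PApp t u) (PApp t u')"

lemma dbeta_psubst: "dbeta t t' \<Longrightarrow> dbeta (psubst \<sigma> t) (psubst \<sigma> t')"
  by (induction arbitrary: \<sigma> rule: dbeta.induct) (auto simp: psubst_inst intro: dbeta.intros)

lemma dbeta_ren: "dbeta t t' \<Longrightarrow> dbeta (ren_pts \<rho> t) (ren_pts \<rho> t')"
  using dbeta_psubst[of t t' "PVar \<circ> \<rho>"] by (simp add: psubst_PVar)

lemma size_ren_pts [simp]: "size (ren_pts \<rho> t) = size t"
  by (induction t arbitrary: \<rho>) auto

lemma ren_up_bind_pts:
  assumes "\<forall>n. Suc n \<in> fv_pts t \<longrightarrow> \<rho> n \<noteq> x"
  shows "ren_pts (up \<rho>) t = bind_pts x (ren_pts (case_nat x \<rho>) t)"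
  unfolding bind_pts_def ren_ren_pts
proof (rule ren_pts_cong)
  show "up \<rho> n = (capture x \<circ> case_nat x \<rho>) n" if "n \<in> fv_pts t" for n
    using that assms by (cases n) (auto simp: capture_def)
qed

lemma pbeta_imp_dbeta: "pbeta t t' \<Longrightarrow> dbeta t t'"
  by (induction rule: pbeta.induct)
    (auto simp: psubst_bind[symmetric] bind_pts_def intro: dbeta.intros dbeta_ren)

text \<open>Successors in a body are its outer variables; avoiding their images under the renaming
  is what allows the renamed body to be bound by \<open>x\<close> again.\<close>

lemma fresh_for_bodies:
  assumes "finite A"
  shows "\<exists>x :: nat. \<forall>n. Suc n \<in> A \<longrightarrow> \<rho> n \<noteq> x"
proof -
  have "\<exists>x. x \<notin> \<rho> ` (Suc -` A)"
    using assms by (intro ex_new_if_finite infinite_UNIV_nat finite_imageI finite_vimageI) auto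
  then show ?thesis by (metis imageI vimageI2)
qed

text \<open>Renaming is built into the claim: giving the body a name \<open>x\<close> renames it by
  \<open>case_nat x \<rho>\<close>, and the induction hypothesis must apply to that renamed
  body.\<close>

lemma dbeta_imp_pbeta_ren: "dbeta t t' \<Longrightarrow> pbeta (ren_pts \<rho> t) (ren_pts \<rho> t')"
proof (induction arbitrary: \<rho> rule: dbeta.induct)
  case (dbeta_redex v t u)
  obtain x where "\<forall>n. Suc n \<in> fv_pts t \<longrightarrow> \<rho> n \<noteq> x"
    using fresh_for_bodies[of "fv_pts t" \<rho>] by auto
  then have t: "ren_pts (up \<rho>) t = bind_pts x (ren_pts (case_nat x \<rho>) t)"
    by (rule ren_up_bind_pts)
  show ?case by (simp add: ren_inst t psubst_bind pbeta_redex)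
next
  case (dbeta_pi_ty T T' t)
  obtain x where "\<forall>n. Suc n \<in> fv_pts t \<longrightarrow> \<rho> n \<noteq> x"
    using fresh_for_bodies[of "fv_pts t" \<rho>] by auto
  with dbeta_pi_ty.IH show ?case by (simp add: ren_up_bind_pts[of t \<rho> x] pbeta_pi_ty)
next
  case (dbeta_lam_ty T T' t)
  obtain x where "\<forall>n. Suc n \<in> fv_pts t \<longrightarrow> \<rho> n \<noteq> x"
    using fresh_for_bodies[of "fv_pts t" \<rho>] by auto
  with dbeta_lam_ty.IH show ?case by (simp add: ren_up_bind_pts[of t \<rho> x] pbeta_lam_ty)
next
  case (dbeta_pi_body t t' T)
  obtain x where "\<forall>n. Suc n \<in> fv_pts t \<union> fv_pts t' \<longrightarrow> \<rho> n \<noteq> x"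
    using fresh_for_bodies[of "fv_pts t \<union> fv_pts t'" \<rho>] by auto
  with dbeta_pi_body.IH show ?case
    by (simp add: ren_up_bind_pts[of t \<rho> x] ren_up_bind_pts[of t' \<rho> x] pbeta_pi_body)
next
  case (dbeta_lam_body t t' T)
  obtain x where "\<forall>n. Suc n \<in> fv_pts t \<union> fv_pts t' \<longrightarrow> \<rho> n \<noteq> x"
    using fresh_for_bodies[of "fv_pts t \<union> fv_pts t'" \<rho>] by auto
  with dbeta_lam_body.IH show ?case
    by (simp add: ren_up_bind_pts[of t \<rho> x] ren_up_bind_pts[of t' \<rho> x] pbeta_lam_body)
qed (auto intro: pbeta.intros)

lemma dbeta_imp_pbeta: "dbeta t t' \<Longrightarrow> pbeta t t'"
  using dbeta_imp_pbeta_ren[of t t' id] by (simp add: ren_pts_id)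

lemma pbeta_eq_dbeta: "pbeta = dbeta"
  using pbeta_imp_dbeta dbeta_imp_pbeta by (intro ext iffI)

section \<open>Reduction of PTSC terms without names\<close>

text \<open>When a substitution enters a binder, the two innermost variables of the body change
  places: before the step, 0 belongs to the binder and 1 to the substitution; after it, 0 belongs to
  the substitution.\<close>

definition swp :: "nat \<Rightarrow> nat" where
  "swp = id(0 := 1, 1 := 0)"

inductive dred :: "'s trm \<Rightarrow> 's trm \<Rightarrow> bool" and dred_lst :: "'s lst \<Rightarrow> 's lst \<Rightarrow> bool" where
  d_beta: "dred (TApp (Lam A M) (LCons N l)) (TApp (TSub N A M) l)"
| d_app_nil: "dred (TApp M LNil) M"
| d_app_var: "dred (TApp (VApp x l) l') (VApp x (LAppend l l'))"
| d_app_app: "dred (TApp (TApp M l) l') (TApp M (LAppend l l'))"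
| d_append_cons: "dred_lst (LAppend (LCons M l') l) (LCons M (LAppend l' l))"
| d_append_nil_left: "dred_lst (LAppend LNil l) l"
| d_append_assoc: "dred_lst (LAppend (LAppend l l') l'') (LAppend l (LAppend l' l''))"
| d_append_nil_right: "dred_lst (LAppend l LNil) l"
| d_sub_lam: "dred (TSub P G (Lam A M))
    (Lam (TSub P G A) (TSub (ren_trm Suc P) (ren_trm Suc G) (ren_trm swp M)))"
| d_sub_var_eq: "dred (TSub P G (VApp 0 l)) (TApp P (LSub P G l))"
| d_sub_var_neq: "dred (TSub P G (VApp (Suc x) l)) (VApp x (LSub P G l))"
| d_sub_app: "dred (TSub P G (TApp M l)) (TApp (TSub P G M) (LSub P G l))"
| d_sub_pi: "dred (TSub P G (Pi A M))
    (Pi (TSub P G A) (TSub (ren_trm Suc P) (ren_trm Suc G) (ren_trm swp M)))"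
| d_sub_sort: "dred (TSub P G (Sort s)) (Sort s)"
| d_sub_nil: "dred_lst (LSub P G LNil) LNil"
| d_sub_cons: "dred_lst (LSub P G (LCons M l)) (LCons (TSub P G M) (LSub P G l))"
| d_sub_append: "dred_lst (LSub P G (LAppend l l')) (LAppend (LSub P G l) (LSub P G l'))"
| d_pi_ty: "dred A A' \<Longrightarrow> dred (Pi A B) (Pi A' B)"
| d_pi_body: "dred B B' \<Longrightarrow> dred (Pi A B) (Pi A B')"
| d_lam_ty: "dred A A' \<Longrightarrow> dred (Lam A M) (Lam A' M)"
| d_lam_body: "dred M M' \<Longrightarrow> dred (Lam A M) (Lam A M')"
| d_var: "dred_lst l l' \<Longrightarrow> dred (VApp x l) (VApp x l')"
| d_app_head: "dred M M' \<Longrightarrow> dred (TApp M l) (TApp M' l)"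
| d_app_list: "dred_lst l l' \<Longrightarrow> dred (TApp M l) (TApp M l')"
| d_sub_arg: "dred N N' \<Longrightarrow> dred (TSub N A M) (TSub N' A M)"
| d_sub_ty: "dred A A' \<Longrightarrow> dred (TSub N A M) (TSub N A' M)"
| d_sub_body: "dred M M' \<Longrightarrow> dred (TSub N A M) (TSub N A M')"
| d_cons_head: "dred M M' \<Longrightarrow> dred_lst (LCons M l) (LCons M' l)"
| d_cons_tail: "dred_lst l l' \<Longrightarrow> dred_lst (LCons M l) (LCons M l')"
| d_append_left: "dred_lst l k \<Longrightarrow> dred_lst (LAppend l l') (LAppend k l')"
| d_append_right: "dred_lst l' k \<Longrightarrow> dred_lst (LAppend l l') (LAppend l k)"
| d_subl_arg: "dred N N' \<Longrightarrow> dred_lst (LSub N A l) (LSub N' A l)"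
| d_subl_ty: "dred A A' \<Longrightarrow> dred_lst (LSub N A l) (LSub N A' l)"
| d_subl_body: "dred_lst l l' \<Longrightarrow> dred_lst (LSub N A l) (LSub N A l')"

lemma finite_fv [simp]: "finite (fv_trm (M :: 's trm))" "finite (fv_lst (l :: 's lst))"
  by (induction M and l) (auto intro: finite_vimageI)

lemma swp_up: "swp \<circ> up (up \<rho>) = up (up \<rho>) \<circ> swp"
proof
  show "(swp \<circ> up (up \<rho>)) n = (up (up \<rho>) \<circ> swp) n" for n
    by (cases n; cases "n - 1") (auto simp: swp_def)
qed

lemma up_Suc: "up \<rho> \<circ> Suc = Suc \<circ> \<rho>"
  by (simp add: fun_eq_iff)

lemma dred_ren:
  fixes M M' :: "'s trm" and l l' :: "'s lst"
  shows "dred M M' \<Longrightarrow> dred (ren_trm \<rho> M) (ren_trm \<rho> M')"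
  "dred_lst l l' \<Longrightarrow> dred_lst (ren_lst \<rho> l) (ren_lst \<rho> l')"
proof (induction arbitrary: \<rho> and \<rho> rule: dred_dred_lst.inducts)
  case (d_sub_lam P G A M)
  show ?case
    using dred_dred_lst.d_sub_lam[of "ren_trm \<rho> P" "ren_trm \<rho> G" "ren_trm (up \<rho>) A" "ren_trm (up (up \<rho>)) M"]
    by (simp add: ren_comp swp_up up_Suc)
next
  case (d_sub_pi P G A M)
  show ?case
    using dred_dred_lst.d_sub_pi[of "ren_trm \<rho> P" "ren_trm \<rho> G" "ren_trm (up \<rho>) A" "ren_trm (up (up \<rho>)) M"]
    by (simp add: ren_comp swp_up up_Suc)
qed (simp_all add: dred_dred_lst.intros)

lemma bind_fresh: "x \<notin> fv_trm P \<Longrightarrow> bind_trm x P = ren_trm Suc P"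
  unfolding bind_trm_def by (rule ren_cong) (auto simp: capture_def)

text \<open>Abstracting \<open>x\<close> and \<open>y\<close> in the two possible orders gives
  bodies that differ only in their two innermost variables. This reconciles the named propagation
  rules for binders with \<open>swp\<close>.\<close>

lemma bind_bind:
  assumes "x \<noteq> y"
  shows "ren_trm (up (capture x)) (bind_trm y M) = ren_trm swp (ren_trm (up (capture y)) (bind_trm x M))"
proof -
  have "up (capture x) \<circ> capture y = swp \<circ> (up (capture y) \<circ> capture x)"
    using assms by (auto simp: fun_eq_iff capture_def swp_def up_def)
  then show ?thesis by (simp add: bind_trm_def ren_comp)
qed

lemma bind_simps:
  "bind_trm x (Pi A B) = Pi (bind_trm x A) (ren_trm (up (capture x)) B)"
  "bind_trm x (Lam A B) = Lam (bind_trm x A) (ren_trm (up (capture x)) B)"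
  "bind_trm x (Sort s) = Sort s"
  "bind_trm x (VApp y l) = VApp (capture x y) (bind_lst x l)"
  "bind_trm x (TApp M l) = TApp (bind_trm x M) (bind_lst x l)"
  "bind_trm x (TSub N A M) = TSub (bind_trm x N) (bind_trm x A) (ren_trm (up (capture x)) M)"
  "bind_lst x LNil = LNil"
  "bind_lst x (LCons M l) = LCons (bind_trm x M) (bind_lst x l)"
  "bind_lst x (LAppend l l') = LAppend (bind_lst x l) (bind_lst x l')"
  by (simp_all add: bind_trm_def bind_lst_def)

lemma capture_simps: "capture x x = 0" "y \<noteq> x \<Longrightarrow> capture x y = Suc y"
  by (simp_all add: capture_def)

lemma dred_bind:
  "dred M M' \<Longrightarrow> dred (bind_trm x M) (bind_trm x M')"
  "dred_lst l l' \<Longrightarrow> dred_lst (bind_lst x l) (bind_lst x l')"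
  unfolding bind_trm_def bind_lst_def by (rule dred_ren, assumption)+

lemma red_imp_dred:
  fixes M M' :: "'s trm" and l l' :: "'s lst"
  shows "red M M' \<Longrightarrow> dred M M'"
  "red_lst l l' \<Longrightarrow> dred_lst l l'"
proof (induction rule: red_red_lst.inducts)
  case (sub_lam x y P G A M)
  then show ?case by (simp add: bind_simps bind_fresh bind_bind[of x y M] d_sub_lam)
next
  case (sub_pi x y P G A M)
  then show ?case by (simp add: bind_simps bind_fresh bind_bind[of x y M] d_sub_pi)
qed (simp_all add: bind_simps capture_simps dred_dred_lst.intros dred_bind)

lemma ren_up_bind:
  "\<forall>n. Suc n \<in> fv_trm M \<longrightarrow> \<rho> n \<noteq> x \<Longrightarrow> ren_trm (up \<rho>) M = bind_trm x (ren_trm (case_nat x \<rho>) M)"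
  unfolding bind_trm_def ren_comp
  by (rule ren_cong) (auto simp: capture_def up_def split: nat.split)

lemma ren_up_bind_lst:
  "\<forall>n. Suc n \<in> fv_lst M \<longrightarrow> \<rho> n \<noteq> x \<Longrightarrow> ren_lst (up \<rho>) M = bind_lst x (ren_lst (case_nat x \<rho>) M)"
  unfolding bind_lst_def ren_comp
  by (rule ren_cong) (auto simp: capture_def up_def split: nat.split)

lemma ex_bind:
  assumes "finite F" obtains x M' where "M = bind_trm x M'" "x \<notin> F"
proof -
  have "finite (F \<union> Suc -` fv_trm M)" using assms by (auto intro: finite_vimageI finite_fv)
  then obtain x where "x \<notin> F \<union> Suc -` fv_trm M" using ex_new_if_finite by blast
  then show ?thesis using that bind_named[of x M] by (metis UnI1 UnI2 vimageI2)
qed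

lemma ex_bind_lst: obtains x M' where "M = bind_lst x M'"
proof -
  obtain x where x: "\<forall>n. Suc n \<in> fv_lst M \<longrightarrow> id n \<noteq> x"
    using fresh_for_bodies[OF finite_fv(2), of M id] by blast
  show ?thesis by (rule that, use ren_up_bind_lst[OF x] in \<open>simp only: up_id ren_id\<close>)
qed

text \<open>\<open>K\<close> stands for \<open>Lam\<close> and for \<open>Pi\<close>, whose
  propagation rules have the same shape.\<close>

lemma red_sub_abs:
  fixes K :: "'s trm \<Rightarrow> 's trm \<Rightarrow> 's trm"
  assumes K: "\<And>x A M. bind_trm x (K A M) = K (bind_trm x A) (ren_trm (up (capture x)) M)"
    and red: "\<And>x y A M. \<lbrakk>x \<noteq> y; x \<notin> fv_trm P; x \<notin> fv_trm G\<rbrakk> \<Longrightarrow>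
      red (SUB P y G (K A (bind_trm x M))) (K (SUB P y G A) (bind_trm x (SUB P y G M)))"
  shows "red (TSub P G (K A M)) (K (TSub P G A) (TSub (ren_trm Suc P) (ren_trm Suc G) (ren_trm swp M)))"
proof -
  \<comment> \<open>\<open>Pi A M\<close> packs both bodies so that one fresh name \<open>y\<close>
    serves them, with \<open>M\<close> lying under one more binder than \<open>A\<close>.\<close>
  obtain y where y: "\<forall>n. Suc n \<in> fv_trm (Pi A M) \<longrightarrow> id n \<noteq> y"
    using fresh_for_bodies[OF finite_fv(1), of "Pi A M" id] by blast
  have A: "A = bind_trm y (ren_trm (case_nat y id) A)"
    and M: "M = ren_trm (up (capture y)) (ren_trm (up (case_nat y id)) M)"
    using ren_up_bind[OF y] by (simp_all only: up_id ren_id ren_trm.simps bind_simps trm.inject)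
  obtain x M0 where x: "ren_trm (up (case_nat y id)) M = bind_trm x M0" "x \<notin> {y} \<union> fv_trm P \<union> fv_trm G"
    by (rule ex_bind[of "{y} \<union> fv_trm P \<union> fv_trm G"]) (auto simp: finite_fv)
  have "red (TSub P G (K A M)) (K (TSub P G A) (bind_trm x (SUB P y G M0)))"
    using red[of x y "ren_trm (case_nat y id) A" M0] x A M by (simp add: K)
  also have "bind_trm x (SUB P y G M0) = TSub (ren_trm Suc P) (ren_trm Suc G) (ren_trm swp M)"
    using x M by (simp add: bind_simps bind_fresh bind_bind[of x y M0])
  finally show ?thesis .
qed

text \<open>As for \<beta>-reduction, the arbitrary renaming absorbs the choice of a name for each
  body.\<close>

lemma dred_imp_red_ren:
  fixes M M' :: "'s trm" and l l' :: "'s lst"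
  shows "dred M M' \<Longrightarrow> red (ren_trm \<rho> M) (ren_trm \<rho> M')"
  "dred_lst l l' \<Longrightarrow> red_lst (ren_lst \<rho> l) (ren_lst \<rho> l')"
proof (induction arbitrary: \<rho> and \<rho> rule: dred_dred_lst.inducts)
  case (d_beta A M N l)
  obtain x M0 where "ren_trm (up \<rho>) M = bind_trm x M0" by (rule ex_bind[OF finite.emptyI])
  then show ?case by (simp add: beta)
next
  case (d_sub_lam P G A M)
  show ?case using red_sub_abs[OF bind_simps(2) sub_lam, of "ren_trm \<rho> P" "ren_trm \<rho> G" "ren_trm (up \<rho>) A" "ren_trm (up (up \<rho>)) M"]
    by (simp add: ren_comp swp_up up_Suc)
next
  case (d_sub_pi P G A M)
  show ?case using red_sub_abs[OF bind_simps(1) sub_pi, of "ren_trm \<rho> P" "ren_trm \<rho> G" "ren_trm (up \<rho>) A" "ren_trm (up (up \<rho>)) M"]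
    by (simp add: ren_comp swp_up up_Suc)
next
  case (d_sub_var_eq P G l)
  obtain x l0 where "ren_lst (up \<rho>) l = bind_lst x l0" by (rule ex_bind_lst)
  then show ?case using sub_var_eq[of "ren_trm \<rho> P" "ren_trm \<rho> G" x l0] by (simp add: bind_simps capture_simps)
next
  case (d_sub_var_neq P G x l)
  obtain y where "\<forall>n. Suc n \<in> insert (Suc x) (fv_lst l) \<longrightarrow> \<rho> n \<noteq> y"
    using fresh_for_bodies[of "insert (Suc x) (fv_lst l)" \<rho>] by auto
  then have "ren_lst (up \<rho>) l = bind_lst y (ren_lst (case_nat y \<rho>) l)" "\<rho> x \<noteq> y"
    by (auto intro!: ren_up_bind_lst)
  then show ?case using sub_var_neq[of "\<rho> x" y "ren_trm \<rho> P" "ren_trm \<rho> G"] by (simp add: bind_simps capture_simps)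
next
  case (d_sub_app P G M l)
  obtain x where "\<forall>n. Suc n \<in> fv_trm (TApp M l) \<longrightarrow> \<rho> n \<noteq> x"
    using fresh_for_bodies[of "fv_trm (TApp M l)" \<rho>] by auto
  then have "ren_trm (up \<rho>) M = bind_trm x (ren_trm (case_nat x \<rho>) M)" "ren_lst (up \<rho>) l = bind_lst x (ren_lst (case_nat x \<rho>) l)"
    by (auto intro!: ren_up_bind_lst ren_up_bind)
  then show ?case using sub_app[of "ren_trm \<rho> P" "ren_trm \<rho> G" x] by (simp add: bind_simps)
next
  case (d_sub_sort P G s)
  show ?case using sub_sort[of _ _ 0] by (simp add: bind_simps)
next
  case (d_sub_nil P G)
  show ?case using sub_nil[of _ _ 0] by (simp add: bind_simps)
next
  case (d_sub_cons P G M l)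
  obtain x where "\<forall>n. Suc n \<in> fv_lst (LCons M l) \<longrightarrow> \<rho> n \<noteq> x"
    using fresh_for_bodies[of "fv_lst (LCons M l)" \<rho>] by auto
  then have "ren_trm (up \<rho>) M = bind_trm x (ren_trm (case_nat x \<rho>) M)" "ren_lst (up \<rho>) l = bind_lst x (ren_lst (case_nat x \<rho>) l)"
    by (auto intro!: ren_up_bind_lst ren_up_bind)
  then show ?case using sub_cons[of "ren_trm \<rho> P" "ren_trm \<rho> G" x] by (simp add: bind_simps)
next
  case (d_sub_append P G k l)
  obtain x where "\<forall>n. Suc n \<in> fv_lst (LAppend k l) \<longrightarrow> \<rho> n \<noteq> x"
    using fresh_for_bodies[of "fv_lst (LAppend k l)" \<rho>] by auto
  then have "ren_lst (up \<rho>) k = bind_lst x (ren_lst (case_nat x \<rho>) k)" "ren_lst (up \<rho>) l = bind_lst x (ren_lst (case_nat x \<rho>) l)"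
    by (auto intro!: ren_up_bind_lst ren_up_bind)
  then show ?case using sub_append[of "ren_trm \<rho> P" "ren_trm \<rho> G" x] by (simp add: bind_simps)
next
  case (d_pi_ty A A' B)
  obtain x B0 where "ren_trm (up \<rho>) B = bind_trm x B0" by (rule ex_bind[OF finite.emptyI])
  with d_pi_ty.IH[of \<rho>] show ?case by (simp add: ctx_pi_ty)
next
  case (d_lam_ty A A' B)
  obtain x B0 where "ren_trm (up \<rho>) B = bind_trm x B0" by (rule ex_bind[OF finite.emptyI])
  with d_lam_ty.IH[of \<rho>] show ?case by (simp add: ctx_lam_ty)
next
  case (d_sub_arg A A' G B)
  obtain x B0 where "ren_trm (up \<rho>) B = bind_trm x B0" by (rule ex_bind[OF finite.emptyI])
  with d_sub_arg.IH[of \<rho>] show ?case by (simp add: ctx_sub_arg)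
next
  case (d_sub_ty A A' P B)
  obtain x B0 where "ren_trm (up \<rho>) B = bind_trm x B0" by (rule ex_bind[OF finite.emptyI])
  with d_sub_ty.IH[of \<rho>] show ?case by (simp add: ctx_sub_ty)
next
  case (d_subl_arg A A' G B)
  obtain x B0 where "ren_lst (up \<rho>) B = bind_lst x B0" by (rule ex_bind_lst)
  with d_subl_arg.IH[of \<rho>] show ?case by (simp add: ctx_subl_arg)
next
  case (d_subl_ty A A' P B)
  obtain x B0 where "ren_lst (up \<rho>) B = bind_lst x B0" by (rule ex_bind_lst)
  with d_subl_ty.IH[of \<rho>] show ?case by (simp add: ctx_subl_ty)
next
  case (d_pi_body M M' A)
  obtain x where "\<forall>n. Suc n \<in> fv_trm M \<union> fv_trm M' \<longrightarrow> \<rho> n \<noteq> x"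
    using fresh_for_bodies[of "fv_trm M \<union> fv_trm M'" \<rho>] by auto
  with d_pi_body.IH show ?case by (simp add: ren_up_bind[of M \<rho> x] ren_up_bind[of M' \<rho> x] ctx_pi_body)
next
  case (d_lam_body M M' A)
  obtain x where "\<forall>n. Suc n \<in> fv_trm M \<union> fv_trm M' \<longrightarrow> \<rho> n \<noteq> x"
    using fresh_for_bodies[of "fv_trm M \<union> fv_trm M'" \<rho>] by auto
  with d_lam_body.IH show ?case by (simp add: ren_up_bind[of M \<rho> x] ren_up_bind[of M' \<rho> x] ctx_lam_body)
next
  case (d_sub_body M M' N A)
  obtain x where "\<forall>n. Suc n \<in> fv_trm M \<union> fv_trm M' \<longrightarrow> \<rho> n \<noteq> x"
    using fresh_for_bodies[of "fv_trm M \<union> fv_trm M'" \<rho>] by auto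
  with d_sub_body.IH show ?case by (simp add: ren_up_bind[of M \<rho> x] ren_up_bind[of M' \<rho> x] ctx_sub_body)
next
  case (d_subl_body M M' N A)
  obtain x where "\<forall>n. Suc n \<in> fv_lst M \<union> fv_lst M' \<longrightarrow> \<rho> n \<noteq> x"
    using fresh_for_bodies[of "fv_lst M \<union> fv_lst M'" \<rho>] by auto
  with d_subl_body.IH show ?case by (simp add: ren_up_bind_lst[of M \<rho> x] ren_up_bind_lst[of M' \<rho> x] ctx_subl_body)
qed (simp_all add: red_red_lst.intros)

lemma red_eq_dred: "red = dred"
proof (intro ext iffI)
  show "dred M M'" if "red M M'" for M M' :: "'s trm" using that by (rule red_imp_dred)
  show "red M M'" if "dred M M'" for M M' :: "'s trm"
    using dred_imp_red_ren(1)[OF that, of id] by (simp only: ren_id)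
qed

section \<open>A PTS with redundant premises\<close>

text \<open>The additional premises are the well-sortedness facts that make the substitution lemma, and the
  translation of derivations into PTSC, plain inductions.\<close>

inductive xpts_wf :: "('s \<times> 's) set \<Rightarrow> ('s \<times> 's \<times> 's) set \<Rightarrow> 's penv \<Rightarrow> bool"
  and xpts_trm :: "('s \<times> 's) set \<Rightarrow> ('s \<times> 's \<times> 's) set \<Rightarrow> 's penv \<Rightarrow> 's pts \<Rightarrow> 's pts \<Rightarrow> bool"
  for Ax :: "('s \<times> 's) set" and Ru :: "('s \<times> 's \<times> 's) set" where
  x_empty: "xpts_wf Ax Ru []"
| x_extend: "\<lbrakk>xpts_trm Ax Ru \<Gamma> T (PSort s); x \<notin> fst ` set \<Gamma>\<rbrakk> \<Longrightarrow> xpts_wf Ax Ru (\<Gamma> @ [(x, T)])"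
| x_var: "\<lbrakk>xpts_wf Ax Ru \<Gamma>; (x, T) \<in> set \<Gamma>; xpts_trm Ax Ru \<Gamma> T (PSort s)\<rbrakk> \<Longrightarrow>
    xpts_trm Ax Ru \<Gamma> (PVar x) T"
| x_sort: "\<lbrakk>xpts_wf Ax Ru \<Gamma>; (s, s') \<in> Ax\<rbrakk> \<Longrightarrow> xpts_trm Ax Ru \<Gamma> (PSort s) (PSort s')"
| x_pi: "\<lbrakk>xpts_trm Ax Ru \<Gamma> U (PSort s1); xpts_trm Ax Ru (\<Gamma> @ [(x, U)]) T (PSort s2);
    (s1, s2, s3) \<in> Ru\<rbrakk> \<Longrightarrow> xpts_trm Ax Ru \<Gamma> (PPI x U T) (PSort s3)"
| x_lam: "\<lbrakk>xpts_trm Ax Ru \<Gamma> U (PSort s1); xpts_trm Ax Ru \<Gamma> (PPI x U T) (PSort s);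
    xpts_trm Ax Ru (\<Gamma> @ [(x, U)]) t T\<rbrakk> \<Longrightarrow> xpts_trm Ax Ru \<Gamma> (PLAM x U t) (PPI x U T)"
| x_app: "\<lbrakk>xpts_trm Ax Ru \<Gamma> U (PSort s1); xpts_trm Ax Ru (\<Gamma> @ [(x, U)]) T (PSort s2);
    xpts_trm Ax Ru \<Gamma> (PPI x U T) (PSort s); xpts_trm Ax Ru \<Gamma> (subst T x u) (PSort s2);
    xpts_trm Ax Ru \<Gamma> t (PPI x U T); xpts_trm Ax Ru \<Gamma> u U\<rbrakk> \<Longrightarrow>
    xpts_trm Ax Ru \<Gamma> (PApp t u) (subst T x u)"
| x_conv: "\<lbrakk>xpts_trm Ax Ru \<Gamma> t U; xpts_trm Ax Ru \<Gamma> V (PSort s); pconv U V\<rbrakk> \<Longrightarrow>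
    xpts_trm Ax Ru \<Gamma> t V"

lemma xpts_trm_wf: 
  "xpts_wf Ax Ru \<Gamma> \<Longrightarrow> True"
  "xpts_trm Ax Ru \<Gamma> t T \<Longrightarrow> xpts_wf Ax Ru \<Gamma>"
  by (induction rule: xpts_wf_xpts_trm.inducts) auto

lemma xpts_wf_snoc:
  "xpts_wf Ax Ru (\<Gamma> @ [(x, T)]) \<Longrightarrow> (\<exists>s. xpts_trm Ax Ru \<Gamma> T (PSort s)) \<and> x \<notin> fst ` set \<Gamma>"
  by (erule xpts_wf.cases) auto

lemma xpts_fv:
  "xpts_wf Ax Ru \<Gamma> \<Longrightarrow> \<forall>(x, A) \<in> set \<Gamma>. fv_pts A \<subseteq> fst ` set \<Gamma>"
  "xpts_trm Ax Ru \<Gamma> t T \<Longrightarrow> fv_pts t \<subseteq> fst ` set \<Gamma> \<and> fv_pts T \<subseteq> fst ` set \<Gamma> \<and>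
    (\<forall>(x, A) \<in> set \<Gamma>. fv_pts A \<subseteq> fst ` set \<Gamma>)"
proof (induction rule: xpts_wf_xpts_trm.inducts)
  case (x_var \<Gamma> x T s)
  then show ?case by force
qed (auto simp: fv_bind_pts)

lemma equivclp_map:
  assumes "equivclp r x y" "\<And>x y. r x y \<Longrightarrow> equivclp q (f x) (f y)"
  shows "equivclp q (f x) (f y)"
  using assms(1)
proof (induction rule: equivclp_induct)
  case (step y z)
  then show ?case using assms(2) by (meson equivclp_sym equivclp_trans)
qed simp

lemma pconv_psubst: "pconv t u \<Longrightarrow> pconv (psubst \<sigma> t) (psubst \<sigma> u)"
  unfolding pbeta_eq_dbeta by (erule equivclp_map) (auto intro: dbeta_psubst)

lemma fresh_for_subst: 
  "finite F \<Longrightarrow> finite A \<Longrightarrow> \<exists>y. y \<notin> F \<and> (\<forall>n\<in>A. y \<notin> fv_pts (\<sigma> n))"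
  using ex_new_if_finite[of "F \<union> (\<Union>n\<in>A. fv_pts (\<sigma> n))"] by auto

lemma psubst_subst:
  assumes "\<forall>n\<in>fv_pts T. y \<notin> fv_pts (\<sigma> n)"
  shows "psubst \<sigma> (subst T x u) = subst (psubst (\<sigma>(x := PVar y)) T) y (psubst \<sigma> u)"
  using psubst_up_bind[of T x y \<sigma>] assms by (simp add: psubst_bind[symmetric] psubst_inst)

text \<open>The substitution lemma, for a generic notion \<open>J\<close> of what a substitution has to provide for each
  variable; renamings are the instance that yields thinning, which is needed for the instance of
  well-typed substitutions.\<close>

locale typed_subst =
  fixes Ax :: "('s \<times> 's) set" and Ru :: "('s \<times> 's \<times> 's) set"
    and J :: "'s penv \<Rightarrow> 's pts \<Rightarrow> 's pts \<Rightarrow> bool"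
  assumes J_typed: "\<lbrakk>J \<Delta> t A; xpts_wf Ax Ru \<Delta>; xpts_trm Ax Ru \<Delta> A (PSort s)\<rbrakk> \<Longrightarrow> xpts_trm Ax Ru \<Delta> t A"
    and J_weak: "\<lbrakk>J \<Delta> t A; xpts_wf Ax Ru (\<Delta> @ [(y, U)])\<rbrakk> \<Longrightarrow> J (\<Delta> @ [(y, U)]) t A"
    and J_var: "xpts_wf Ax Ru (\<Delta> @ [(y, U)]) \<Longrightarrow> J (\<Delta> @ [(y, U)]) (PVar y) U"
begin

definition "subst_ok \<Gamma> \<Delta> \<sigma> \<longleftrightarrow> (\<forall>(x, A) \<in> set \<Gamma>. J \<Delta> (\<sigma> x) (psubst \<sigma> A))"

text \<open>The invariant when going under a binder, whose name \<open>x\<close> is replaced by a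
  fresh \<open>y\<close>. Neither \<open>U\<close> nor any type in \<open>\<Gamma>\<close> mentions
  \<open>x\<close>, so overriding \<open>\<sigma>\<close> at \<open>x\<close> affects none of
  them.\<close>

lemma subst_ok_snoc:
  assumes "xpts_trm Ax Ru (\<Gamma> @ [(x, U)]) t T" "subst_ok \<Gamma> \<Delta> \<sigma>"
    and "xpts_trm Ax Ru \<Delta> (psubst \<sigma> U) (PSort s)" "y \<notin> fst ` set \<Delta>"
  shows "subst_ok (\<Gamma> @ [(x, U)]) (\<Delta> @ [(y, psubst \<sigma> U)]) (\<sigma>(x := PVar y))"
    and "xpts_wf Ax Ru (\<Delta> @ [(y, psubst \<sigma> U)])"
proof -
  show wf: "xpts_wf Ax Ru (\<Delta> @ [(y, psubst \<sigma> U)])" using assms(3,4) by (rule x_extend)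
  from xpts_wf_snoc[OF xpts_trm_wf(2)[OF assms(1)]] obtain s'
    where U: "xpts_trm Ax Ru \<Gamma> U (PSort s')" and x: "x \<notin> fst ` set \<Gamma>" by blast
  have eq: "psubst (\<sigma>(x := PVar y)) A = psubst \<sigma> A" if "fv_pts A \<subseteq> fst ` set \<Gamma>" for A
    by (rule psubst_cong) (use that x in auto)
  have "psubst (\<sigma>(x := PVar y)) U = psubst \<sigma> U"
    using xpts_fv(2)[OF U] by (intro eq) simp
  moreover have "J (\<Delta> @ [(y, psubst \<sigma> U)]) ((\<sigma>(x := PVar y)) z) (psubst (\<sigma>(x := PVar y)) A)"
    if "(z, A) \<in> set \<Gamma>" for z A
  proof -
    have "z \<noteq> x" using that x by force
    moreover have "psubst (\<sigma>(x := PVar y)) A = psubst \<sigma> A"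
      using xpts_fv(1)[OF xpts_trm_wf(2)[OF U]] that by (intro eq) auto
    ultimately show ?thesis
      using assms(2) that J_weak[OF _ wf] by (auto simp: subst_ok_def)
  qed
  ultimately show "subst_ok (\<Gamma> @ [(x, U)]) (\<Delta> @ [(y, psubst \<sigma> U)]) (\<sigma>(x := PVar y))"
    using J_var[OF wf] by (auto simp: subst_ok_def)
qed

lemma xpts_subst:
  "xpts_wf Ax Ru \<Gamma> \<Longrightarrow> True"
  "\<lbrakk>xpts_trm Ax Ru \<Gamma> t T; xpts_wf Ax Ru \<Delta>; subst_ok \<Gamma> \<Delta> \<sigma>\<rbrakk> \<Longrightarrow>
    xpts_trm Ax Ru \<Delta> (psubst \<sigma> t) (psubst \<sigma> T)"
proof (induction arbitrary: and \<Delta> \<sigma> rule: xpts_wf_xpts_trm.inducts)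
  case (x_var \<Gamma> x T s)
  \<comment> \<open>Turning \<open>J\<close> into a typing by \<open>J_typed\<close> requires a sort
    for the substituted type. It comes from the extra premise of \<open>x_var\<close>, through its
    induction hypothesis.\<close>
  from x_var(4)[OF x_var.prems] have "xpts_trm Ax Ru \<Delta> (psubst \<sigma> T) (PSort s)" by simp
  moreover have "J \<Delta> (\<sigma> x) (psubst \<sigma> T)" using x_var by (auto simp: subst_ok_def)
  ultimately show ?case using J_typed x_var.prems(1) by simp
next
  case (x_sort \<Gamma> s s')
  then show ?case by (simp add: xpts_wf_xpts_trm.x_sort)
next
  case (x_pi \<Gamma> U s1 x T s2 s3)
  \<comment> \<open>\<open>y\<close> must be new in \<open>\<Delta>\<close> to extend it, and absent
    from the images of \<open>\<sigma>\<close> to avoid capture.\<close>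
  obtain y where y: "y \<notin> fst ` set \<Delta>" "\<forall>n\<in>fv_pts T. y \<notin> fv_pts (\<sigma> n)"
    using fresh_for_subst[of "fst ` set \<Delta>" "fv_pts T" \<sigma>] by auto
  from x_pi(2)[OF x_pi.prems] have U: "xpts_trm Ax Ru \<Delta> (psubst \<sigma> U) (PSort s1)" by simp
  note ok = subst_ok_snoc[OF x_pi(3) x_pi.prems(2) U y(1)]
  from x_pi(4)[OF ok(2,1)] xpts_wf_xpts_trm.x_pi[OF U _ x_pi(5)]
  have "xpts_trm Ax Ru \<Delta> (PPI y (psubst \<sigma> U) (psubst (\<sigma>(x := PVar y)) T)) (PSort s3)"
    by (simp only: psubst.simps)
  then show ?case using y by (simp add: psubst_up_bind[of T x y])
next
  case (x_lam \<Gamma> U s1 x T s t)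
  obtain y where y: "y \<notin> fst ` set \<Delta>" "\<forall>n\<in>fv_pts T \<union> fv_pts t. y \<notin> fv_pts (\<sigma> n)"
    using fresh_for_subst[of "fst ` set \<Delta>" "fv_pts T \<union> fv_pts t" \<sigma>] by auto
  from x_lam(2)[OF x_lam.prems] have U: "xpts_trm Ax Ru \<Delta> (psubst \<sigma> U) (PSort s1)" by simp
  note ok = subst_ok_snoc[OF x_lam(5) x_lam.prems(2) U y(1)]
  from x_lam(4)[OF x_lam.prems] y
  have "xpts_trm Ax Ru \<Delta> (PPI y (psubst \<sigma> U) (psubst (\<sigma>(x := PVar y)) T)) (PSort s)"
    by (simp add: psubst_up_bind[of T x y] psubst_up_bind[of t x y] del: fun_upd_apply)
  from xpts_wf_xpts_trm.x_lam[OF U this x_lam(6)[OF ok(2,1)]] show ?case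
    using y by (simp add: psubst_up_bind[of T x y] psubst_up_bind[of t x y] del: fun_upd_apply)
next
  case (x_app \<Gamma> U s1 x T s2 s u t)
  obtain y where y: "y \<notin> fst ` set \<Delta>" "\<forall>n\<in>fv_pts T. y \<notin> fv_pts (\<sigma> n)"
    using fresh_for_subst[of "fst ` set \<Delta>" "fv_pts T" \<sigma>] by auto
  from x_app(2)[OF x_app.prems] have U: "xpts_trm Ax Ru \<Delta> (psubst \<sigma> U) (PSort s1)" by simp
  note ok = subst_ok_snoc[OF x_app(3) x_app.prems(2) U y(1)]
  let ?T = "psubst (\<sigma>(x := PVar y)) T"
  have Pi: "psubst \<sigma> (PPI x U T) = PPI y (psubst \<sigma> U) ?T"
    using y by (simp add: psubst_up_bind[of T x y])
  note subst = psubst_subst[OF y(2), of x u]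
  show ?case
    using xpts_wf_xpts_trm.x_app[OF U x_app(4)[OF ok(2,1), unfolded psubst.simps(2)] x_app(6)[OF x_app.prems, unfolded Pi psubst.simps(2)]
        x_app(8)[OF x_app.prems, unfolded subst psubst.simps(2)] x_app(10)[OF x_app.prems, unfolded Pi] x_app(12)[OF x_app.prems]]
    by (simp add: subst del: fun_upd_apply)
next
  case (x_conv \<Gamma> t U V s)
  show ?case
    by (rule xpts_wf_xpts_trm.x_conv[OF x_conv(2)[OF x_conv.prems]
        x_conv(4)[OF x_conv.prems, unfolded psubst.simps(2)] pconv_psubst[OF x_conv(5)]])
qed auto

end

lemma xpts_thinning:
  assumes "xpts_trm Ax Ru \<Gamma> t T" "xpts_wf Ax Ru \<Delta>" "set \<Gamma> \<subseteq> set \<Delta>"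
  shows "xpts_trm Ax Ru \<Delta> t T"
proof -
  interpret typed_subst Ax Ru "\<lambda>\<Delta> t A. \<exists>y. t = PVar y \<and> (y, A) \<in> set \<Delta>"
    by unfold_locales (auto intro: x_var)
  have "subst_ok \<Gamma> \<Delta> PVar" using assms(3) by (auto simp: subst_ok_def psubst_id)
  from xpts_subst(2)[OF assms(1,2) this] show ?thesis by (simp add: psubst_id)
qed

text \<open>Image types are only asked to agree up to conversion, because \<open>env_le\<close> in
  the PTSC rules for explicit substitutions compares environments no more precisely than
  that.\<close>

lemma xpts_subst_lemma:
  assumes "xpts_trm Ax Ru \<Gamma> t T" "xpts_wf Ax Ru \<Delta>"
    and "\<And>x A. (x, A) \<in> set \<Gamma> \<Longrightarrow> \<exists>B. xpts_trm Ax Ru \<Delta> (\<sigma> x) B \<and> pconv B (psubst \<sigma> A)"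
  shows "xpts_trm Ax Ru \<Delta> (psubst \<sigma> t) (psubst \<sigma> T)"
proof -
  interpret typed_subst Ax Ru "\<lambda>\<Delta> t A. \<exists>B. xpts_trm Ax Ru \<Delta> t B \<and> pconv B A"
  proof unfold_locales
    fix \<Delta> :: "'a penv" and y U
    assume wf: "xpts_wf Ax Ru (\<Delta> @ [(y, U)])"
    then obtain s where "xpts_trm Ax Ru \<Delta> U (PSort s)" using xpts_wf_snoc by blast
    then have "xpts_trm Ax Ru (\<Delta> @ [(y, U)]) U (PSort s)" by (rule xpts_thinning[OF _ wf]) auto
    then show "\<exists>B. xpts_trm Ax Ru (\<Delta> @ [(y, U)]) (PVar y) B \<and> pconv B U"
      using x_var[OF wf] by (intro exI[of _ U]) auto
    show "\<exists>B. xpts_trm Ax Ru (\<Delta> @ [(y, U)]) t B \<and> pconv B A"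
      if "\<exists>B. xpts_trm Ax Ru \<Delta> t B \<and> pconv B A" for t A
      using that xpts_thinning[OF _ wf] by auto
  qed (auto intro: x_conv)
  have "subst_ok \<Gamma> \<Delta> \<sigma>" using assms(3) by (auto simp: subst_ok_def)
  with xpts_subst(2)[OF assms(1,2)] show ?thesis .
qed

section \<open>Type correctness and agreement of the two PTS presentations\<close>

lemma xpts_type_correct:
  "xpts_trm Ax Ru \<Gamma> t T \<Longrightarrow> T \<in> range PSort \<or> (\<exists>s. xpts_trm Ax Ru \<Gamma> T (PSort s))"
  by (erule xpts_trm.cases) auto

lemma xpts_wf_env:
  "xpts_wf Ax Ru \<Gamma> \<Longrightarrow> (x, A) \<in> set \<Gamma> \<Longrightarrow> \<exists>s. xpts_trm Ax Ru \<Gamma> A (PSort s)"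
proof (induction \<Gamma> rule: rev_induct)
  case (snoc b \<Gamma>)
  obtain y B where b: "b = (y, B)" by force
  from xpts_wf_snoc[OF snoc.prems(1)[unfolded b]] obtain s where B: "xpts_trm Ax Ru \<Gamma> B (PSort s)" by blast
  with snoc b obtain s' where "xpts_trm Ax Ru \<Gamma> A (PSort s')" using xpts_trm_wf(2)[OF B] by auto
  then show ?case using xpts_thinning[OF _ snoc.prems(1)] by fastforce
qed simp

text \<open>Conversion changes only the type of a term, so apart from trailing conversions a
  derivation for a product ends with the product rule. The name found there need not be the one in
  which the product was written.\<close>

lemma xpts_pi_inv:
  "xpts_wf Ax Ru \<Gamma> \<Longrightarrow> True"
  "xpts_trm Ax Ru \<Gamma> t C \<Longrightarrow> t = PPi U T0 \<Longrightarrow>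
    \<exists>x T s1 s2. T0 = bind_pts x T \<and> xpts_trm Ax Ru \<Gamma> U (PSort s1) \<and> xpts_trm Ax Ru (\<Gamma> @ [(x, U)]) T (PSort s2)"
  by (induction rule: xpts_wf_xpts_trm.inducts) auto

lemma xpts_imp_pts:
  "xpts_wf Ax Ru \<Gamma> \<Longrightarrow> pts_wf Ax Ru \<Gamma>"
  "xpts_trm Ax Ru \<Gamma> t T \<Longrightarrow> pts_trm Ax Ru \<Gamma> t T"
  by (induction rule: xpts_wf_xpts_trm.inducts) (auto intro: pts_wf_pts_trm.intros)

text \<open>The delicate rule is application: type correctness gives the product a sort, inversion
  gives sorts to its domain and codomain, and the substitution lemma carries the sort of the
  codomain to the type of the result.\<close>

lemma pts_imp_xpts:
  "pts_wf Ax Ru \<Gamma> \<Longrightarrow> xpts_wf Ax Ru \<Gamma>"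
  "pts_trm Ax Ru \<Gamma> t T \<Longrightarrow> xpts_trm Ax Ru \<Gamma> t T"
proof (induction rule: pts_wf_pts_trm.inducts)
  case (pty_var \<Gamma> x T)
  then show ?case using xpts_wf_env x_var by metis
next
  case (pty_lam \<Gamma> x U T s t)
  then show ?case using xpts_wf_snoc[OF xpts_trm_wf(2)] x_lam by metis
next
  case (pty_app \<Gamma> t x U T u)
  from xpts_type_correct[OF pty_app(2)] obtain s where Pi: "xpts_trm Ax Ru \<Gamma> (PPI x U T) (PSort s)"
    by auto
  from xpts_pi_inv(2)[OF this refl] obtain y T' s1 s2 where T: "bind_pts x T = bind_pts y T'"
    and U: "xpts_trm Ax Ru \<Gamma> U (PSort s1)" and T': "xpts_trm Ax Ru (\<Gamma> @ [(y, U)]) T' (PSort s2)"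
    by blast
  have wf: "xpts_wf Ax Ru \<Gamma>" using xpts_trm_wf(2)[OF U] .
  have y: "y \<notin> fst ` set \<Gamma>" using xpts_wf_snoc[OF xpts_trm_wf(2)[OF T']] by simp
  \<comment> \<open>Types in \<open>\<Gamma>\<close> cannot mention \<open>y\<close>, since
    \<open>\<Gamma>\<close> does not declare it.\<close>
  have eq: "psubst (PVar(y := u)) A = A" if "fv_pts A \<subseteq> fst ` set \<Gamma>" for A
    using psubst_cong[of A "PVar(y := u)" PVar] that y by (force simp: psubst_id)
  have "xpts_trm Ax Ru \<Gamma> (subst T' y u) (psubst (PVar(y := u)) (PSort s2))"
    unfolding subst_def
  proof (rule xpts_subst_lemma[OF T' wf])
    fix z A assume "(z, A) \<in> set (\<Gamma> @ [(y, U)])"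
    then consider "z = y" "A = U" | "(z, A) \<in> set \<Gamma>" by auto
    then show "\<exists>B. xpts_trm Ax Ru \<Gamma> ((PVar(y := u)) z) B \<and> pconv B (psubst (PVar(y := u)) A)"
    proof cases
      case 1
      then show ?thesis using pty_app(4) eq[of U] xpts_fv(2)[OF U] by auto
    next
      case 2
      moreover have "fv_pts A \<subseteq> fst ` set \<Gamma>" using 2 xpts_fv(1)[OF wf] by auto
      moreover have "z \<noteq> y" using 2 y by force
      ultimately show ?thesis
        using eq[of A] xpts_wf_env[OF wf 2] x_var[OF wf 2] by (intro exI[of _ A]) auto
    qed
  qed
  moreover have "subst T x u = subst T' y u" using T by (metis psubst_bind)
  ultimately show ?case using x_app[OF U T' Pi[unfolded T]] pty_app(2,4) by (simp add: T)
qed (auto intro: xpts_wf_xpts_trm.intros)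

lemma pts_eq_xpts: "pts_wf = xpts_wf" "pts_trm = xpts_trm"
  using xpts_imp_pts pts_imp_xpts by (intro ext iffI; blast)+

section \<open>From PTSC to PTS\<close>

text \<open>A list is translated to the arguments it stands for, so that no variable for the head is
  needed.\<close>

primrec pt_trm :: "'s trm \<Rightarrow> 's pts" and pt_lst :: "'s lst \<Rightarrow> 's pts list" where
  "pt_trm (Pi A B) = PPi (pt_trm A) (pt_trm B)"
| "pt_trm (Lam A M) = PLam (pt_trm A) (pt_trm M)"
| "pt_trm (Sort s) = PSort s"
| "pt_trm (VApp x l) = foldl PApp (PVar x) (pt_lst l)"
| "pt_trm (TApp M l) = foldl PApp (pt_trm M) (pt_lst l)"
| "pt_trm (TSub N A M) = psubst (inst (pt_trm N)) (pt_trm M)"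
| "pt_lst LNil = []"
| "pt_lst (LCons M l) = pt_trm M # pt_lst l"
| "pt_lst (LAppend l l') = pt_lst l @ pt_lst l'"
| "pt_lst (LSub N A l) = map (psubst (inst (pt_trm N))) (pt_lst l)"

definition pt_env :: "'s env \<Rightarrow> 's penv" where
  "pt_env \<Gamma> = map (\<lambda>(x, A). (x, pt_trm A)) \<Gamma>"

lemma psubst_foldl: "psubst \<sigma> (foldl PApp h ls) = foldl PApp (psubst \<sigma> h) (map (psubst \<sigma>) ls)"
  by (induction ls arbitrary: h) auto

lemma ren_foldl: "ren_pts \<rho> (foldl PApp h ls) = foldl PApp (ren_pts \<rho> h) (map (ren_pts \<rho>) ls)"
  by (induction ls arbitrary: h) auto

lemma pt_ren:
  "pt_trm (ren_trm \<rho> (M :: 's trm)) = ren_pts \<rho> (pt_trm M)"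
  "pt_lst (ren_lst \<rho> (l :: 's lst)) = map (ren_pts \<rho>) (pt_lst l)"
  by (induction M and l arbitrary: \<rho> and \<rho>) (auto simp: ren_foldl ren_inst)

lemma pt_bind: "pt_trm (bind_trm x M) = bind_pts x (pt_trm M)"
  by (simp add: bind_trm_def bind_pts_def pt_ren)

lemma pt_bind_lst: "pt_lst (bind_lst x l) = map (bind_pts x) (pt_lst l)"
  by (simp add: bind_lst_def bind_pts_def[abs_def] pt_ren)

lemma pt_SUB: "pt_trm (SUB N x A M) = subst (pt_trm M) x (pt_trm N)"
  by (simp add: pt_bind psubst_bind)

lemma pt_SUBL: "pt_lst (SUBL N x A l) = map (\<lambda>t. subst t x (pt_trm N)) (pt_lst l)"
  by (simp add: pt_bind_lst psubst_bind)

subsection \<open>Simulation\<close>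

lemma rtranclp_map:
  assumes "r\<^sup>*\<^sup>* x y" "\<And>x y. r x y \<Longrightarrow> q (f x) (f y)"
  shows "q\<^sup>*\<^sup>* (f x) (f y)"
  using assms(1) by induction (auto intro: rtranclp.rtrancl_into_rtrancl assms(2))

lemma dbeta_star_app:
  assumes "dbeta\<^sup>*\<^sup>* t t'" "dbeta\<^sup>*\<^sup>* u u'"
  shows "dbeta\<^sup>*\<^sup>* (PApp t u) (PApp t' u')"
proof -
  have "dbeta\<^sup>*\<^sup>* (PApp t u) (PApp t' u)"
    by (rule rtranclp_map[OF assms(1)]) (rule dbeta_app_left)
  also have "dbeta\<^sup>*\<^sup>* (PApp t' u) (PApp t' u')"
    by (rule rtranclp_map[OF assms(2)]) (rule dbeta_app_right)
  finally show ?thesis .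
qed

lemma dbeta_star_pi:
  assumes "dbeta\<^sup>*\<^sup>* t t'" "dbeta\<^sup>*\<^sup>* u u'"
  shows "dbeta\<^sup>*\<^sup>* (PPi t u) (PPi t' u')"
proof -
  have "dbeta\<^sup>*\<^sup>* (PPi t u) (PPi t' u)"
    by (rule rtranclp_map[OF assms(1)]) (rule dbeta_pi_ty)
  also have "dbeta\<^sup>*\<^sup>* (PPi t' u) (PPi t' u')"
    by (rule rtranclp_map[OF assms(2)]) (rule dbeta_pi_body)
  finally show ?thesis .
qed

lemma dbeta_star_lam:
  assumes "dbeta\<^sup>*\<^sup>* t t'" "dbeta\<^sup>*\<^sup>* u u'"
  shows "dbeta\<^sup>*\<^sup>* (PLam t u) (PLam t' u')"
proof -
  have "dbeta\<^sup>*\<^sup>* (PLam t u) (PLam t' u)"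
    by (rule rtranclp_map[OF assms(1)]) (rule dbeta_lam_ty)
  also have "dbeta\<^sup>*\<^sup>* (PLam t' u) (PLam t' u')"
    by (rule rtranclp_map[OF assms(2)]) (rule dbeta_lam_body)
  finally show ?thesis .
qed

lemma dbeta_foldl_head: "dbeta h h' \<Longrightarrow> dbeta (foldl PApp h ls) (foldl PApp h' ls)"
  by (induction ls arbitrary: h h') (auto intro: dbeta_app_left)

lemma dbeta_star_foldl:
  "list_all2 dbeta\<^sup>*\<^sup>* ls ls' \<Longrightarrow> dbeta\<^sup>*\<^sup>* h h' \<Longrightarrow> dbeta\<^sup>*\<^sup>* (foldl PApp h ls) (foldl PApp h' ls')"
  by (induction ls ls' arbitrary: h h' rule: list_all2_induct) (auto intro: dbeta_star_app)

lemma dbeta_star_psubst: "dbeta\<^sup>*\<^sup>* t t' \<Longrightarrow> dbeta\<^sup>*\<^sup>* (psubst \<sigma> t) (psubst \<sigma> t')"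
  by (erule rtranclp_map) (rule dbeta_psubst)

text \<open>Several steps or none are needed, as a variable may occur many times or not at
  all.\<close>

lemma dbeta_star_psubst_arg:
  "(\<And>n. dbeta\<^sup>*\<^sup>* (\<sigma> n) (\<tau> n)) \<Longrightarrow> dbeta\<^sup>*\<^sup>* (psubst \<sigma> t) (psubst \<tau> t)"
proof (induction t arbitrary: \<sigma> \<tau>)
  case (PPi T U)
  have "dbeta\<^sup>*\<^sup>* (up_subst \<sigma> n) (up_subst \<tau> n)" for n
    by (cases n) (auto intro!: rtranclp_map[OF PPi.prems] dbeta_ren)
  then show ?case using PPi by (auto intro!: dbeta_star_pi)
next
  case (PLam T U)
  have "dbeta\<^sup>*\<^sup>* (up_subst \<sigma> n) (up_subst \<tau> n)" for n
    by (cases n) (auto intro!: rtranclp_map[OF PLam.prems] dbeta_ren)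
  then show ?case using PLam by (auto intro!: dbeta_star_lam)
qed (auto intro!: dbeta_star_app)

lemma dbeta_star_inst:
  assumes "dbeta\<^sup>*\<^sup>* u u'" "dbeta\<^sup>*\<^sup>* t t'"
  shows "dbeta\<^sup>*\<^sup>* (psubst (inst u) t) (psubst (inst u') t')"
proof -
  have "dbeta\<^sup>*\<^sup>* (psubst (inst u) t) (psubst (inst u') t)"
    by (rule dbeta_star_psubst_arg) (simp add: assms(1) split: nat.split)
  also have "dbeta\<^sup>*\<^sup>* (psubst (inst u') t) (psubst (inst u') t')"
    using assms(2) by (rule dbeta_star_psubst)
  finally show ?thesis .
qed

lemma dbeta_star_list_refl [simp]: "list_all2 dbeta\<^sup>*\<^sup>* ls ls"
  by (simp add: list_all2_refl)

lemma dbeta_star_list_inst: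
  "dbeta\<^sup>*\<^sup>* u u' \<Longrightarrow> list_all2 dbeta\<^sup>*\<^sup>* ls ls' \<Longrightarrow>
    list_all2 dbeta\<^sup>*\<^sup>* (map (psubst (inst u)) ls) (map (psubst (inst u')) ls')"
  by (auto simp: list.rel_map intro: dbeta_star_inst elim!: list_all2_mono)

text \<open>This is why moving a substitution under a binder leaves the translation unchanged:
  lifting an instantiation amounts to exchanging the two innermost variables and instantiating with
  the weakened term.\<close>

lemma up_subst_inst: "up_subst (inst u) = inst (ren_pts Suc u) \<circ> swp"
proof
  show "up_subst (inst u) n = (inst (ren_pts Suc u) \<circ> swp) n" for n
    by (cases n; cases "n - 1") (auto simp: swp_def)
qed

lemma psubst_up_inst: "psubst (inst (ren_pts Suc u)) (ren_pts swp t) = psubst (up_subst (inst u)) t"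
  by (simp add: psubst_ren up_subst_inst)

text \<open>Among the root rules only the \<beta>-rule contracts a redex. The others are identities
  of \<open>foldl\<close>, append and substitution, hence leave the translation unchanged. A list
  keeps its number of arguments, so its steps can be compared pointwise.\<close>

lemma pt_dred:
  fixes M M' :: "'s trm" and l l' :: "'s lst"
  shows "dred M M' \<Longrightarrow> dbeta\<^sup>*\<^sup>* (pt_trm M) (pt_trm M')"
    and "dred_lst l l' \<Longrightarrow> list_all2 dbeta\<^sup>*\<^sup>* (pt_lst l) (pt_lst l')"
proof (induction rule: dred_dred_lst.inducts)
  case (d_beta A M N l)
  show ?case by (auto intro!: r_into_rtranclp dbeta_foldl_head dbeta_redex)
qed (simp_all add: pt_ren psubst_up_inst psubst_foldl list_all2_appendI dbeta_star_foldl
  dbeta_star_pi dbeta_star_lam dbeta_star_inst dbeta_star_list_inst)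

lemma pconv_pt: "conv M N \<Longrightarrow> pconv (pt_trm M) (pt_trm N)"
  unfolding pbeta_eq_dbeta red_eq_dred
  by (erule equivclp_map) (auto intro: rtranclp_into_equivclp pt_dred)

subsection \<open>Typing\<close>

lemma pt_env_simps [simp]:
  "pt_env [] = []" "pt_env (\<Gamma> @ \<Delta>) = pt_env \<Gamma> @ pt_env \<Delta>"
  "pt_env ((x, A) # \<Gamma>) = (x, pt_trm A) # pt_env \<Gamma>"
  "fst ` set (pt_env \<Gamma>) = fst ` set \<Gamma>"
  by (simp_all add: pt_env_def image_image case_prod_unfold)

lemma pt_env_mem: "(x, A) \<in> set \<Gamma> \<Longrightarrow> (x, pt_trm A) \<in> set (pt_env \<Gamma>)"
  by (force simp: pt_env_def)

lemma xpts_var: "xpts_wf Ax Ru \<Gamma> \<Longrightarrow> (x, A) \<in> set \<Gamma> \<Longrightarrow> xpts_trm Ax Ru \<Gamma> (PVar x) A"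
  using xpts_wf_env x_var by metis

lemma xpts_wf_distinct: "xpts_wf Ax Ru \<Gamma> \<Longrightarrow> distinct (map fst \<Gamma>)"
proof (induction \<Gamma> rule: rev_induct)
  case (snoc b \<Gamma>)
  obtain y B where b: "b = (y, B)" by force
  from xpts_wf_snoc[OF snoc.prems[unfolded b]] xpts_trm_wf(2) have "xpts_wf Ax Ru \<Gamma>" "y \<notin> fst ` set \<Gamma>"
    by blast+
  with snoc b show ?case by simp
qed simp

lemma psubst_upd_fresh: "x \<notin> fv_pts t \<Longrightarrow> psubst (\<sigma>(x := u)) t = psubst \<sigma> t"
  by (rule psubst_cong) auto

text \<open>The typing of a list is that of its arguments applied to a variable head, and lists are
  composed by substituting for this head. The premise ranges over all \<open>z\<close> new in
  \<open>\<Gamma>\<close>, so that one can be picked which also avoids \<open>ls\<close> and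
  \<open>B\<close>; substituting \<open>t\<close> then changes nothing but the head.\<close>

lemma xpts_head_subst:
  assumes l: "\<And>z. z \<notin> fst ` set \<Gamma> \<Longrightarrow> xpts_trm Ax Ru (\<Gamma> @ [(z, A)]) (foldl PApp (PVar z) ls) B"
    and t: "xpts_trm Ax Ru \<Delta> t A'" "pconv A' A"
    and \<Delta>: "xpts_wf Ax Ru \<Delta>" "set \<Gamma> \<subseteq> set \<Delta>"
  shows "xpts_trm Ax Ru \<Delta> (foldl PApp t ls) B"
proof -
  obtain z where z: "z \<notin> fst ` set \<Gamma> \<union> (\<Union>u\<in>set ls. fv_pts u) \<union> fv_pts B"
    using ex_new_if_finite[of "fst ` set \<Gamma> \<union> (\<Union>u\<in>set ls. fv_pts u) \<union> fv_pts B"] by auto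
  let ?\<sigma> = "PVar(z := t)"
  have lz: "xpts_trm Ax Ru (\<Gamma> @ [(z, A)]) (foldl PApp (PVar z) ls) B" using l z by simp
  from xpts_wf_snoc[OF xpts_trm_wf(2)[OF this]] obtain s where A: "xpts_trm Ax Ru \<Gamma> A (PSort s)" by blast
  have "xpts_trm Ax Ru \<Delta> (psubst ?\<sigma> (foldl PApp (PVar z) ls)) (psubst ?\<sigma> B)"
  proof (rule xpts_subst_lemma[OF lz \<Delta>(1)])
    fix y C assume "(y, C) \<in> set (\<Gamma> @ [(z, A)])"
    then consider "y = z" "C = A" | "(y, C) \<in> set \<Gamma>" by auto
    then show "\<exists>D. xpts_trm Ax Ru \<Delta> (?\<sigma> y) D \<and> pconv D (psubst ?\<sigma> C)"
    proof cases
      case 1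
      have "z \<notin> fv_pts A" using z xpts_fv(2)[OF A] by auto
      then have "psubst ?\<sigma> C = A" using 1 by (simp only: psubst_upd_fresh psubst_id not_False_eq_True)
      then show ?thesis using t 1 by (intro exI[of _ A']) (simp only: fun_upd_same simp_thms)
    next
      case 2
      then have y: "y \<in> fst ` set \<Gamma>" by force
      have "fv_pts C \<subseteq> fst ` set \<Gamma>" using 2 xpts_fv(2)[OF A] by auto
      then have "psubst ?\<sigma> C = C" using z by (subst psubst_upd_fresh) (auto simp: psubst_id)
      moreover have "?\<sigma> y = PVar y" using z y by auto
      moreover have "xpts_trm Ax Ru \<Delta> (PVar y) C" using 2 \<Delta> by (intro xpts_var) auto
      ultimately show ?thesis by (intro exI[of _ C]) (simp del: fun_upd_apply)
    qed
  qed
  moreover have "map (psubst ?\<sigma>) ls = ls"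
  proof (rule map_idI)
    show "psubst ?\<sigma> u = u" if "u \<in> set ls" for u
      using that z by (subst psubst_upd_fresh) (auto simp: psubst_id)
  qed
  moreover have "psubst ?\<sigma> B = B" using z by (subst psubst_upd_fresh) (auto simp: psubst_id)
  ultimately show ?thesis by (simp only: psubst_foldl psubst.simps fun_upd_same)
qed

lemma xpts_sub_env:
  assumes P: "xpts_trm Ax Ru \<Gamma> P A" and wf: "xpts_wf Ax Ru (\<Gamma> @ [(x, A)] @ \<Delta>)" "xpts_wf Ax Ru \<Delta>'"
    and \<Gamma>: "\<forall>y B. (y, B) \<in> set \<Gamma> \<longrightarrow> (\<exists>B'. (y, B') \<in> set \<Delta>' \<and> pconv B B')"
    and \<Delta>: "\<forall>y B. (y, B) \<in> set \<Delta> \<longrightarrow> (\<exists>B'. (y, B') \<in> set \<Delta>' \<and> pconv (subst B x P) B')"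
    and yB: "(y, B) \<in> set (\<Gamma> @ [(x, A)] @ \<Delta>)"
  shows "\<exists>B'. xpts_trm Ax Ru \<Delta>' ((PVar(x := P)) y) B' \<and> pconv B' (psubst (PVar(x := P)) B)"
proof -
  from xpts_wf_distinct[OF wf(1)] have x: "x \<notin> fst ` set \<Gamma>" "x \<notin> fst ` set \<Delta>" by auto
  from yB consider "y = x" "B = A" | "(y, B) \<in> set \<Gamma>" | "(y, B) \<in> set \<Delta>" by auto
  then show ?thesis
  proof cases
    case 1
    \<comment> \<open>Thinning cannot move \<open>P\<close> into \<open>\<Delta>'\<close>, whose
      types are merely convertible to those of \<open>\<Gamma>\<close>. The identity substitution
      can, as it tolerates conversion.\<close>
    have "xpts_trm Ax Ru \<Delta>' (psubst PVar P) (psubst PVar A)"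
    proof (rule xpts_subst_lemma[OF P wf(2)])
      fix z C assume "(z, C) \<in> set \<Gamma>"
      from \<Gamma>[rule_format, OF this] show "\<exists>D. xpts_trm Ax Ru \<Delta>' (PVar z) D \<and> pconv D (psubst PVar C)"
        using xpts_var[OF wf(2)] by (metis equivclp_sym psubst_id)
    qed
    moreover have "psubst (PVar(x := P)) A = A"
      using x xpts_fv(2)[OF P] by (subst psubst_upd_fresh) (auto simp: psubst_id)
    ultimately show ?thesis using 1 by (intro exI[of _ A]) (simp add: psubst_id)
  next
    case 2
    then have "y \<in> fst ` set \<Gamma>" by force
    then have "(PVar(x := P)) y = PVar y" using x by auto
    moreover have "fv_pts B \<subseteq> fst ` set \<Gamma>" using 2 xpts_fv(2)[OF P] by auto
    then have "psubst (PVar(x := P)) B = B" using x by (subst psubst_upd_fresh) (auto simp: psubst_id)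
    moreover obtain B' where "(y, B') \<in> set \<Delta>'" "pconv B B'" using \<Gamma>[rule_format, OF 2] by blast
    ultimately show ?thesis using xpts_var[OF wf(2)] equivclp_sym by metis
  next
    case 3
    then have "y \<in> fst ` set \<Delta>" by force
    then have "(PVar(x := P)) y = PVar y" using x by auto
    moreover obtain B' where "(y, B') \<in> set \<Delta>'" "pconv (psubst (PVar(x := P)) B) B'"
      using \<Delta>[rule_format, OF 3] unfolding subst_def by blast
    ultimately show ?thesis using xpts_var[OF wf(2)] equivclp_sym by metis
  qed
qed

lemma env_le_pt:
  assumes "env_le (\<Gamma> @ sub_env P x A \<Delta>) \<Delta>'"
  shows "\<forall>y B. (y, B) \<in> set (pt_env \<Gamma>) \<longrightarrow> (\<exists>B'. (y, B') \<in> set (pt_env \<Delta>') \<and> pconv B B')"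
    and "\<forall>y B. (y, B) \<in> set (pt_env \<Delta>) \<longrightarrow>
      (\<exists>B'. (y, B') \<in> set (pt_env \<Delta>') \<and> pconv (subst B x (pt_trm P)) B')"
proof (safe)
  fix y B assume "(y, B) \<in> set (pt_env \<Gamma>)"
  then obtain B0 where "(y, B0) \<in> set \<Gamma>" "B = pt_trm B0" by (auto simp: pt_env_def)
  moreover from this obtain B' where "(y, B') \<in> set \<Delta>'" "conv B0 B'"
    using assms by (auto simp: env_le_def)
  ultimately show "\<exists>B'. (y, B') \<in> set (pt_env \<Delta>') \<and> pconv B B'" using pt_env_mem pconv_pt by metis
next
  fix y B assume "(y, B) \<in> set (pt_env \<Delta>)"
  then obtain B0 where "(y, B0) \<in> set \<Delta>" "B = pt_trm B0" by (auto simp: pt_env_def)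
  moreover from this have "(y, SUB P x A B0) \<in> set (\<Gamma> @ sub_env P x A \<Delta>)" by (force simp: sub_env_def)
  then obtain B' where "(y, B') \<in> set \<Delta>'" "conv (SUB P x A B0) B'"
    using assms unfolding env_le_def by blast
  ultimately show "\<exists>B'. (y, B') \<in> set (pt_env \<Delta>') \<and> pconv (subst B x (pt_trm P)) B'"
    using pt_env_mem pconv_pt pt_SUB by metis
qed

text \<open>A list is not a PTS term, so its judgement becomes the typing of an application whose
  head is a fresh variable of the type \<open>C\<close> that the list consumes.\<close>

lemma pt_typing:
  "ptsc_wf Ax Ru \<Gamma> \<Longrightarrow> xpts_wf Ax Ru (pt_env \<Gamma>)"
  "ptsc_trm Ax Ru \<Gamma> M A \<Longrightarrow> xpts_trm Ax Ru (pt_env \<Gamma>) (pt_trm M) (pt_trm A)"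
  "ptsc_lst Ax Ru \<Gamma> C l B \<Longrightarrow> z \<notin> fst ` set \<Gamma> \<Longrightarrow>
    xpts_trm Ax Ru (pt_env \<Gamma> @ [(z, pt_trm C)]) (foldl PApp (PVar z) (pt_lst l)) (pt_trm B)"
proof (induction arbitrary: and and z rule: ptsc_wf_ptsc_trm_ptsc_lst.inducts)
  case wf_empty
  show ?case by (simp add: x_empty)
next
  case (wf_extend \<Gamma> A s x)
  then show ?case by (simp add: x_extend)
next
  case (ty_sort \<Gamma> s s')
  then show ?case by (simp add: x_sort)
next
  case (ty_pi \<Gamma> A s1 x B s2 s3)
  then show ?case by (simp add: x_pi pt_bind)
next
  case (ty_lam \<Gamma> x A B s M)
  then have M: "xpts_trm Ax Ru (pt_env \<Gamma> @ [(x, pt_trm A)]) (pt_trm M) (pt_trm B)"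
    and Pi: "xpts_trm Ax Ru (pt_env \<Gamma>) (PPI x (pt_trm A) (pt_trm B)) (PSort s)"
    by (simp_all add: pt_bind)
  from xpts_wf_snoc[OF xpts_trm_wf(2)[OF M]] obtain s1
    where "xpts_trm Ax Ru (pt_env \<Gamma>) (pt_trm A) (PSort s1)" by blast
  from x_lam[OF this Pi M] show ?case by (simp add: pt_bind)
next
  case (ty_var \<Gamma> A l B x)
  \<comment> \<open>The hypothesis on the list says nothing directly about \<open>\<Gamma>\<close>;
    its well-formedness is read off from the environment extended by a fresh head.\<close>
  obtain z where "z \<notin> fst ` set \<Gamma>" using ex_new_if_finite[of "fst ` set \<Gamma>"] by auto
  from xpts_trm_wf(2)[OF ty_var(2)[OF this]] xpts_wf_snoc xpts_trm_wf(2) have wf: "xpts_wf Ax Ru (pt_env \<Gamma>)"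
    by blast
  have "xpts_trm Ax Ru (pt_env \<Gamma>) (foldl PApp (PVar x) (pt_lst l)) (pt_trm B)"
    by (rule xpts_head_subst[OF _ xpts_var[OF wf pt_env_mem[OF ty_var(3)]] equivclp_refl wf, where \<Gamma> = "pt_env \<Gamma>"])
      (simp_all add: ty_var(2))
  then show ?case by simp
next
  case (ty_nil \<Gamma> A s)
  have "xpts_wf Ax Ru (pt_env \<Gamma> @ [(z, pt_trm A)])"
    by (rule x_extend[OF ty_nil(2)[unfolded pt_trm.simps(3)]]) (use ty_nil(3) in simp)
  then show ?case by (simp add: xpts_var)
next
  case (ty_conv \<Gamma> M A B s)
  then show ?case using x_conv[OF _ _ pconv_pt] by simp
next
  case (ty_cons \<Gamma> x A B s M l C)
  let ?\<Delta> = "pt_env \<Gamma> @ [(z, pt_trm (PI x A B))]"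
  have wf: "xpts_wf Ax Ru ?\<Delta>"
    by (rule x_extend[OF ty_cons(2)[unfolded pt_trm.simps(3)]]) (use ty_cons(7) in simp)
  have "xpts_trm Ax Ru ?\<Delta> (PVar z) (PPI x (pt_trm A) (pt_trm B))"
    using xpts_var[OF wf, of z] by (simp add: pt_bind)
  moreover have "xpts_trm Ax Ru ?\<Delta> (pt_trm M) (pt_trm A)"
    by (rule xpts_thinning[OF ty_cons(4) wf]) auto
  \<comment> \<open>Passing through the original PTS rule spares the extra premises of
    \<open>x_app\<close>, which \<open>pts_eq_xpts\<close> recovers.\<close>
  ultimately have "xpts_trm Ax Ru ?\<Delta> (PApp (PVar z) (pt_trm M)) (pt_trm (SUB M x A B))"
    unfolding pts_eq_xpts(2)[symmetric] pt_SUB by (rule pty_app)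
  from xpts_head_subst[where \<Gamma> = "pt_env \<Gamma>", OF _ this equivclp_refl wf] ty_cons(6)
  have "xpts_trm Ax Ru ?\<Delta> (foldl PApp (PApp (PVar z) (pt_trm M)) (pt_lst l)) (pt_trm C)"
    by (simp only: pt_env_simps set_append Un_upper1 simp_thms)
  then show ?case by simp
next
  case (ty_conv_right \<Gamma> C l A B s)
  note l = ty_conv_right(2)[OF ty_conv_right(6)]
  have "xpts_trm Ax Ru (pt_env \<Gamma> @ [(z, pt_trm C)]) (pt_trm B) (PSort s)"
    by (rule xpts_thinning[OF _ xpts_trm_wf(2)[OF l]]) (use ty_conv_right(4) in auto)
  with l show ?case using x_conv[OF _ _ pconv_pt[OF ty_conv_right(5)]] by simp
next
  case (ty_conv_left \<Gamma> A l C B s)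
  have wf: "xpts_wf Ax Ru (pt_env \<Gamma> @ [(z, pt_trm B)])"
    by (rule x_extend[OF ty_conv_left(4)[unfolded pt_trm.simps(3)]]) (use ty_conv_left(6) in simp)
  have "xpts_trm Ax Ru (pt_env \<Gamma> @ [(z, pt_trm B)]) (PVar z) (pt_trm B)"
    using xpts_var[OF wf] by simp
  from xpts_head_subst[where \<Gamma> = "pt_env \<Gamma>", OF _ this equivclp_sym[OF pconv_pt[OF ty_conv_left(5)]] wf] ty_conv_left(2)
  show ?case by (simp only: pt_env_simps set_append Un_upper1 simp_thms)
next
  case (ty_append \<Gamma> C l' A l B)
  note t = ty_append(2)[OF ty_append(5)]
  from xpts_head_subst[where \<Gamma> = "pt_env \<Gamma>", OF _ t equivclp_refl xpts_trm_wf(2)[OF t]] ty_append(4)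
  show ?case by (simp only: pt_env_simps set_append Un_upper1 simp_thms pt_lst.simps foldl_append)
next
  case (ty_subl \<Gamma> P A x \<Delta> B l C \<Delta>')
  let ?\<Xi> = "pt_env \<Gamma> @ [(x, pt_trm A)] @ pt_env \<Delta>" and ?\<sigma> = "PVar(x := pt_trm P)"
  let ?B = "psubst ?\<sigma> (pt_trm B)"
  let ?F = "fst ` set ?\<Xi> \<union> (\<Union>u\<in>set (pt_lst l). fv_pts u) \<union> fv_pts (pt_trm C)"
  \<comment> \<open>The induction hypothesis needs a head outside \<open>?\<Xi>\<close>, whereas
    \<open>z\<close> is only known to avoid \<open>\<Delta>'\<close>. So \<open>z'\<close> is used
    for the premise and \<open>?\<tau>\<close> sends it to \<open>z\<close> while substituting for
    \<open>x\<close>.\<close>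
  obtain z' where z': "z' \<notin> ?F" using ex_new_if_finite[of ?F] by auto
  then have l: "xpts_trm Ax Ru (?\<Xi> @ [(z', pt_trm B)]) (foldl PApp (PVar z') (pt_lst l)) (pt_trm C)"
    using ty_subl(4)[of z'] by (simp add: image_Un)
  from xpts_wf_snoc[OF xpts_trm_wf(2)[OF l]] obtain s where B: "xpts_trm Ax Ru ?\<Xi> (pt_trm B) (PSort s)" by blast
  note \<Xi> = xpts_trm_wf(2)[OF B]
  note ok = xpts_sub_env[OF ty_subl(2) \<Xi> ty_subl(6) env_le_pt[OF ty_subl(7)]]
  have "xpts_trm Ax Ru (pt_env \<Delta>') ?B (PSort s)"
    using xpts_subst_lemma[OF B ty_subl(6) ok] by (simp del: fun_upd_apply)
  from x_extend[OF this] ty_subl(8) have wf: "xpts_wf Ax Ru (pt_env \<Delta>' @ [(z, ?B)])" by simp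
  let ?\<tau> = "?\<sigma>(z' := PVar z)"
  have "xpts_trm Ax Ru (pt_env \<Delta>' @ [(z, ?B)]) (psubst ?\<tau> (foldl PApp (PVar z') (pt_lst l))) (psubst ?\<tau> (pt_trm C))"
  proof (rule xpts_subst_lemma[OF l wf])
    fix y D assume "(y, D) \<in> set (?\<Xi> @ [(z', pt_trm B)])"
    then consider "y = z'" "D = pt_trm B" | "(y, D) \<in> set ?\<Xi>" by auto
    then show "\<exists>E. xpts_trm Ax Ru (pt_env \<Delta>' @ [(z, ?B)]) (?\<tau> y) E \<and> pconv E (psubst ?\<tau> D)"
    proof cases
      case 1
      then have "psubst ?\<tau> D = ?B" using z' xpts_fv(2)[OF B] by (subst psubst_upd_fresh) auto
      then show ?thesis using 1 xpts_var[OF wf, of z ?B] by (intro exI[of _ ?B]) auto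
    next
      case 2
      then have "y \<in> fst ` set ?\<Xi>" by force
      then have "?\<tau> y = ?\<sigma> y" using z' by auto
      moreover have "fv_pts D \<subseteq> fst ` set ?\<Xi>" using 2 xpts_fv(1)[OF \<Xi>] by blast
      then have "psubst ?\<tau> D = psubst ?\<sigma> D" using z' by (intro psubst_upd_fresh) blast
      moreover obtain E where E: "xpts_trm Ax Ru (pt_env \<Delta>') (?\<sigma> y) E" "pconv E (psubst ?\<sigma> D)"
        using ok[OF 2] by blast
      moreover have "xpts_trm Ax Ru (pt_env \<Delta>' @ [(z, ?B)]) (?\<sigma> y) E"
        by (rule xpts_thinning[OF E(1) wf]) auto
      ultimately show ?thesis by (intro exI[of _ E]) (simp only: simp_thms)
    qed
  qed
  moreover have "map (psubst ?\<tau>) (pt_lst l) = map (psubst ?\<sigma>) (pt_lst l)"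
    using z' by (intro map_cong psubst_upd_fresh) auto
  moreover have "psubst ?\<tau> (pt_trm C) = psubst ?\<sigma> (pt_trm C)" using z' by (intro psubst_upd_fresh) auto
  moreover have "?\<tau> z' = PVar z" by simp
  ultimately show ?case
    unfolding pt_SUB pt_SUBL subst_def by (simp only: psubst_foldl psubst.simps)
next
  case (ty_app \<Gamma> M A l B)
  from xpts_head_subst[where \<Gamma> = "pt_env \<Gamma>", OF _ ty_app(2) equivclp_refl xpts_trm_wf(2)[OF ty_app(2)]] ty_app(4)
  show ?case by (simp only: pt_env_simps subset_refl pt_trm.simps simp_thms)
next
  case (ty_sub \<Gamma> P A x \<Delta> M C \<Delta>' C')
  have M: "xpts_trm Ax Ru (pt_env \<Gamma> @ [(x, pt_trm A)] @ pt_env \<Delta>) (pt_trm M) (pt_trm C)"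
    using ty_sub(4) by simp
  have "xpts_trm Ax Ru (pt_env \<Delta>') (subst (pt_trm M) x (pt_trm P)) (subst (pt_trm C) x (pt_trm P))"
    unfolding subst_def
    by (rule xpts_subst_lemma[OF M ty_sub(6) xpts_sub_env[OF ty_sub(2) xpts_trm_wf(2)[OF M] ty_sub(6) env_le_pt[OF ty_sub(7)]]])
  \<comment> \<open>Substitution fixes sorts, so both branches of the side condition have the same
    translation.\<close>
  moreover have "pt_trm C' = subst (pt_trm C) x (pt_trm P)"
    using ty_sub(8) by (auto simp: pt_SUB subst_def simp del: pt_trm.simps(6))
  ultimately show ?case by (simp only: pt_SUB)
qed

section \<open>Strong normalisation of PTSC terms\<close>

text \<open>Accessibility along reduction: unlike the absence of infinite sequences, it comes with
  an induction principle.\<close>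

inductive sn :: "('a \<Rightarrow> 'a \<Rightarrow> bool) \<Rightarrow> 'a \<Rightarrow> bool" for r where
  snI: "(\<And>y. r x y \<Longrightarrow> sn r y) \<Longrightarrow> sn r x"

lemma sn_iff: "strongly_normalising r x \<longleftrightarrow> sn r x"
proof
  assume *: "strongly_normalising r x"
  show "sn r x"
  proof (rule ccontr)
    assume "\<not> sn r x"
    have "\<exists>y. r z y \<and> \<not> sn r y" if "\<not> sn r z" for z using that snI[of r z] by blast
    then obtain g where g: "\<And>z. \<not> sn r z \<Longrightarrow> r z (g z) \<and> \<not> sn r (g z)" by metis
    define f where "f n = (g ^^ n) x" for n
    have "\<not> sn r (f n)" for n by (induction n) (use \<open>\<not> sn r x\<close> g in \<open>auto simp: f_def\<close>)
    then have "r (f n) (f (Suc n))" for n using g by (simp add: f_def)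
    moreover have "f 0 = x" by (simp add: f_def)
    ultimately show False using * unfolding strongly_normalising_def by blast
  qed
next
  assume "sn r x"
  then have "\<forall>f. f 0 = x \<longrightarrow> \<not> (\<forall>n. r (f n) (f (Suc n)))"
  proof induction
    case (snI x)
    show ?case
    proof (intro allI impI notI)
      fix f :: "nat \<Rightarrow> 'a" assume f: "f 0 = x" "\<forall>n. r (f n) (f (Suc n))"
      then have "r x (f 1)" by (metis One_nat_def)
      from snI.IH[OF this] f(2) show False by (auto dest!: spec[of _ "\<lambda>n. f (Suc n)"])
    qed
  qed
  then show "strongly_normalising r x" by (auto simp: strongly_normalising_def)
qed

lemma sn_pair_induct [consumes 2, case_names step]:
  assumes "sn r x" "sn q y"
    and step: "\<And>x y. (\<And>x'. r x x' \<Longrightarrow> P x' y) \<Longrightarrow> (\<And>y'. q y y' \<Longrightarrow> P x y') \<Longrightarrow> P x y"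
  shows "P x y"
  using assms(1,2)
proof (induction arbitrary: y)
  case (snI x)
  from snI.prems show ?case by induction (blast intro: step snI.IH sn.snI)
qed

section \<open>Beta-reduction combined with the subterm relation\<close>

inductive psubt :: "'s pts \<Rightarrow> 's pts \<Rightarrow> bool" where
  "psubt (PPi T U) T" | "psubt (PPi T U) U" | "psubt (PLam T t) T" | "psubt (PLam T t) t"
| "psubt (PApp t u) t" | "psubt (PApp t u) u"

definition dsub :: "'s pts \<Rightarrow> 's pts \<Rightarrow> bool" where
  "dsub t u \<longleftrightarrow> dbeta t u \<or> psubt t u"

text \<open>A \<beta>-step in a subterm can be carried out in place, so passing to a subterm can be
  postponed until after the step.\<close>

lemma psubt_dbeta: "psubt t u \<Longrightarrow> dbeta u v \<Longrightarrow> \<exists>t'. dbeta t t' \<and> psubt t' v"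
proof (induction rule: psubt.induct)
  case (1 T U)
  then show ?case using dbeta_pi_ty psubt.intros(1) by blast
next
  case (2 T U)
  then show ?case using dbeta_pi_body psubt.intros(2) by blast
next
  case (3 T t)
  then show ?case using dbeta_lam_ty psubt.intros(3) by blast
next
  case (4 T t)
  then show ?case using dbeta_lam_body psubt.intros(4) by blast
next
  case (5 t u)
  then show ?case using dbeta_app_left psubt.intros(5) by blast
next
  case (6 t u)
  then show ?case using dbeta_app_right psubt.intros(6) by blast
qed

lemma psubts_dbeta: "psubt\<^sup>*\<^sup>* t u \<Longrightarrow> dbeta u v \<Longrightarrow> \<exists>t'. dbeta t t' \<and> psubt\<^sup>*\<^sup>* t' v"
proof (induction arbitrary: v rule: rtranclp_induct)
  case (step u w)
  from psubt_dbeta[OF step(2,4)] obtain u' where "dbeta u u'" "psubt u' v" by blast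
  with step.IH[of u'] show ?case by (meson rtranclp.rtrancl_into_rtrancl)
qed auto

lemma psubt_size: "psubt t u \<Longrightarrow> size u < size t"
  by (erule psubt.cases) auto

text \<open>The claim concerns every subterm \<open>u\<close> of \<open>t\<close>: a \<beta>-step
  from \<open>u\<close> lifts to one from \<open>t\<close>, which advances the outer induction, and
  passing to a subterm decreases the size of \<open>u\<close>.\<close>

lemma sn_dsub_psubts: "sn dbeta t \<Longrightarrow> psubt\<^sup>*\<^sup>* t u \<Longrightarrow> sn dsub u"
proof (induction arbitrary: u rule: sn.induct)
  case (snI t)
  from snI.prems show ?case
  proof (induction u rule: measure_induct_rule[of size])
    case (less u)
    show ?case
    proof (rule sn.snI)
      fix v assume "dsub u v"
      then consider (beta) "dbeta u v" | (sub) "psubt u v" unfolding dsub_def by (elim disjE)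
      then show "sn dsub v"
      proof cases
        case beta
        from psubts_dbeta[OF less.prems this] obtain t' where t': "dbeta t t'" "psubt\<^sup>*\<^sup>* t' v"
          by (elim exE conjE)
        show ?thesis by (rule snI.IH[OF t'])
      next
        case sub
        show ?thesis
          by (rule less.IH[OF psubt_size[OF sub] rtranclp.rtrancl_into_rtrancl[OF less.prems sub]])
      qed
    qed
  qed
qed

lemma sn_dsub: "sn dbeta t \<Longrightarrow> sn dsub t"
  by (rule sn_dsub_psubts[OF _ rtranclp.rtrancl_refl])

section \<open>Termination together with that of the components\<close>

primrec trm_trms :: "'s trm \<Rightarrow> 's trm set" where
  "trm_trms (Pi A B) = {A, B}"
| "trm_trms (Lam A M) = {A, M}"
| "trm_trms (Sort s) = {}"
| "trm_trms (VApp x l) = {}"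
| "trm_trms (TApp M l) = {M}"
| "trm_trms (TSub N A M) = {N, A, M}"

primrec trm_lsts :: "'s trm \<Rightarrow> 's lst set" where
  "trm_lsts (Pi A B) = {}"
| "trm_lsts (Lam A M) = {}"
| "trm_lsts (Sort s) = {}"
| "trm_lsts (VApp x l) = {l}"
| "trm_lsts (TApp M l) = {l}"
| "trm_lsts (TSub N A M) = {}"

primrec lst_trms :: "'s lst \<Rightarrow> 's trm set" where
  "lst_trms LNil = {}"
| "lst_trms (LCons M l) = {M}"
| "lst_trms (LAppend l l') = {}"
| "lst_trms (LSub N A l) = {N, A}"

primrec lst_lsts :: "'s lst \<Rightarrow> 's lst set" where
  "lst_lsts LNil = {}"
| "lst_lsts (LCons M l) = {l}"
| "lst_lsts (LAppend l l') = {l, l'}"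
| "lst_lsts (LSub N A l) = {l}"

text \<open>One induction principle descends both to reducts and to immediate components. This is
  the form required by the propagation rules, which push a cut or a substitution from a term to its
  components, interleaved with arbitrary steps.\<close>

inductive sn_trm :: "'s trm \<Rightarrow> bool" and sn_lst :: "'s lst \<Rightarrow> bool" where
  sn_trmI: "\<lbrakk>\<And>M'. dred M M' \<Longrightarrow> sn_trm M'; \<And>N. N \<in> trm_trms M \<Longrightarrow> sn_trm N;
    \<And>l. l \<in> trm_lsts M \<Longrightarrow> sn_lst l\<rbrakk> \<Longrightarrow> sn_trm M"
| sn_lstI: "\<lbrakk>\<And>l'. dred_lst l l' \<Longrightarrow> sn_lst l'; \<And>N. N \<in> lst_trms l \<Longrightarrow> sn_trm N;
    \<And>k. k \<in> lst_lsts l \<Longrightarrow> sn_lst k\<rbrakk> \<Longrightarrow> sn_lst l"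

inductive_cases dred_cases:
  "dred (Pi A B) X" "dred (Lam A B) X" "dred (Sort s) X" "dred (VApp x l) X" "dred (TApp M l) X"
  "dred (TSub N A M) X"

inductive_cases dred_lst_cases:
  "dred_lst LNil X" "dred_lst (LCons M l) X" "dred_lst (LAppend l k) X" "dred_lst (LSub N A l) X"

lemma sn_trm_dred: "sn_trm M \<Longrightarrow> dred M M' \<Longrightarrow> sn_trm M'"
  by (erule sn_trm.cases) auto

lemma sn_lst_dred: "sn_lst l \<Longrightarrow> dred_lst l l' \<Longrightarrow> sn_lst l'"
  by (erule sn_lst.cases) auto

lemma sn_trm_subs:
  "sn_trm M \<Longrightarrow> N \<in> trm_trms M \<Longrightarrow> sn_trm N"
  "sn_trm M \<Longrightarrow> l \<in> trm_lsts M \<Longrightarrow> sn_lst l"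
  by (erule sn_trm.cases; auto)+

lemma sn_lst_subs:
  "sn_lst l \<Longrightarrow> N \<in> lst_trms l \<Longrightarrow> sn_trm N"
  "sn_lst l \<Longrightarrow> k \<in> lst_lsts l \<Longrightarrow> sn_lst k"
  by (erule sn_lst.cases; auto)+

lemma sn_trm_sn:
  fixes M :: "'s trm" and l :: "'s lst"
  shows "sn_trm M \<Longrightarrow> sn dred M" and "sn_lst l \<Longrightarrow> sn dred_lst l"
  by (induction rule: sn_trm_sn_lst.inducts) (auto intro: snI)

lemma sn_Sort: "sn_trm (Sort s)"
  by (rule sn_trmI) (auto elim: dred_cases)

lemma sn_LNil: "sn_lst LNil"
  by (rule sn_lstI) (auto elim: dred_lst_cases)

text \<open>\<open>K\<close> is \<open>Pi\<close> or \<open>Lam\<close>: neither has a rule at its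
  root, so each step lies in one component. The assumptions \<open>sn_trm\<close> are kept as
  implications because the induction runs over plain termination of the components.\<close>

lemma sn_abs:
  assumes K: "\<And>A B X. dred (K A B) X \<Longrightarrow>
      (\<exists>A'. dred A A' \<and> X = K A' B) \<or> (\<exists>B'. dred B B' \<and> X = K A B')"
    and subs: "\<And>A B. trm_trms (K A B) = {A, B}" "\<And>A B. trm_lsts (K A B) = {}"
    and AB: "sn_trm A" "sn_trm B"
  shows "sn_trm (K A B)"
proof -
  from AB[THEN sn_trm_sn(1)] have "sn_trm A \<longrightarrow> sn_trm B \<longrightarrow> sn_trm (K A B)"
  proof (induction rule: sn_pair_induct)
    case (step A B)
    show ?case
    proof (intro impI)
      assume sn: "sn_trm A" "sn_trm B"
      show "sn_trm (K A B)"
      proof (rule sn_trmI)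
        fix X assume "dred (K A B) X"
        from K[OF this] show "sn_trm X"
          using step sn_trm_dred[OF sn(1)] sn_trm_dred[OF sn(2)] sn by metis
      qed (use sn in \<open>simp_all add: subs, blast\<close>)
    qed
  qed
  then show ?thesis using AB by simp
qed

lemma sn_Pi: "sn_trm A \<Longrightarrow> sn_trm B \<Longrightarrow> sn_trm (Pi A B)"
  by (rule sn_abs[of Pi]) (erule dred_cases, simp_all)

lemma sn_Lam: "sn_trm A \<Longrightarrow> sn_trm B \<Longrightarrow> sn_trm (Lam A B)"
  by (rule sn_abs[of Lam]) (erule dred_cases, simp_all)

lemma sn_LCons:
  assumes Ml: "sn_trm M" "sn_lst l"
  shows "sn_lst (LCons M l)"
proof -
  from sn_trm_sn(1)[OF Ml(1)] sn_trm_sn(2)[OF Ml(2)] have "sn_trm M \<longrightarrow> sn_lst l \<longrightarrow> sn_lst (LCons M l)"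
  proof (induction rule: sn_pair_induct)
    case (step M l)
    show ?case
    proof (intro impI)
      assume sn: "sn_trm M" "sn_lst l"
      show "sn_lst (LCons M l)"
      proof (rule sn_lstI)
        fix X assume "dred_lst (LCons M l) X"
        then show "sn_lst X"
        proof (cases rule: dred_lst_cases(2)[consumes 1])
          case (1 M')
          with step(1)[OF 1(2)] sn_trm_dred[OF sn(1) 1(2)] sn show ?thesis by simp
        next
          case (2 l')
          with step(2)[OF 2(2)] sn_lst_dred[OF sn(2) 2(2)] sn show ?thesis by simp
        qed
      qed (use sn in simp_all)
    qed
  qed
  then show ?thesis using Ml by simp
qed

lemma sn_VApp:
  assumes "sn_lst l"
  shows "sn_trm (VApp x l)"
proof -
  from sn_trm_sn(2)[OF assms] assms show ?thesis
  proof induction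
    case (snI l)
    show ?case
    proof (rule sn_trmI)
      fix X assume "dred (VApp x l) X"
      then show "sn_trm X"
      proof (cases rule: dred_cases(4)[consumes 1])
        case (1 l')
        with snI.IH[OF 1(2)] sn_lst_dred[OF snI.prems 1(2)] show ?thesis by simp
      qed
    qed (use snI.prems in simp_all)
  qed
qed

text \<open>The second list is arbitrary in the induction on the first, since reassociation shortens
  the first at the price of lengthening the second. Steps inside the second list need a further
  induction on it.\<close>

lemma sn_LAppend:
  fixes M :: "'s trm" and l l' :: "'s lst"
  shows "sn_trm M \<Longrightarrow> True" and "sn_lst l \<Longrightarrow> sn_lst l' \<Longrightarrow> sn_lst (LAppend l l')"
proof (induction arbitrary: and l' rule: sn_trm_sn_lst.inducts)
  case (sn_lstI l)
  have l: "sn_lst l" by (rule sn_trm_sn_lst.sn_lstI) (use sn_lstI in blast)+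
  have red: "sn_lst (LAppend k l')" if "dred_lst l k" "sn_lst l'" for k l'
    using sn_lstI that by blast
  have sub: "sn_lst (LAppend k l')" if "k \<in> lst_lsts l" "sn_lst l'" for k l'
    using sn_lstI that by blast
  from sn_trm_sn(2)[OF \<open>sn_lst l'\<close>] \<open>sn_lst l'\<close> show ?case
  proof (induction rule: sn.induct)
    case (snI l')
    show ?case
    proof (rule sn_trm_sn_lst.sn_lstI)
      fix X assume "dred_lst (LAppend l l') X"
      then show "sn_lst X"
      proof (cases rule: dred_lst_cases(3)[consumes 1])
        case (1 M k)
        then have "sn_lst (LAppend k l')" "sn_trm M"
          using sub[OF _ snI.prems] sn_lst_subs(1)[OF l] by simp_all
        then show ?thesis using 1 by (simp add: sn_LCons)
      next
        case 2
        then show ?thesis using snI.prems by simp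
      next
        \<comment> \<open>Both \<open>k\<close> and \<open>k'\<close> are components of
          \<open>l\<close>: the hypothesis is used for \<open>k'\<close> first, and then for
          \<open>k\<close> with the new second list.\<close>
        case (3 k k')
        then have "sn_lst (LAppend k' l')" using sub[OF _ snI.prems] by simp
        then have "sn_lst (LAppend k (LAppend k' l'))" using 3 sub by simp
        then show ?thesis using 3 by simp
      next
        case 4
        then show ?thesis using l by simp
      next
        case (5 k)
        then show ?thesis using red[OF 5(2) snI.prems] by simp
      next
        case (6 k)
        then show ?thesis using snI.IH[OF 6(2)] sn_lst_dred[OF snI.prems 6(2)] by simp
      qed
    qed (use l snI.prems in auto)
  qed
qed simp

section \<open>Reduction and renaming\<close>

lemma ren_eq_iff:
  "ren_trm \<rho> M = Pi A B \<longleftrightarrow> (\<exists>A' B'. M = Pi A' B' \<and> A = ren_trm \<rho> A' \<and> B = ren_trm (up \<rho>) B')"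
  "ren_trm \<rho> M = Lam A B \<longleftrightarrow> (\<exists>A' B'. M = Lam A' B' \<and> A = ren_trm \<rho> A' \<and> B = ren_trm (up \<rho>) B')"
  "ren_trm \<rho> M = Sort s \<longleftrightarrow> M = Sort s"
  "ren_trm \<rho> M = VApp x l \<longleftrightarrow> (\<exists>x' l'. M = VApp x' l' \<and> x = \<rho> x' \<and> l = ren_lst \<rho> l')"
  "ren_trm \<rho> M = TApp N l \<longleftrightarrow> (\<exists>N' l'. M = TApp N' l' \<and> N = ren_trm \<rho> N' \<and> l = ren_lst \<rho> l')"
  "ren_lst \<rho> k = LNil \<longleftrightarrow> k = LNil"
  "ren_lst \<rho> k = LCons N l \<longleftrightarrow> (\<exists>N' l'. k = LCons N' l' \<and> N = ren_trm \<rho> N' \<and> l = ren_lst \<rho> l')"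
  "ren_lst \<rho> k = LAppend j l \<longleftrightarrow> (\<exists>j' l'. k = LAppend j' l' \<and> j = ren_lst \<rho> j' \<and> l = ren_lst \<rho> l')"
  by (cases M; auto; fail)+ (cases k; auto; fail)+

text \<open>A renaming creates no redex, even if it identifies variables: the only test made on a
  variable is whether it is the 0 of an enclosing substitution, and \<open>up\<close> sends only 0
  to 0.\<close>

lemma dred_ren_inv:
  fixes M :: "'s trm" and l :: "'s lst"
  shows "dred (ren_trm \<rho> M) X \<Longrightarrow> \<exists>M'. X = ren_trm \<rho> M' \<and> dred M M'"
    and "dred_lst (ren_lst \<rho> l) Y \<Longrightarrow> \<exists>l'. Y = ren_lst \<rho> l' \<and> dred_lst l l'"
proof (induction M and l arbitrary: \<rho> X and \<rho> Y)
  case (Pi A B)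
  from Pi.prems have "dred (Pi (ren_trm \<rho> A) (ren_trm (up \<rho>) B)) X" by simp
  then show ?case
    by (cases rule: dred_cases(1)[consumes 1]) (force dest: Pi.IH intro: d_pi_ty d_pi_body)+
next
  case (Lam A B)
  from Lam.prems have "dred (Lam (ren_trm \<rho> A) (ren_trm (up \<rho>) B)) X" by simp
  then show ?case
    by (cases rule: dred_cases(2)[consumes 1]) (force dest: Lam.IH intro: d_lam_ty d_lam_body)+
next
  case (Sort s)
  then show ?case by (auto elim: dred_cases)
next
  case (VApp x l)
  from VApp.prems have "dred (VApp (\<rho> x) (ren_lst \<rho> l)) X" by simp
  then show ?case
    by (cases rule: dred_cases(4)[consumes 1]) (force dest: VApp.IH intro: d_var)
next
  case (TApp M l)
  from TApp.prems have "dred (TApp (ren_trm \<rho> M) (ren_lst \<rho> l)) X" by simp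
  then show ?case
  proof (cases rule: dred_cases(5)[consumes 1])
    case (1 A M' N k)
    then obtain A0 M0 N0 k0 where "M = Lam A0 M0" "A = ren_trm \<rho> A0" "M' = ren_trm (up \<rho>) M0"
      "l = LCons N0 k0" "N = ren_trm \<rho> N0" "k = ren_lst \<rho> k0" by (auto simp: ren_eq_iff)
    with 1 show ?thesis by (intro exI[of _ "TApp (TSub N0 A0 M0) k0"]) (simp add: d_beta)
  next
    case 2
    then show ?thesis by (intro exI[of _ M]) (simp add: ren_eq_iff d_app_nil)
  next
    case (3 x k)
    then obtain x' k' where "M = VApp x' k'" "x = \<rho> x'" "k = ren_lst \<rho> k'" by (auto simp: ren_eq_iff)
    with 3 show ?thesis by (intro exI[of _ "VApp x' (LAppend k' l)"]) (simp add: d_app_var)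
  next
    case (4 N k)
    then obtain N' k' where "M = TApp N' k'" "N = ren_trm \<rho> N'" "k = ren_lst \<rho> k'" by (auto simp: ren_eq_iff)
    with 4 show ?thesis by (intro exI[of _ "TApp N' (LAppend k' l)"]) (simp add: d_app_app)
  next
    case (5 M')
    from TApp.IH(1)[OF 5(2)] obtain N0 where "M' = ren_trm \<rho> N0" "dred M N0" by blast
    with 5 show ?thesis by (intro exI[of _ "TApp N0 l"]) (simp add: d_app_head)
  next
    case (6 k)
    from TApp.IH(2)[OF 6(2)] obtain N0 where "k = ren_lst \<rho> N0" "dred_lst l N0" by blast
    with 6 show ?thesis by (intro exI[of _ "TApp M N0"]) (simp add: d_app_list)
  qed
next
  case (TSub P G M)
  from TSub.prems have "dred (TSub (ren_trm \<rho> P) (ren_trm \<rho> G) (ren_trm (up \<rho>) M)) X" by simp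
  then show ?case
  proof (cases rule: dred_cases(6)[consumes 1])
    case (1 A B)
    then obtain A' B' where "M = Lam A' B'" "A = ren_trm (up \<rho>) A'" "B = ren_trm (up (up \<rho>)) B'"
      by (auto simp: ren_eq_iff)
    with 1 show ?thesis
      by (intro exI[of _ "Lam (TSub P G A') (TSub (ren_trm Suc P) (ren_trm Suc G) (ren_trm swp B'))"])
        (simp add: d_sub_lam ren_comp up_Suc swp_up)
  next
    case (2 l)
    then obtain x l' where "M = VApp x l'" "up \<rho> x = 0" "l = ren_lst (up \<rho>) l'" by (auto simp: ren_eq_iff)
    then have "M = VApp 0 l'" by (cases x) auto
    with 2 \<open>l = _\<close> show ?thesis by (intro exI[of _ "TApp P (LSub P G l')"]) (simp add: d_sub_var_eq)
  next
    case (3 x l)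
    then obtain y l' where "M = VApp y l'" "up \<rho> y = Suc x" "l = ren_lst (up \<rho>) l'" by (auto simp: ren_eq_iff)
    then obtain x' where "M = VApp (Suc x') l'" "x = \<rho> x'" by (cases y) auto
    with 3 \<open>l = _\<close> show ?thesis by (intro exI[of _ "VApp x' (LSub P G l')"]) (simp add: d_sub_var_neq)
  next
    case (4 N l)
    then obtain N' l' where "M = TApp N' l'" "N = ren_trm (up \<rho>) N'" "l = ren_lst (up \<rho>) l'"
      by (auto simp: ren_eq_iff)
    with 4 show ?thesis by (intro exI[of _ "TApp (TSub P G N') (LSub P G l')"]) (simp add: d_sub_app)
  next
    case (5 A B)
    then obtain A' B' where "M = Pi A' B'" "A = ren_trm (up \<rho>) A'" "B = ren_trm (up (up \<rho>)) B'"
      by (auto simp: ren_eq_iff)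
    with 5 show ?thesis
      by (intro exI[of _ "Pi (TSub P G A') (TSub (ren_trm Suc P) (ren_trm Suc G) (ren_trm swp B'))"])
        (simp add: d_sub_pi ren_comp up_Suc swp_up)
  next
    case (6 s)
    then show ?thesis by (intro exI[of _ "Sort s"]) (simp add: ren_eq_iff d_sub_sort)
  next
    case (7 P')
    from TSub.IH(1)[OF 7(2)] obtain N0 where "P' = ren_trm \<rho> N0" "dred P N0" by blast
    with 7 show ?thesis by (intro exI[of _ "TSub N0 G M"]) (simp add: d_sub_arg)
  next
    case (8 G')
    from TSub.IH(2)[OF 8(2)] obtain N0 where "G' = ren_trm \<rho> N0" "dred G N0" by blast
    with 8 show ?thesis by (intro exI[of _ "TSub P N0 M"]) (simp add: d_sub_ty)
  next
    case (9 M')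
    from TSub.IH(3)[OF 9(2)] obtain N0 where "M' = ren_trm (up \<rho>) N0" "dred M N0" by blast
    with 9 show ?thesis by (intro exI[of _ "TSub P G N0"]) (simp add: d_sub_body)
  qed
next
  case LNil
  then show ?case by (auto elim: dred_lst_cases)
next
  case (LCons M l)
  from LCons.prems have "dred_lst (LCons (ren_trm \<rho> M) (ren_lst \<rho> l)) Y" by simp
  then show ?case
    by (cases rule: dred_lst_cases(2)[consumes 1]) (force dest: LCons.IH intro: d_cons_head d_cons_tail)+
next
  case (LAppend l k)
  from LAppend.prems have "dred_lst (LAppend (ren_lst \<rho> l) (ren_lst \<rho> k)) Y" by simp
  then show ?case
  proof (cases rule: dred_lst_cases(3)[consumes 1])
    case (1 M l1)
    then obtain M' l1' where "l = LCons M' l1'" "M = ren_trm \<rho> M'" "l1 = ren_lst \<rho> l1'"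
      by (auto simp: ren_eq_iff)
    with 1 show ?thesis by (intro exI[of _ "LCons M' (LAppend l1' k)"]) (simp add: d_append_cons)
  next
    case 2
    then show ?thesis by (intro exI[of _ k]) (simp add: ren_eq_iff d_append_nil_left)
  next
    case (3 l1 l2)
    then obtain l1' l2' where "l = LAppend l1' l2'" "l1 = ren_lst \<rho> l1'" "l2 = ren_lst \<rho> l2'"
      by (auto simp: ren_eq_iff)
    with 3 show ?thesis by (intro exI[of _ "LAppend l1' (LAppend l2' k)"]) (simp add: d_append_assoc)
  next
    case 4
    then show ?thesis by (intro exI[of _ l]) (simp add: ren_eq_iff d_append_nil_right)
  next
    case (5 l')
    from LAppend.IH(1)[OF 5(2)] obtain N0 where "l' = ren_lst \<rho> N0" "dred_lst l N0" by blast
    with 5 show ?thesis by (intro exI[of _ "LAppend N0 k"]) (simp add: d_append_left)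
  next
    case (6 k')
    from LAppend.IH(2)[OF 6(2)] obtain N0 where "k' = ren_lst \<rho> N0" "dred_lst k N0" by blast
    with 6 show ?thesis by (intro exI[of _ "LAppend l N0"]) (simp add: d_append_right)
  qed
next
  case (LSub P G l)
  from LSub.prems have "dred_lst (LSub (ren_trm \<rho> P) (ren_trm \<rho> G) (ren_lst (up \<rho>) l)) Y" by simp
  then show ?case
  proof (cases rule: dred_lst_cases(4)[consumes 1])
    case 1
    then show ?thesis by (intro exI[of _ LNil]) (simp add: ren_eq_iff d_sub_nil)
  next
    case (2 M k)
    then obtain M' k' where "l = LCons M' k'" "M = ren_trm (up \<rho>) M'" "k = ren_lst (up \<rho>) k'"
      by (auto simp: ren_eq_iff)
    with 2 show ?thesis by (intro exI[of _ "LCons (TSub P G M') (LSub P G k')"]) (simp add: d_sub_cons)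
  next
    case (3 k k2)
    then obtain k' k2' where "l = LAppend k' k2'" "k = ren_lst (up \<rho>) k'" "k2 = ren_lst (up \<rho>) k2'"
      by (auto simp: ren_eq_iff)
    with 3 show ?thesis by (intro exI[of _ "LAppend (LSub P G k') (LSub P G k2')"]) (simp add: d_sub_append)
  next
    case (4 P')
    from LSub.IH(1)[OF 4(2)] obtain N0 where "P' = ren_trm \<rho> N0" "dred P N0" by blast
    with 4 show ?thesis by (intro exI[of _ "LSub N0 G l"]) (simp add: d_subl_arg)
  next
    case (5 G')
    from LSub.IH(2)[OF 5(2)] obtain N0 where "G' = ren_trm \<rho> N0" "dred G N0" by blast
    with 5 show ?thesis by (intro exI[of _ "LSub P N0 l"]) (simp add: d_subl_ty)
  next
    case (6 l')
    from LSub.IH(3)[OF 6(2)] obtain N0 where "l' = ren_lst (up \<rho>) N0" "dred_lst l N0" by blast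
    with 6 show ?thesis by (intro exI[of _ "LSub P G N0"]) (simp add: d_subl_body)
  qed
qed

lemma subs_ren:
  "N \<in> trm_trms (ren_trm \<rho> M) \<Longrightarrow> \<exists>N' \<rho>'. N = ren_trm \<rho>' N' \<and> N' \<in> trm_trms M"
  "l \<in> trm_lsts (ren_trm \<rho> M) \<Longrightarrow> \<exists>l'. l = ren_lst \<rho> l' \<and> l' \<in> trm_lsts M"
  "N \<in> lst_trms (ren_lst \<rho> k) \<Longrightarrow> \<exists>N'. N = ren_trm \<rho> N' \<and> N' \<in> lst_trms k"
  "l \<in> lst_lsts (ren_lst \<rho> k) \<Longrightarrow> \<exists>l' \<rho>'. l = ren_lst \<rho>' l' \<and> l' \<in> lst_lsts k"
  by (cases M; auto; fail)+ (cases k; auto; fail)+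

lemma sn_ren:
  fixes M :: "'s trm" and l :: "'s lst"
  shows "sn_trm M \<Longrightarrow> sn_trm (ren_trm \<rho> M)" and "sn_lst l \<Longrightarrow> sn_lst (ren_lst \<rho> l)"
proof (induction arbitrary: \<rho> and \<rho> rule: sn_trm_sn_lst.inducts)
  case (sn_trmI M)
  show ?case
    by (rule sn_trm_sn_lst.sn_trmI) (use sn_trmI in \<open>blast dest: dred_ren_inv subs_ren\<close>)+
next
  case (sn_lstI l)
  show ?case
    by (rule sn_trm_sn_lst.sn_lstI) (use sn_lstI in \<open>blast dest: dred_ren_inv subs_ren\<close>)+
qed

section \<open>Termination of applications and explicit substitutions\<close>

abbreviation dsubs :: "'s pts \<Rightarrow> 's pts \<Rightarrow> bool" where
  "dsubs \<equiv> dsub\<^sup>*\<^sup>*"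

lemma dbeta_dsubs: "dbeta\<^sup>*\<^sup>* t u \<Longrightarrow> dsubs t u"
  by (erule rtranclp_mono[THEN predicate2D, rotated]) (auto simp: dsub_def)

lemma psubt_dsubs: "psubt t u \<Longrightarrow> dsubs t u"
  by (auto simp: dsub_def)

lemma dsubs_simps [simp]:
  "dsubs (PPi T U) T" "dsubs (PPi T U) U" "dsubs (PLam T t) T" "dsubs (PLam T t) t"
  by (intro psubt_dsubs psubt.intros)+

lemma dsubs_foldl_head: "dsubs (foldl PApp h ls) h"
proof (induction ls rule: rev_induct)
  case (snoc u ls)
  have "dsubs (PApp (foldl PApp h ls) u) (foldl PApp h ls)"
    by (intro psubt_dsubs psubt.intros)
  from rtranclp_trans[OF this snoc] show ?case by simp
qed simp

lemma dsubs_foldl_arg: "u \<in> set ls \<Longrightarrow> dsubs (foldl PApp h ls) u"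
proof (induction ls rule: rev_induct)
  case (snoc v ls)
  have "dsubs (PApp (foldl PApp h ls) v) (foldl PApp h ls)" "dsubs (PApp (foldl PApp h ls) v) v"
    by (intro psubt_dsubs psubt.intros)+
  with snoc show ?case using rtranclp_trans[of dsub _ "foldl PApp h ls" u] by auto
qed simp

text \<open>The bound \<open>t\<close> on the translations is the outer induction parameter: the root \<open>\<beta>\<close>-step moves
  strictly below it, whereas all other steps stay (weakly) below it and are handled by induction on the
  components.\<close>

definition cut_ok :: "'s pts \<Rightarrow> bool" where
  "cut_ok t \<longleftrightarrow> (\<forall>(M :: 's trm) l. dsubs t (pt_trm (TApp M l)) \<longrightarrow> sn_trm M \<longrightarrow> sn_lst l \<longrightarrow> sn_trm (TApp M l))"

definition sub_ok :: "'s pts \<Rightarrow> bool" where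
  "sub_ok t \<longleftrightarrow> (\<forall>(P :: 's trm) G M. dsubs t (pt_trm (TSub P G M)) \<longrightarrow>
    sn_trm P \<longrightarrow> sn_trm G \<longrightarrow> sn_trm M \<longrightarrow> sn_trm (TSub P G M))"

text \<open>A list translates to several terms, so the bound is imposed on each argument.\<close>

definition subl_ok :: "'s pts \<Rightarrow> bool" where
  "subl_ok t \<longleftrightarrow> (\<forall>(P :: 's trm) G l. (\<forall>u\<in>set (pt_lst (LSub P G l)). dsubs t u) \<longrightarrow>
    sn_trm P \<longrightarrow> sn_trm G \<longrightarrow> sn_lst l \<longrightarrow> sn_lst (LSub P G l))"

lemma cut_okD: "cut_ok t \<Longrightarrow> dsubs t (pt_trm (TApp M l)) \<Longrightarrow> sn_trm M \<Longrightarrow> sn_lst l \<Longrightarrow> sn_trm (TApp M l)"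
  unfolding cut_ok_def by blast

lemma sub_okD: "sub_ok t \<Longrightarrow> dsubs t (pt_trm (TSub P G M)) \<Longrightarrow> sn_trm P \<Longrightarrow> sn_trm G \<Longrightarrow> sn_trm M \<Longrightarrow>
    sn_trm (TSub P G M)"
  unfolding sub_ok_def by blast

text \<open>Induction on \<open>M\<close> with \<open>l\<close> arbitrary, then on \<open>l\<close>:
  flattening an application of an application passes to a component of \<open>M\<close> but enlarges
  the list. A root \<beta>-step escapes both inductions and is paid for by the strictly smaller
  bound.\<close>

lemma cut_ok_step:
  fixes t :: "'s pts"
  assumes IH: "\<And>t'. dsub\<^sup>+\<^sup>+ t t' \<Longrightarrow> cut_ok t'" "\<And>t'. dsub\<^sup>+\<^sup>+ t t' \<Longrightarrow> sub_ok t'"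
  shows "cut_ok t"
proof -
  have "sn_trm M \<Longrightarrow> dsubs t (pt_trm (TApp M l)) \<Longrightarrow> sn_lst l \<Longrightarrow> sn_trm (TApp M l)"
    and "sn_lst k \<Longrightarrow> True"
    for M :: "'s trm" and l k :: "'s lst"
  proof (induction arbitrary: l and rule: sn_trm_sn_lst.inducts)
    case (sn_trmI M)
    have M: "sn_trm M" by (rule sn_trm_sn_lst.sn_trmI[OF sn_trmI(1-3)])
    have red: "sn_trm (TApp M' l)" if "dred M M'" "dsubs t (pt_trm (TApp M' l))" "sn_lst l" for M' l
      by (rule sn_trmI(4)[OF that])
    have sub: "sn_trm (TApp N l)" if "N \<in> trm_trms M" "dsubs t (pt_trm (TApp N l))" "sn_lst l" for N l
      by (rule sn_trmI(5)[OF that])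
    from sn_trm_sn(2)[OF \<open>sn_lst l\<close>] \<open>sn_lst l\<close> \<open>dsubs t (pt_trm (TApp M l))\<close> show ?case
    proof (induction rule: sn.induct)
      case (snI l)
      have step: "dsubs t (pt_trm X)" if "dred (TApp M l) X" for X
        using snI.prems(2) dbeta_dsubs[OF pt_dred(1)[OF that]] by (rule rtranclp_trans)
      show ?case
      proof (rule sn_trm_sn_lst.sn_trmI)
        fix X assume X: "dred (TApp M l) X"
        then show "sn_trm X"
        proof (cases rule: dred_cases(5)[consumes 1])
          case (1 A N' N k)
          have "dsub (pt_trm (TApp M l)) (pt_trm X)"
            using 1 by (simp add: dsub_def dbeta_foldl_head dbeta_redex)
          with snI.prems(2) have tX: "dsub\<^sup>+\<^sup>+ t (pt_trm X)" by (rule rtranclp_into_tranclp1)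
          \<comment> \<open>The new substitution is the head of the reduct \<open>X\<close>, so it
            also lies strictly below \<open>t\<close>. The hypotheses then apply first to it and
            afterwards to its application to \<open>k\<close>.\<close>
          have "dsubs (pt_trm X) (pt_trm (TSub N A N'))"
            using 1 by (simp add: dsubs_foldl_head)
          with tX have "dsub\<^sup>+\<^sup>+ t (pt_trm (TSub N A N'))" by (rule tranclp_rtranclp_tranclp)
          moreover have "sn_trm N" "sn_trm A" "sn_trm N'" "sn_lst k"
            using 1 sn_trm_subs[OF M] sn_lst_subs[OF snI.prems(1)] by simp_all
          ultimately have "sn_trm (TSub N A N')" by (intro sub_okD[OF IH(2) rtranclp.rtrancl_refl])
          moreover have "dsubs (pt_trm X) (pt_trm (TApp (TSub N A N') k))"
            unfolding 1(1) by (rule rtranclp.rtrancl_refl)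
          ultimately have "sn_trm (TApp (TSub N A N') k)"
            using \<open>sn_lst k\<close> by (intro cut_okD[OF IH(1)[OF tX]])
          then show ?thesis using 1 by simp
        next
          case 2
          then show ?thesis using M by simp
        next
          case (3 x k)
          then have "sn_lst k" using sn_trm_subs(2)[OF M] by simp
          then show ?thesis using 3 snI.prems(1) by (simp add: sn_VApp sn_LAppend)
        next
          \<comment> \<open>The translation is unchanged here; what decreases is the passage from
            \<open>M\<close> to its component \<open>N\<close>.\<close>
          case (4 N k)
          then have "sn_lst k" using sn_trm_subs(2)[OF M] by simp
          then have "sn_lst (LAppend k l)" using snI.prems(1) by (rule sn_LAppend)
          then show ?thesis using sub[of N "LAppend k l"] step[OF X] 4 by simp
        next
          case (5 M')
          then show ?thesis using red[OF 5(2)] step[OF X] snI.prems(1) by simp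
        next
          case (6 k)
          then show ?thesis
            using snI.IH[OF 6(2)] sn_lst_dred[OF snI.prems(1) 6(2)] step[OF X] by simp
        qed
      qed (use M snI.prems in simp_all)
    qed
  qed simp
  then show ?thesis unfolding cut_ok_def by blast
qed

text \<open>Entering a binder permutes the variables of the body and weakens \<open>P\<close> and
  \<open>G\<close>, so the induction is on \<open>M\<close> up to a renaming, with \<open>P\<close>
  and \<open>G\<close> arbitrary. The rules for the substituted variable and for applications create
  cuts whose translation is still below \<open>t\<close>, which is why \<open>cut_ok\<close> is
  needed at the same bound.\<close>

lemma sub_ok_step:
  fixes t :: "'s pts"
  assumes cut: "cut_ok t"
  shows "sub_ok t" "subl_ok t"
proof -
  have "sn_trm M \<Longrightarrow> dsubs t (pt_trm (TSub P G (ren_trm \<rho> M))) \<Longrightarrow> sn_trm P \<Longrightarrow> sn_trm G \<Longrightarrow>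
      sn_trm (TSub P G (ren_trm \<rho> M))"
    and "sn_lst l \<Longrightarrow> \<forall>u\<in>set (pt_lst (LSub P G (ren_lst \<rho> l))). dsubs t u \<Longrightarrow> sn_trm P \<Longrightarrow> sn_trm G \<Longrightarrow>
      sn_lst (LSub P G (ren_lst \<rho> l))"
    for P G M :: "'s trm" and l :: "'s lst" and \<rho>
  proof (induction arbitrary: P G \<rho> and P G \<rho> rule: sn_trm_sn_lst.inducts)
    case (sn_trmI M)
    have M: "sn_trm (ren_trm \<rho> M)"
      by (rule sn_ren(1)[OF sn_trm_sn_lst.sn_trmI[OF sn_trmI(1-3)]])
    have red: "sn_trm (TSub P G (ren_trm \<rho> M'))"
      if "dred M M'" "dsubs t (pt_trm (TSub P G (ren_trm \<rho> M')))" "sn_trm P" "sn_trm G" for M' P G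
      by (rule sn_trmI(4)[OF that])
    have sub: "sn_trm (TSub P G (ren_trm \<rho> N))"
      if "N \<in> trm_trms M" "dsubs t (pt_trm (TSub P G (ren_trm \<rho> N)))" "sn_trm P" "sn_trm G" for N P G \<rho>
      by (rule sn_trmI(5)[OF that])
    have subl: "sn_lst (LSub P G (ren_lst \<rho> l))"
      if "l \<in> trm_lsts M" "\<forall>u\<in>set (pt_lst (LSub P G (ren_lst \<rho> l))). dsubs t u" "sn_trm P" "sn_trm G" for l P G \<rho>
      by (rule sn_trmI(6)[OF that])
    \<comment> \<open>A step in \<open>P\<close> or \<open>G\<close> keeps \<open>M\<close> and
      possibly the translation, so it calls for an induction of its own.\<close>
    have "sn dred P" "sn dred G" using sn_trmI(8,9) by (auto intro: sn_trm_sn)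
    then have "sn_trm P \<longrightarrow> sn_trm G \<longrightarrow> dsubs t (pt_trm (TSub P G (ren_trm \<rho> M))) \<longrightarrow>
        sn_trm (TSub P G (ren_trm \<rho> M))"
    proof (induction rule: sn_pair_induct)
      case (step P G)
      show ?case
      proof (intro impI)
        assume sn: "sn_trm P" "sn_trm G" and t: "dsubs t (pt_trm (TSub P G (ren_trm \<rho> M)))"
        have tX: "dsubs t (pt_trm X)" if "dred (TSub P G (ren_trm \<rho> M)) X" for X
          using t dbeta_dsubs[OF pt_dred(1)[OF that]] by (rule rtranclp_trans)
        \<comment> \<open>For the body of a binder the renaming becomes
          \<open>swp \<circ> up \<rho>\<close>, and the hypothesis for its component is taken with
          the weakened \<open>P\<close> and \<open>G\<close>.\<close>
        have abs: "sn_trm (TSub P G A) \<and> sn_trm (TSub (ren_trm Suc P) (ren_trm Suc G) (ren_trm swp N))"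
          if "trm_trms M = {A', N'}" "A = ren_trm \<rho> A'" "N = ren_trm (up \<rho>) N'"
            and tA: "dsubs t (pt_trm (TSub P G A))"
            and tN: "dsubs t (pt_trm (TSub (ren_trm Suc P) (ren_trm Suc G) (ren_trm swp N)))"
          for A N A' N'
          using that sub[of A' P G \<rho>] sub[of N' "ren_trm Suc P" "ren_trm Suc G" "swp \<circ> up \<rho>"] sn
          by (simp add: ren_comp sn_ren)
        show "sn_trm (TSub P G (ren_trm \<rho> M))"
        proof (rule sn_trm_sn_lst.sn_trmI)
          fix X assume X: "dred (TSub P G (ren_trm \<rho> M)) X"
          note tX = tX[OF X]
          from X show "sn_trm X"
          proof (cases rule: dred_cases(6)[consumes 1])
            case (1 A N)
            then obtain A' N' where *: "M = Lam A' N'" "A = ren_trm \<rho> A'" "N = ren_trm (up \<rho>) N'"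
              by (auto simp: ren_eq_iff)
            have "dsubs t (pt_trm (TSub P G A))"
              "dsubs t (pt_trm (TSub (ren_trm Suc P) (ren_trm Suc G) (ren_trm swp N)))"
              by (rule rtranclp_trans[OF tX], simp add: 1)+
            with abs[of A' N' A N] * 1 show ?thesis by (simp add: sn_Lam)
          next
            case (2 k)
            then obtain x k' where *: "M = VApp x k'" "k = ren_lst \<rho> k'" "\<rho> x = 0"
              by (auto simp: ren_eq_iff)
            have "\<forall>u\<in>set (pt_lst (LSub P G k)). dsubs t u"
              by (intro ballI rtranclp_trans[OF tX]) (simp add: 2 dsubs_foldl_arg)
            with subl[of k' P G \<rho>] * sn have "sn_lst (LSub P G k)" by simp
            with cut_okD[OF cut _ sn(1), of "LSub P G k"] tX 2 show ?thesis by simp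
          next
            case (3 x k)
            then obtain y k' where *: "M = VApp y k'" "k = ren_lst \<rho> k'"
              by (auto simp: ren_eq_iff)
            have "\<forall>u\<in>set (pt_lst (LSub P G k)). dsubs t u"
              by (intro ballI rtranclp_trans[OF tX]) (simp add: 3 dsubs_foldl_arg)
            with subl[of k' P G \<rho>] * sn have "sn_lst (LSub P G k)" by simp
            with 3 show ?thesis by (simp add: sn_VApp)
          next
            case (4 N k)
            then obtain N' k' where *: "M = TApp N' k'" "N = ren_trm \<rho> N'" "k = ren_lst \<rho> k'"
              by (auto simp: ren_eq_iff)
            have "\<forall>u\<in>set (pt_lst (LSub P G k)). dsubs t u"
              by (intro ballI rtranclp_trans[OF tX]) (simp add: 4 dsubs_foldl_arg)
            moreover have "dsubs t (pt_trm (TSub P G N))"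
              by (rule rtranclp_trans[OF tX]) (simp add: 4 dsubs_foldl_head)
            ultimately have "sn_lst (LSub P G k)" "sn_trm (TSub P G N)"
              using subl[of k' P G \<rho>] sub[of N' P G \<rho>] * sn by simp_all
            with cut_okD[OF cut, of "TSub P G N" "LSub P G k"] tX 4 show ?thesis by simp
          next
            case (5 A N)
            then obtain A' N' where *: "M = Pi A' N'" "A = ren_trm \<rho> A'" "N = ren_trm (up \<rho>) N'"
              by (auto simp: ren_eq_iff)
            have "dsubs t (pt_trm (TSub P G A))"
              "dsubs t (pt_trm (TSub (ren_trm Suc P) (ren_trm Suc G) (ren_trm swp N)))"
              by (rule rtranclp_trans[OF tX], simp add: 5)+
            with abs[of A' N' A N] * 5 show ?thesis by (simp add: sn_Pi)
          next
            case (6 s)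
            then show ?thesis by (simp add: sn_Sort)
          next
            case (7 P')
            then show ?thesis using step(1)[OF 7(2)] sn_trm_dred[OF sn(1) 7(2)] sn tX by simp
          next
            case (8 G')
            then show ?thesis using step(2)[OF 8(2)] sn_trm_dred[OF sn(2) 8(2)] sn tX by simp
          next
            case (9 N)
            from dred_ren_inv(1)[OF 9(2)] obtain M' where "N = ren_trm \<rho> M'" "dred M M'" by blast
            then show ?thesis using red[of M' P G] tX 9 sn by simp
          qed
        qed (use sn M in auto)
      qed
    qed
    then show ?case using sn_trmI(7-9) by blast
  next
    case (sn_lstI l)
    have l: "sn_lst (ren_lst \<rho> l)"
      by (rule sn_ren(2)[OF sn_trm_sn_lst.sn_lstI[OF sn_lstI(1-3)]])
    have red: "sn_lst (LSub P G (ren_lst \<rho> l'))"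
      if "dred_lst l l'" "\<forall>u\<in>set (pt_lst (LSub P G (ren_lst \<rho> l'))). dsubs t u" "sn_trm P" "sn_trm G" for l' P G
      by (rule sn_lstI(4)[OF that])
    have sub: "sn_trm (TSub P G (ren_trm \<rho> N))"
      if "N \<in> lst_trms l" "dsubs t (pt_trm (TSub P G (ren_trm \<rho> N)))" "sn_trm P" "sn_trm G" for N P G
      by (rule sn_lstI(5)[OF that])
    have subl: "sn_lst (LSub P G (ren_lst \<rho> k))"
      if "k \<in> lst_lsts l" "\<forall>u\<in>set (pt_lst (LSub P G (ren_lst \<rho> k))). dsubs t u" "sn_trm P" "sn_trm G" for k P G
      by (rule sn_lstI(6)[OF that])
    have "sn dred P" "sn dred G" using sn_lstI(8,9) by (auto intro: sn_trm_sn)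
    then have "sn_trm P \<longrightarrow> sn_trm G \<longrightarrow> (\<forall>u\<in>set (pt_lst (LSub P G (ren_lst \<rho> l))). dsubs t u) \<longrightarrow>
        sn_lst (LSub P G (ren_lst \<rho> l))"
    proof (induction rule: sn_pair_induct)
      case (step P G)
      show ?case
      proof (intro impI)
        assume sn: "sn_trm P" "sn_trm G" and t: "\<forall>u\<in>set (pt_lst (LSub P G (ren_lst \<rho> l))). dsubs t u"
        show "sn_lst (LSub P G (ren_lst \<rho> l))"
        proof (rule sn_trm_sn_lst.sn_lstI)
          fix X assume X: "dred_lst (LSub P G (ren_lst \<rho> l)) X"
          have tX: "\<forall>u\<in>set (pt_lst X). dsubs t u"
          proof
            fix u assume "u \<in> set (pt_lst X)"
            with pt_dred(2)[OF X] obtain v where "v \<in> set (pt_lst (LSub P G (ren_lst \<rho> l)))" "dbeta\<^sup>*\<^sup>* v u"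
              unfolding list_all2_conv_all_nth in_set_conv_nth by metis
            then show "dsubs t u" using t dbeta_dsubs rtranclp_trans by metis
          qed
          from X show "sn_lst X"
          proof (cases rule: dred_lst_cases(4)[consumes 1])
            case 1
            then show ?thesis by (simp add: sn_LNil)
          next
            case (2 N k)
            then obtain N' k' where *: "l = LCons N' k'" "N = ren_trm \<rho> N'" "k = ren_lst \<rho> k'"
              by (auto simp: ren_eq_iff)
            with subl[of k' P G] sub[of N' P G] tX 2 sn
            have "sn_lst (LSub P G k)" "sn_trm (TSub P G N)" by simp_all
            with 2 show ?thesis by (simp add: sn_LCons)
          next
            case (3 j k)
            then obtain j' k' where *: "l = LAppend j' k'" "j = ren_lst \<rho> j'" "k = ren_lst \<rho> k'"
              by (auto simp: ren_eq_iff)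
            with subl[of k' P G] subl[of j' P G] tX 3 sn
            have "sn_lst (LSub P G k)" "sn_lst (LSub P G j)" by (simp_all add: ball_Un)
            with 3 show ?thesis by (simp add: sn_LAppend)
          next
            case (4 P')
            then show ?thesis using step(1)[OF 4(2)] sn_trm_dred[OF sn(1) 4(2)] sn tX by simp
          next
            case (5 G')
            then show ?thesis using step(2)[OF 5(2)] sn_trm_dred[OF sn(2) 5(2)] sn tX by simp
          next
            case (6 k)
            from dred_ren_inv(2)[OF 6(2)] obtain l' where "k = ren_lst \<rho> l'" "dred_lst l l'" by blast
            then show ?thesis using red[of l' P G] tX 6 sn by simp
          qed
        qed (use sn l in auto)
      qed
    qed
    then show ?case using sn_lstI(7-9) by blast
  qed
  note * = this[of _ _ _ id, unfolded ren_id]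
  show "sub_ok t" "subl_ok t" unfolding sub_ok_def subl_ok_def using * by blast+
qed

lemma ok_mono:
  assumes "dsubs t u"
  shows "cut_ok t \<Longrightarrow> cut_ok u" "sub_ok t \<Longrightarrow> sub_ok u"
proof -
  assume "cut_ok t"
  then show "cut_ok u"
    unfolding cut_ok_def[of u] by (intro allI impI cut_okD[OF _ rtranclp_trans[OF assms]])
next
  assume "sub_ok t"
  then show "sub_ok u"
    unfolding sub_ok_def[of u] by (intro allI impI sub_okD[OF _ rtranclp_trans[OF assms]])
qed

text \<open>Applications come first, using both claims at strictly smaller bounds; substitutions
  then follow at the same bound, as the cuts they create are bounded by \<open>t\<close>
  itself.\<close>

lemma cut_sub_ok:
  assumes "sn dsub t"
  shows "cut_ok t \<and> sub_ok t \<and> subl_ok t"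
  using assms
proof (induction rule: sn.induct)
  case (snI t)
  have ok: "cut_ok t'" "sub_ok t'" if t': "dsub\<^sup>+\<^sup>+ t t'" for t'
  proof -
    \<comment> \<open>The induction hypothesis covers a single step from \<open>t\<close>; the
      remaining steps are absorbed by \<open>ok_mono\<close>.\<close>
    from tranclpD[OF t'] obtain t1 where t1: "dsub t t1" "dsubs t1 t'" by (elim exE conjE)
    from snI.IH[OF t1(1)] ok_mono[OF t1(2)] show "cut_ok t'" "sub_ok t'" by simp_all
  qed
  have "cut_ok t" by (rule cut_ok_step[OF ok])
  with sub_ok_step[OF this] show ?case by simp
qed

lemma sn_TApp: "sn dsub (pt_trm (TApp M l)) \<Longrightarrow> sn_trm M \<Longrightarrow> sn_lst l \<Longrightarrow> sn_trm (TApp M l)"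
  by (rule cut_okD[OF conjunct1[OF cut_sub_ok] rtranclp.rtrancl_refl])

lemma sn_TSub:
  "sn dsub (pt_trm (TSub P G M)) \<Longrightarrow> sn_trm P \<Longrightarrow> sn_trm G \<Longrightarrow> sn_trm M \<Longrightarrow> sn_trm (TSub P G M)"
  by (rule sub_okD[OF conjunct1[OF conjunct2[OF cut_sub_ok]] rtranclp.rtrancl_refl])

text \<open>The head \<open>h\<close> is arbitrary: a typed list is known to the PTS only through an
  application, and its arguments are subterms of that application.\<close>

lemma sn_LSub:
  assumes "sn dsub (foldl PApp h (pt_lst (LSub P G l)))" "sn_trm P" "sn_trm G" "sn_lst l"
  shows "sn_lst (LSub P G l)"
proof -
  have "\<forall>u\<in>set (pt_lst (LSub P G l)). dsubs (foldl PApp h (pt_lst (LSub P G l))) u"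
    by (intro ballI dsubs_foldl_arg)
  then show ?thesis using cut_sub_ok[OF assms(1)] assms(2-4) unfolding subl_ok_def by simp
qed

section \<open>Termination of typed PTSC terms\<close>

lemma sn_bind: "sn_trm M \<Longrightarrow> sn_trm (bind_trm x M)" "sn_lst l \<Longrightarrow> sn_lst (bind_lst x l)"
  unfolding bind_trm_def bind_lst_def by (rule sn_ren, assumption)+

text \<open>The types in the environment are included for the sake of annotations: that of an
  explicit substitution is obtained from the environment
  \<open>\<Gamma> @ [(x, A)] @ \<Delta>\<close> of the body.\<close>

lemma ptsc_sn:
  assumes PTS: "\<And>\<Gamma> t T. xpts_trm Ax Ru \<Gamma> t T \<Longrightarrow> sn dsub t"
  shows "ptsc_wf Ax Ru \<Gamma> \<Longrightarrow> \<forall>(x, A) \<in> set \<Gamma>. sn_trm A"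
    and "ptsc_trm Ax Ru \<Gamma> M A \<Longrightarrow> sn_trm M \<and> (\<forall>(x, A) \<in> set \<Gamma>. sn_trm A)"
    and "ptsc_lst Ax Ru \<Gamma> C l B \<Longrightarrow> sn_lst l \<and> (\<forall>(x, A) \<in> set \<Gamma>. sn_trm A)"
proof (induction rule: ptsc_wf_ptsc_trm_ptsc_lst.inducts)
  case (ty_subl \<Gamma> P A x \<Delta> B l C \<Delta>')
  obtain z where "z \<notin> fst ` set \<Delta>'" using ex_new_if_finite[of "fst ` set \<Delta>'"] by auto
  \<comment> \<open>The rule is applied again to type the substituted list itself, whose translation
    is then part of a typed PTS term and provides the bound.\<close>
  from pt_typing(3)[OF ptsc_wf_ptsc_trm_ptsc_lst.ty_subl[OF ty_subl(1,3,7,5)] this]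
  have "sn dsub (foldl PApp (PVar z) (pt_lst (SUBL P x A l)))" by (rule PTS)
  from sn_LSub[OF this] ty_subl(2,4,6) show ?case by (simp add: sn_bind)
next
  case (ty_app \<Gamma> M A l B)
  from PTS[OF pt_typing(2)[OF ptsc_wf_ptsc_trm_ptsc_lst.ty_app[OF ty_app(1,3)]]]
  have "sn dsub (pt_trm (TApp M l))" .
  from sn_TApp[OF this] ty_app(2,4) show ?case by simp
next
  case (ty_sub \<Gamma> P A x \<Delta> M C \<Delta>' C')
  from PTS[OF pt_typing(2)[OF ptsc_wf_ptsc_trm_ptsc_lst.ty_sub[OF ty_sub(1,3,7,5,8)]]]
  have "sn dsub (pt_trm (SUB P x A M))" .
  from sn_TSub[OF this] ty_sub(2,4,6) show ?case by (simp add: sn_bind)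
qed (auto simp: sn_bind sn_Sort sn_Pi sn_Lam sn_VApp sn_LNil sn_LCons sn_LAppend)

lemma PTS_SN_imp_PTSC_SN:
  assumes "PTS_SN Ax Ru"
  shows "PTSC_SN Ax Ru"
  unfolding PTSC_SN_def
proof (intro allI impI)
  fix \<Gamma> M A assume M: "ptsc_trm Ax Ru \<Gamma> M A"
  have "sn dsub t" if "xpts_trm Ax Ru \<Gamma> t T" for \<Gamma> t T
    using that assms unfolding PTS_SN_def pts_eq_xpts(2) sn_iff pbeta_eq_dbeta by (intro sn_dsub) blast
  then have "sn_trm M \<and> (\<forall>(x, A) \<in> set \<Gamma>. sn_trm A)" by (rule ptsc_sn(2)[OF _ M])
  then show "strongly_normalising red M" unfolding sn_iff red_eq_dred by (simp add: sn_trm_sn(1))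
qed

section \<open>From PTS to PTSC\<close>

primrec bt :: "'s pts \<Rightarrow> 's trm" where
  "bt (PVar x) = VApp x LNil"
| "bt (PSort s) = Sort s"
| "bt (PPi T U) = Pi (bt T) (bt U)"
| "bt (PLam T t) = Lam (bt T) (bt t)"
| "bt (PApp t u) = TApp (bt t) (LCons (bt u) LNil)"

definition bt_env :: "'s penv \<Rightarrow> 's env" where
  "bt_env \<Gamma> = map (\<lambda>(x, A). (x, bt A)) \<Gamma>"

lemma bt_env_simps [simp]:
  "bt_env [] = []" "bt_env (\<Gamma> @ [(x, A)]) = bt_env \<Gamma> @ [(x, bt A)]"
  "fst ` set (bt_env \<Gamma>) = fst ` set \<Gamma>"
  by (simp_all add: bt_env_def image_image case_prod_unfold)

lemma bt_ren: "bt (ren_pts \<rho> t) = ren_trm \<rho> (bt t)"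
  by (induction t arbitrary: \<rho>) simp_all

lemma bt_bind: "bt (bind_pts x t) = bind_trm x (bt t)"
  by (simp add: bind_pts_def bind_trm_def bt_ren)

section \<open>Simulation of beta-reduction in PTSC\<close>

lemma dred_star_TApp:
  assumes "dred\<^sup>*\<^sup>* M M'" "dred_lst\<^sup>*\<^sup>* l l'"
  shows "dred\<^sup>*\<^sup>* (TApp M l) (TApp M' l')"
proof -
  have "dred\<^sup>*\<^sup>* (TApp M l) (TApp M' l)"
    by (rule rtranclp_map[OF assms(1)]) (rule d_app_head)
  also have "dred\<^sup>*\<^sup>* (TApp M' l) (TApp M' l')"
    by (rule rtranclp_map[OF assms(2)]) (rule d_app_list)
  finally show ?thesis .
qed

lemma dred_star_Pi:
  assumes "dred\<^sup>*\<^sup>* A A'" "dred\<^sup>*\<^sup>* B B'"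
  shows "dred\<^sup>*\<^sup>* (Pi A B) (Pi A' B')"
proof -
  have "dred\<^sup>*\<^sup>* (Pi A B) (Pi A' B)"
    by (rule rtranclp_map[OF assms(1)]) (rule d_pi_ty)
  also have "dred\<^sup>*\<^sup>* (Pi A' B) (Pi A' B')"
    by (rule rtranclp_map[OF assms(2)]) (rule d_pi_body)
  finally show ?thesis .
qed

lemma dred_star_Lam:
  assumes "dred\<^sup>*\<^sup>* A A'" "dred\<^sup>*\<^sup>* B B'"
  shows "dred\<^sup>*\<^sup>* (Lam A B) (Lam A' B')"
proof -
  have "dred\<^sup>*\<^sup>* (Lam A B) (Lam A' B)"
    by (rule rtranclp_map[OF assms(1)]) (rule d_lam_ty)
  also have "dred\<^sup>*\<^sup>* (Lam A' B) (Lam A' B')"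
    by (rule rtranclp_map[OF assms(2)]) (rule d_lam_body)
  finally show ?thesis .
qed

text \<open>Induction on the size, as the substitution meets the body of a binder permuted by
  \<open>swp\<close>: this is no longer a subterm but has the same size.\<close>

lemma bt_inst: "dred\<^sup>*\<^sup>* (TSub (bt u) G (bt t)) (bt (psubst (inst u) t))"
proof (induction t arbitrary: u G rule: measure_induct_rule[of size])
  case (less t)
  have body: "dred\<^sup>*\<^sup>* (TSub (ren_trm Suc (bt u)) (ren_trm Suc G) (ren_trm swp (bt U)))
      (bt (psubst (up_subst (inst u)) U))" if "size U < size t" for U
    using less.IH[of "ren_pts swp U" "ren_pts Suc u" "ren_trm Suc G"] that
    by (simp add: bt_ren psubst_up_inst)
  show ?case
  proof (cases t)
    case (PVar x)
    show ?thesis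
    proof (cases x)
      case 0
      have "dred\<^sup>*\<^sup>* (TSub (bt u) G (VApp 0 LNil)) (TApp (bt u) (LSub (bt u) G LNil))"
        by (intro r_into_rtranclp d_sub_var_eq)
      also have "dred\<^sup>*\<^sup>* \<dots> (TApp (bt u) LNil)"
        by (intro r_into_rtranclp d_app_list d_sub_nil)
      also have "dred\<^sup>*\<^sup>* \<dots> (bt u)" by (intro r_into_rtranclp d_app_nil)
      finally show ?thesis using PVar 0 by simp
    next
      case (Suc n)
      have "dred\<^sup>*\<^sup>* (TSub (bt u) G (VApp (Suc n) LNil)) (VApp n (LSub (bt u) G LNil))"
        by (intro r_into_rtranclp d_sub_var_neq)
      also have "dred\<^sup>*\<^sup>* \<dots> (VApp n LNil)" by (intro r_into_rtranclp d_var d_sub_nil)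
      finally show ?thesis using PVar Suc by simp
    qed
  next
    case (PSort s)
    then show ?thesis by (simp add: r_into_rtranclp d_sub_sort)
  next
    case (PPi T U)
    have "dred\<^sup>*\<^sup>* (TSub (bt u) G (bt t))
        (Pi (TSub (bt u) G (bt T)) (TSub (ren_trm Suc (bt u)) (ren_trm Suc G) (ren_trm swp (bt U))))"
      unfolding PPi bt.simps by (rule r_into_rtranclp, rule d_sub_pi)
    also have "dred\<^sup>*\<^sup>* \<dots> (Pi (bt (psubst (inst u) T)) (bt (psubst (up_subst (inst u)) U)))"
      by (intro dred_star_Pi body less.IH) (simp_all add: PPi)
    finally show ?thesis by (simp add: PPi)
  next
    case (PLam T U)
    have "dred\<^sup>*\<^sup>* (TSub (bt u) G (bt t))
        (Lam (TSub (bt u) G (bt T)) (TSub (ren_trm Suc (bt u)) (ren_trm Suc G) (ren_trm swp (bt U))))"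
      unfolding PLam bt.simps by (rule r_into_rtranclp, rule d_sub_lam)
    also have "dred\<^sup>*\<^sup>* \<dots> (Lam (bt (psubst (inst u) T)) (bt (psubst (up_subst (inst u)) U)))"
      by (intro dred_star_Lam body less.IH) (simp_all add: PLam)
    finally show ?thesis by (simp add: PLam)
  next
    case (PApp t1 t2)
    have "dred_lst\<^sup>*\<^sup>* (LSub (bt u) G (LCons (bt t2) LNil))
        (LCons (TSub (bt u) G (bt t2)) (LSub (bt u) G LNil))"
      by (intro r_into_rtranclp d_sub_cons)
    also have "dred_lst\<^sup>*\<^sup>* \<dots> (LCons (TSub (bt u) G (bt t2)) LNil)"
      by (intro r_into_rtranclp d_cons_tail d_sub_nil)
    also have "dred_lst\<^sup>*\<^sup>* \<dots> (LCons (bt (psubst (inst u) t2)) LNil)"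
      by (rule rtranclp_map[where f = "\<lambda>M. LCons M LNil"], rule less.IH, simp add: PApp, rule d_cons_head)
    finally have l: "dred_lst\<^sup>*\<^sup>* (LSub (bt u) G (LCons (bt t2) LNil)) (LCons (bt (psubst (inst u) t2)) LNil)" .
    have "dred\<^sup>*\<^sup>* (TSub (bt u) G (bt t)) (TApp (TSub (bt u) G (bt t1)) (LSub (bt u) G (LCons (bt t2) LNil)))"
      unfolding PApp bt.simps by (rule r_into_rtranclp, rule d_sub_app)
    also have "dred\<^sup>*\<^sup>* \<dots> (TApp (bt (psubst (inst u) t1)) (LCons (bt (psubst (inst u) t2)) LNil))"
      by (intro dred_star_TApp l less.IH) (simp add: PApp)
    finally show ?thesis by (simp add: PApp)
  qed
qed

lemma tranclp_map:
  assumes "r\<^sup>+\<^sup>+ x y" "\<And>x y. r x y \<Longrightarrow> q (f x) (f y)"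
  shows "q\<^sup>+\<^sup>+ (f x) (f y)"
  using assms(1)
proof induction
  case (base y)
  then show ?case by (intro tranclp.r_into_trancl assms(2))
next
  case (step y z)
  from step(3) assms(2)[OF step(2)] show ?case by (rule tranclp.trancl_into_trancl)
qed

lemma bt_dbeta: "dbeta t u \<Longrightarrow> dred\<^sup>+\<^sup>+ (bt t) (bt u)"
proof (induction rule: dbeta.induct)
  \<comment> \<open>The \<beta>-rule leaves an application to the exhausted list, which is dropped
    before the substitution is carried out.\<close>
  case (dbeta_redex v t u)
  have "dred\<^sup>*\<^sup>* (TApp (TSub (bt u) (bt v) (bt t)) LNil) (TSub (bt u) (bt v) (bt t))"
    by (intro r_into_rtranclp d_app_nil)
  also note bt_inst
  finally have "dred\<^sup>*\<^sup>* (TApp (TSub (bt u) (bt v) (bt t)) LNil) (bt (psubst (inst u) t))" .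
  with d_beta show ?case unfolding bt.simps by (rule rtranclp_into_tranclp2)
next
  case (dbeta_pi_ty T T' t)
  show ?case unfolding bt.simps by (rule tranclp_map[OF dbeta_pi_ty.IH]) (rule d_pi_ty)
next
  case (dbeta_pi_body t t' T)
  show ?case unfolding bt.simps by (rule tranclp_map[OF dbeta_pi_body.IH]) (rule d_pi_body)
next
  case (dbeta_lam_ty T T' t)
  show ?case unfolding bt.simps by (rule tranclp_map[OF dbeta_lam_ty.IH]) (rule d_lam_ty)
next
  case (dbeta_lam_body t t' T)
  show ?case unfolding bt.simps by (rule tranclp_map[OF dbeta_lam_body.IH]) (rule d_lam_body)
next
  case (dbeta_app_left t t' u)
  show ?case unfolding bt.simps by (rule tranclp_map[OF dbeta_app_left.IH]) (rule d_app_head)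
next
  case (dbeta_app_right u u' t)
  show ?case unfolding bt.simps
    by (rule tranclp_map[OF dbeta_app_right.IH]) (intro d_app_list d_cons_head)
qed

lemma pconv_bt: "pconv t u \<Longrightarrow> conv (bt t) (bt u)"
  unfolding pbeta_eq_dbeta red_eq_dred
  by (erule equivclp_map) (rule rtranclp_into_equivclp[OF tranclp_into_rtranclp[OF bt_dbeta]])

text \<open>Well-formedness accompanies the second claim because typing an explicit substitution in
  the application case asks for it.\<close>

lemma bt_typing:
  "xpts_wf Ax Ru \<Gamma> \<Longrightarrow> ptsc_wf Ax Ru (bt_env \<Gamma>)"
  "xpts_trm Ax Ru \<Gamma> t T \<Longrightarrow> ptsc_wf Ax Ru (bt_env \<Gamma>) \<and> ptsc_trm Ax Ru (bt_env \<Gamma>) (bt t) (bt T)"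
proof (induction rule: xpts_wf_xpts_trm.inducts)
  case x_empty
  show ?case by (simp add: wf_empty)
next
  case (x_extend \<Gamma> T s x)
  then have "ptsc_trm Ax Ru (bt_env \<Gamma>) (bt T) (Sort s)" "x \<notin> fst ` set (bt_env \<Gamma>)" by simp_all
  then have "ptsc_wf Ax Ru (bt_env \<Gamma> @ [(x, bt T)])" by (rule wf_extend)
  then show ?case by simp
next
  case (x_var \<Gamma> x T s)
  have "(x, bt T) \<in> set (bt_env \<Gamma>)" using x_var(5) by (force simp: bt_env_def)
  moreover have "ptsc_trm Ax Ru (bt_env \<Gamma>) (bt T) (Sort s)" using x_var(4) by simp
  ultimately have "ptsc_trm Ax Ru (bt_env \<Gamma>) (VApp x LNil) (bt T)" by (intro ty_var[OF ty_nil])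
  with x_var(2) show ?case by simp
next
  case (x_sort \<Gamma> s s')
  then show ?case by (simp add: ty_sort)
next
  case (x_pi \<Gamma> U s1 x T s2 s3)
  then have "ptsc_trm Ax Ru (bt_env \<Gamma>) (PI x (bt U) (bt T)) (Sort s3)"
    by (intro ty_pi[OF _ _ x_pi(5)]) simp_all
  with x_pi(2) show ?case by (simp add: bt_bind)
next
  case (x_lam \<Gamma> U s1 x T s t)
  then have "ptsc_trm Ax Ru (bt_env \<Gamma>) (LAM x (bt U) (bt t)) (PI x (bt U) (bt T))"
    by (intro ty_lam[of _ _ _ _ _ _ s]) (simp_all add: bt_bind)
  with x_lam(2) show ?case by (simp add: bt_bind)
next
  case (x_app \<Gamma> U s1 x T s2 s u t)
  \<comment> \<open>The list rule produces the explicit substitution \<open>?V\<close>, while the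
    PTS type is the executed one. The former gets its sort from \<open>ty_sub\<close>, the latter
    from an extra premise of \<open>x_app\<close>, and \<open>ty_conv_left\<close> joins the
    two.\<close>
  let ?\<Gamma> = "bt_env \<Gamma>" and ?V = "SUB (bt u) x (bt U) (bt T)"
  have wf: "ptsc_wf Ax Ru ?\<Gamma>" and T: "ptsc_trm Ax Ru (?\<Gamma> @ [(x, bt U)]) (bt T) (Sort s2)"
    and Pi: "ptsc_trm Ax Ru ?\<Gamma> (PI x (bt U) (bt T)) (Sort s)"
    and V: "ptsc_trm Ax Ru ?\<Gamma> (bt (subst T x u)) (Sort s2)"
    and t: "ptsc_trm Ax Ru ?\<Gamma> (bt t) (PI x (bt U) (bt T))" and u: "ptsc_trm Ax Ru ?\<Gamma> (bt u) (bt U)"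
    using x_app(2,4,6,8,10,12) by (simp_all add: bt_bind)
  have "env_le (?\<Gamma> @ sub_env (bt u) x (bt U) []) ?\<Gamma>"
    unfolding env_le_def sub_env_def list.map append_Nil2
    by (intro allI impI exI conjI, assumption, rule equivclp_refl)
  moreover have "ptsc_trm Ax Ru (?\<Gamma> @ [(x, bt U)] @ []) (bt T) (Sort s2)" using T by simp
  \<comment> \<open>The type of \<open>bt T\<close> is a sort and so escapes the substitution, which
    leaves \<open>?V\<close> typed by a sort as conversion demands.\<close>
  moreover have "Sort s2 = (if Sort s2 \<in> range Sort then Sort s2 else SUB (bt u) x (bt U) (Sort s2))"
    by (rule if_P[OF rangeI, symmetric])
  ultimately have "ptsc_trm Ax Ru ?\<Gamma> ?V (Sort s2)" by (intro ty_sub[OF u _ _ wf])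
  moreover have "conv ?V (bt (subst T x u))"
    using rtranclp_into_equivclp[OF bt_inst[of u "bt U" "bind_pts x T"]]
    unfolding red_eq_dred bt_bind psubst_bind .
  then have "conv (bt (subst T x u)) ?V" by (rule equivclp_sym)
  ultimately have "ptsc_lst Ax Ru ?\<Gamma> ?V LNil (bt (subst T x u))"
    by (rule ty_conv_left[OF ty_nil[OF V]])
  from ty_app[OF t ty_cons[OF Pi u this]] wf show ?case by simp
next
  case (x_conv \<Gamma> t U V s)
  then have "ptsc_trm Ax Ru (bt_env \<Gamma>) (bt t) (bt V)"
    by (intro ty_conv[OF _ _ pconv_bt[OF x_conv(5)], of _ _ _ _ s]) simp_all
  with x_conv(2) show ?case by simp
qed

section \<open>Transfer of termination along the simulation\<close>

lemma sn_tranclp: "sn r x \<Longrightarrow> sn r\<^sup>+\<^sup>+ x"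
proof (induction rule: sn.induct)
  case (snI x)
  show ?case
  proof (rule sn.snI)
    fix y assume "r\<^sup>+\<^sup>+ x y"
    from tranclpD[OF this] obtain z where z: "r x z" "r\<^sup>*\<^sup>* z y" by (elim exE conjE)
    from rtranclpD[OF z(2)] snI.IH[OF z(1)] show "sn r\<^sup>+\<^sup>+ y" by (auto elim: sn.cases)
  qed
qed

lemma sn_simulation:
  assumes "sn r (f x)" and sim: "\<And>x x'. q x x' \<Longrightarrow> r (f x) (f x')"
  shows "sn q x"
  using assms(1)
proof (induction "f x" arbitrary: x rule: sn.induct)
  case snI
  show ?case
  proof (rule sn.snI)
    fix x' assume "q x x'"
    from sim[OF this] show "sn q x'" by (rule snI(2))
  qed
qed

lemma PTSC_SN_imp_PTS_SN:
  assumes "PTSC_SN Ax Ru"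
  shows "PTS_SN Ax Ru"
  unfolding PTS_SN_def
proof (intro allI impI)
  fix \<Gamma> t T assume "pts_trm Ax Ru \<Gamma> t T"
  then have "ptsc_trm Ax Ru (bt_env \<Gamma>) (bt t) (bt T)" 
    unfolding pts_eq_xpts(2) by (rule bt_typing(2)[THEN conjunct2])
  with assms have "strongly_normalising red (bt t)" unfolding PTSC_SN_def by (elim allE impE)
  then have "sn dred\<^sup>+\<^sup>+ (bt t)" unfolding sn_iff red_eq_dred by (rule sn_tranclp)
  then have "sn dbeta t" by (rule sn_simulation[where f = bt]) (rule bt_dbeta)
  then show "strongly_normalising pbeta t" unfolding sn_iff pbeta_eq_dbeta .
qed

theorem theorem4p5:
  fixes Ax :: "('s \<times> 's) set" and Ru :: "('s \<times> 's \<times> 's) set"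
  shows "PTSC_SN Ax Ru \<longleftrightarrow> PTS_SN Ax Ru"
  using PTS_SN_imp_PTSC_SN PTSC_SN_imp_PTS_SN by blast

end
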